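(* Let $\mathcal D$ be a dyadic grid of intervals in $\mathbb R$ and let $w:\mathbb R\to\mathbb R$ be a $C^2$ function such that for every $r>1$ there is a constant $C_r$ with $|w(x)|\le C_r(1+|x|)^{-r}$ for all $x\in\mathbb R$. For $I\in\mathcal D$ with center $c_I$ and length $|I|$ put $w_I(x)=|I|^{-1/2}\,w\big((x-c_I)/|I|\big)$, and assume that $\{w_I: I\in\mathcal D\}$ is an orthonormal basis of $L^2(\mathbb R)$. Let $S$ be the wavelet square function given by $$(Sf)^2=\sum_{I\in\mathcal D}\langle f,w_I\rangle^2\,w_I^2 .$$ Then there is a constant $\eta>0$ such that for all measurable sets $V\subset\mathbb R$ of finite measure, $$\int_V (S\mathbf 1_V)^2\,dx\ \ge\ \eta\,|V| .$$
   Context: A dyadic grid is a collection of half-open intervals of lengths $2^k$, $k\in\mathbb Z$, such that for each $k$ the intervals of length $2^k$ partition $\mathbb R$ and each interval of length $2^{k+1}$ is the union of two intervals of length $2^k$ of the collection (for example the standard dyadic intervals $[j2^k,(j+1)2^k)$). $|\cdot|$ denotes Lebesgue measure, $\mathbf 1_V$ the indicator function of $V$, and $\langle f,g\rangle=\int_{\mathbb R} f g\,dx$. *)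

theory Defs
  imports "HOL-Analysis.Analysis"
begin

text \<open>Intervals are subsets of the real line; both kinds of half-open intervals are admitted
  (the partition property forces all intervals of a grid to be of the same kind).\<close>

definition half_open_interval :: "real set \<Rightarrow> bool" where
  "half_open_interval I \<longleftrightarrow> (\<exists>a b. a < b \<and> (I = {a..<b} \<or> I = {a<..b}))"

abbreviation ilength :: "real set \<Rightarrow> real" where
  "ilength I \<equiv> measure lebesgue I"

definition icenter :: "real set \<Rightarrow> real" where
  "icenter I = (Inf I + Sup I) / 2"

lemma ilength_half_open [simp]:
  "a < b \<Longrightarrow> ilength {a..<b} = b - a" "a < b \<Longrightarrow> ilength {a<..b} = b - a"
  by (simp_all)

lemma icenter_half_open [simp]:
  "a < b \<Longrightarrow> icenter {a..<b} = (a + b) / 2" "a < b \<Longrightarrow> icenter {a<..b} = (a + b) / 2"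
  by (simp_all add: icenter_def)

definition dyadic_grid :: "real set set \<Rightarrow> bool" where
  "dyadic_grid D \<longleftrightarrow>
     (\<forall>I\<in>D. half_open_interval I \<and> (\<exists>k::int. ilength I = 2 powi k)) \<and>
     (\<forall>k::int. partition_on UNIV {I\<in>D. ilength I = 2 powi k}) \<and>
     (\<forall>k::int. \<forall>I\<in>D. ilength I = 2 powi (k + 1) \<longrightarrow>
        (\<exists>J\<in>D. \<exists>K\<in>D. ilength J = 2 powi k \<and> ilength K = 2 powi k \<and> I = J \<union> K))"

definition C2_function :: "(real \<Rightarrow> real) \<Rightarrow> bool" where
  "C2_function f \<longleftrightarrow>
     (\<exists>f' f''. (\<forall>x. (f has_real_derivative f' x) (at x)) \<and>
               (\<forall>x. (f' has_real_derivative f'' x) (at x)) \<and>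
               continuous_on UNIV f'')"

definition wavelet :: "(real \<Rightarrow> real) \<Rightarrow> real set \<Rightarrow> real \<Rightarrow> real" where
  "wavelet w I x = ilength I powr (-1/2) * w ((x - icenter I) / ilength I)"

text \<open>The real Hilbert space \<open>L\<^sup>2\<close> of the line is handled through representatives:
  elements are functions, and equality in \<open>L\<^sup>2\<close> is equality almost everywhere.\<close>

definition L2 :: "(real \<Rightarrow> real) set" where
  "L2 = {f \<in> borel_measurable lebesgue. integrable lebesgue (\<lambda>x. (f x)\<^sup>2)}"

definition L2_inner :: "(real \<Rightarrow> real) \<Rightarrow> (real \<Rightarrow> real) \<Rightarrow> real" where
  "L2_inner f g = (\<integral>x. f x * g x \<partial>lebesgue)"

definition L2_norm :: "(real \<Rightarrow> real) \<Rightarrow> real" where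
  "L2_norm f = sqrt (L2_inner f f)"

text \<open>An orthonormal (Hilbert) basis: an orthonormal family whose finite linear combinations
  are dense.\<close>

definition L2_orthonormal_basis :: "'i set \<Rightarrow> ('i \<Rightarrow> real \<Rightarrow> real) \<Rightarrow> bool" where
  "L2_orthonormal_basis A e \<longleftrightarrow>
     (\<forall>i\<in>A. e i \<in> L2) \<and>
     (\<forall>i\<in>A. \<forall>j\<in>A. L2_inner (e i) (e j) = (if i = j then 1 else 0)) \<and>
     (\<forall>f\<in>L2. \<forall>\<epsilon>>0. \<exists>F c. finite F \<and> F \<subseteq> A \<and> L2_norm (\<lambda>x. f x - (\<Sum>i\<in>F. c i * e i x)) < \<epsilon>)"

text \<open>The sum defining the square function is taken in \<open>[0, \<infinity>]\<close>, where it always exists;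
  \<open>ennreal_sqrt\<close> is the square root on \<open>[0, \<infinity>]\<close>.\<close>

definition ennreal_sqrt :: "ennreal \<Rightarrow> ennreal" where
  "ennreal_sqrt a = (if a = \<infinity> then \<infinity> else ennreal (sqrt (enn2real a)))"

lemma ennreal_sqrt_power2 [simp]: "(ennreal_sqrt a)\<^sup>2 = a"
  by (cases a) (auto simp: ennreal_sqrt_def power2_eq_square ennreal_top_mult simp flip: ennreal_mult)

definition wavelet_square_function ::
    "real set set \<Rightarrow> (real \<Rightarrow> real) \<Rightarrow> (real \<Rightarrow> real) \<Rightarrow> real \<Rightarrow> ennreal" where
  "wavelet_square_function D w f x =
     ennreal_sqrt (\<Sum>\<^sub>\<infinity>I\<in>D. ennreal ((L2_inner f (wavelet w I))\<^sup>2 * (wavelet w I x)\<^sup>2))"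

lemma wavelet_square_function_power2:
  "(wavelet_square_function D w f x)\<^sup>2 =
     (\<Sum>\<^sub>\<infinity>I\<in>D. ennreal ((L2_inner f (wavelet w I))\<^sup>2 * (wavelet w I x)\<^sup>2))"
  by (simp add: wavelet_square_function_def)

end

theory Submission
  imports Defs
begin

text \<open>Write \<open>a J = \<langle>1\<^sub>V, w\<^sub>J\<rangle>\<close> and \<open>e J = \<integral>\<^sub>V w\<^sub>J\<^sup>2\<close>, the energy of \<open>J\<close>. The integral in question is
\<open>\<Sum>J. a J\<^sup>2 e J\<close>, while \<open>\<Sum>J. a J\<^sup>2 = |V|\<close> by Parseval. Hence it suffices that a fixed proportion of the
second sum is carried by intervals whose energy exceeds a constant. The other intervals are divided
into three classes according to the local density
\<open>u J = |J|\<^sup>-\<^sup>1 \<integral>\<^sub>V (1 + |x - c\<^sub>J| / |J|)\<^sup>-\<^sup>2 dx\<close>, and each class is shown to carry at most \<open>|V| / 8\<close>.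

\<^item> No interval \<open>Q \<supseteq> J\<close> has density \<open>\<ge> \<epsilon>\<close> (\<open>sparse_sum_le\<close>). This class is closed under passing to larger
intervals. The maximal intervals outside it, the tops, partition the line, and \<open>V\<close> has density at
most \<open>8 \<epsilon>\<close> at every top \<open>T\<close>. Seen from a point of \<open>T\<close>, summing over the class is nearly the same as
summing over all intervals longer than \<open>T\<close>. The latter sum is a projection whose kernel is concentrated at
scale \<open>|T|\<close>: near the diagonal by absolute summation over the longer intervals, and away from it because the sum
over all intervals vanishes there, which replaces the longer intervals by the shorter ones and their
tails (\<open>coarse_pairing_le\<close>). Discrepancies between the two sums come from intervals that are separated from
the point by an endpoint of a top; they cost \<open>\<epsilon>\<^sup>2 |T|\<close> per dense top \<open>T\<close>
(\<open>fine_pairing_le\<close>, \<open>cross_pairing_le\<close>), and the total length of the dense tops is \<open>O(|V| / \<epsilon>)\<close> by a Vitali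
covering argument (\<open>high_density_covering\<close>). Altogether the class carries \<open>O(\<epsilon> |V|)\<close>.

\<^item> \<open>J\<close> lies in an interval of density \<open>\<ge> \<epsilon>\<close>, but \<open>u J < \<delta>\<close> (\<open>low_density_sum_le\<close>). Bessel's
inequality localised to a maximal interval \<open>K\<close> of this kind gives \<open>O(\<delta> |K|)\<close> for all \<open>J \<subseteq> K\<close> together, and the covering
argument bounds the sum of the \<open>|K|\<close> by \<open>O(|V| / \<epsilon>)\<close>.

\<^item> \<open>u J \<ge> \<delta>\<close>, but \<open>e J \<le> \<eta>\<close> (\<open>dense_low_energy_sum_le\<close>). Then \<open>V\<close> is dense in a large dilate of \<open>J\<close>
and nearly absent from the rescaled copy of an interval on which \<open>w\<^sup>2\<close> is bounded below, so \<open>1\<^sub>V\<close>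
correlates with a rescaled step function of mean zero. Such step functions are almost orthogonal, so
these intervals have total length \<open>O(|V|)\<close>; and each of them has \<open>a J\<^sup>2\<close> at most a small multiple
of \<open>|J|\<close>.

The constants are chosen in the order \<open>\<epsilon>\<close>, \<open>\<delta>\<close>, \<open>\<eta>\<close>.\<close>

section \<open>Dyadic grids and sums over their levels\<close>

lemma
  assumes "half_open_interval I"
  shows half_open_interval_length_pos: "0 < ilength I"
    and half_open_interval_near_center: "x \<in> I \<Longrightarrow> \<bar>x - icenter I\<bar> \<le> ilength I / 2"
    and half_open_interval_interior: "\<bar>x - icenter I\<bar> < ilength I / 2 \<Longrightarrow> x \<in> I"
    and half_open_interval_lmeasurable: "I \<in> lmeasurable"
proof -
  obtain a b where ab: "a < b" "I = {a..<b} \<or> I = {a<..b}"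
    using assms unfolding half_open_interval_def by blast
  then have c: "icenter I = (a + b) / 2" "ilength I = b - a" by auto
  show "0 < ilength I" using ab c by auto
  show "\<bar>x - icenter I\<bar> \<le> ilength I / 2" if "x \<in> I"
  proof -
    have "a \<le> x" "x \<le> b" using ab that by auto
    then have "\<bar>x - (a + b) / 2\<bar> \<le> (b - a) / 2" by (simp add: abs_le_iff field_simps)
    then show ?thesis by (simp only: c)
  qed
  show "x \<in> I" if "\<bar>x - icenter I\<bar> < ilength I / 2"
  proof -
    have "\<bar>x - (a + b) / 2\<bar> < (b - a) / 2" using that by (simp only: c)
    then have "x - (a + b) / 2 < (b - a) / 2" "- (x - (a + b) / 2) < (b - a) / 2"
      by (simp_all only: abs_less_iff)
    then have "a < x \<and> x < b" by (simp add: field_simps)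
    then show ?thesis using ab by auto
  qed
  show "I \<in> lmeasurable" using ab by (auto intro: bounded_set_imp_lmeasurable)
qed

abbreviation vol :: "real set \<Rightarrow> real" where "vol A \<equiv> measure lebesgue A"

text \<open>Distance to the centre of an interval in units of its length, shifted by one so that
negative powers are bounded; all decay is expressed through it.\<close>

definition rdist :: "real set \<Rightarrow> real \<Rightarrow> real" where
  "rdist J x = 1 + \<bar>x - icenter J\<bar> / ilength J"

lemma rdist_ge_1: "1 \<le> rdist J x"
  by (simp add: rdist_def)

lemma rdist_pos [simp]: "0 < rdist J x" "rdist J x \<noteq> 0" "0 \<le> rdist J x"
  using rdist_ge_1[of J x] by linarith+

lemma continuous_rdist [continuous_intros]: "continuous_on A (rdist J)"
  unfolding rdist_def divide_inverse by (intro continuous_intros)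

lemma rdist_power_antimono: "p \<le> q \<Longrightarrow> 1 / rdist J x ^ q \<le> 1 / rdist J x ^ p"
  by (intro divide_left_mono power_increasing mult_pos_pos zero_less_power) (auto simp: rdist_ge_1)

lemma sum_powers_of_two_le:
  fixes S :: "int set"
  assumes "finite S" "\<And>i. i \<in> S \<Longrightarrow> i \<le> m"
  shows "(\<Sum>i\<in>S. (2::real) powi i) \<le> 2 * 2 powi m"
  using assms
proof (induction S arbitrary: m rule: finite_linorder_max_induct)
  case (insert b A)
  have "(\<Sum>i\<in>A. (2::real) powi i) \<le> 2 * 2 powi (b - 1)"
    using insert.hyps by (intro insert.IH) force
  also have "\<dots> = 2 powi b" by (simp add: power_int_diff)
  finally have "(\<Sum>i\<in>insert b A. (2::real) powi i) \<le> 2 * 2 powi b"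
    using insert.hyps by (subst sum.insert) auto
  also have "\<dots> \<le> 2 * 2 powi m"
    using insert.prems by (intro mult_left_mono power_int_increasing) auto
  finally show ?case .
qed auto

lemma sum_sqrt_powers_of_two_le:
  fixes S :: "int set"
  assumes "finite S" "\<And>i. i \<in> S \<Longrightarrow> i \<le> m"
  shows "(\<Sum>i\<in>S. sqrt ((2::real) powi i)) \<le> 4 * sqrt (2 powi m)"
  using assms
proof (induction S arbitrary: m rule: finite_linorder_max_induct)
  case (insert b A)
  have half: "4 * sqrt ((2::real) powi (b - 1)) \<le> 3 * sqrt (2 powi b)"
  proof (rule power2_le_imp_le)
    show "(4 * sqrt ((2::real) powi (b - 1)))\<^sup>2 \<le> (3 * sqrt (2 powi b))\<^sup>2"
      by (simp add: power_mult_distrib power_int_diff)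
  qed simp
  have "(\<Sum>i\<in>A. sqrt ((2::real) powi i)) \<le> 4 * sqrt (2 powi (b - 1))"
    using insert.hyps by (intro insert.IH) force
  then have "(\<Sum>i\<in>insert b A. sqrt ((2::real) powi i)) \<le> 4 * sqrt (2 powi b)"
    using insert.hyps half by (subst sum.insert) auto
  also have "\<dots> \<le> 4 * sqrt (2 powi m)"
    using insert.prems by (intro mult_left_mono real_sqrt_le_mono power_int_increasing) auto
  finally show ?case .
qed auto

lemma sum_inverse_squares_nat_le: "(\<Sum>k<Suc n. 1 / (1 + real k)\<^sup>2) \<le> 2 - 1 / (1 + real n)"
proof (induction n)
  case (Suc n)
  have "1 / (2 + real n)\<^sup>2 \<le> 1 / ((1 + real n) * (2 + real n))"
    unfolding power2_eq_square by (intro divide_left_mono mult_right_mono) auto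
  also have "\<dots> = 1 / (1 + real n) - 1 / (2 + real n)"
    by (simp add: field_simps)
  finally show ?case using Suc.IH by simp
qed auto

lemma sum_inverse_squares_int_le:
  fixes S :: "int set"
  assumes "finite S"
  shows "(\<Sum>k\<in>S. 1 / (1 + \<bar>real_of_int k\<bar>)\<^sup>2) \<le> 4"
proof -
  obtain n :: nat where n: "\<And>k. k \<in> S \<Longrightarrow> \<bar>k\<bar> \<le> int n"
  proof (cases "S = {}")
    case True then show ?thesis using that by auto
  next
    case False
    show ?thesis
    proof (rule that[of "nat (Max (abs ` S))"])
      fix k assume "k \<in> S"
      then have "\<bar>k\<bar> \<le> Max (abs ` S)" using assms by auto
      then show "\<bar>k\<bar> \<le> int (nat (Max (abs ` S)))" by auto
    qed
  qed
  let ?g = "\<lambda>k::int. 1 / (1 + \<bar>real_of_int k\<bar>)\<^sup>2"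
  let ?P = "int ` {..<Suc n}" and ?N = "(\<lambda>i. - int i) ` {..<Suc n}"
  have "S \<subseteq> ?P \<union> ?N"
  proof
    fix k assume "k \<in> S"
    then have "\<bar>k\<bar> \<le> int n" by (rule n)
    then show "k \<in> ?P \<union> ?N"
      by (cases "k \<ge> 0") (auto simp: image_iff intro!: bexI[of _ "nat \<bar>k\<bar>"])
  qed
  then have "sum ?g S \<le> sum ?g (?P \<union> ?N)"
    by (intro sum_mono2) auto
  also have "\<dots> \<le> sum ?g ?P + sum ?g ?N"
    by (subst sum_Un) (auto intro!: sum_nonneg)
  also have "sum ?g ?P = (\<Sum>k<Suc n. 1 / (1 + real k)\<^sup>2)"
    by (subst sum.reindex) (auto simp del: lessThan_Suc)
  also have "sum ?g ?N = (\<Sum>k<Suc n. 1 / (1 + real k)\<^sup>2)"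
    by (subst sum.reindex) (auto simp: inj_on_def simp del: lessThan_Suc)
  finally show ?thesis
    using sum_inverse_squares_nat_le[of n] zero_le_divide_1_iff[of "1 + real n"] by linarith
qed

text \<open>Rounding down moves a point by at most one unit. This turns a sum over points with distinct integer
parts into a sum over integers.\<close>

lemma inverse_square_floor_le:
  fixes t :: real
  shows "1 / (1 + \<bar>t\<bar>)\<^sup>2 \<le> 4 * (1 / (1 + \<bar>real_of_int \<lfloor>t\<rfloor>\<bar>)\<^sup>2)"
proof -
  have "1 + \<bar>real_of_int \<lfloor>t\<rfloor>\<bar> \<le> 2 * (1 + \<bar>t\<bar>)"
  proof (cases "0 \<le> \<lfloor>t\<rfloor>")
    case False
    then have "\<lfloor>t\<rfloor> \<le> -1" by linarith
    then have "real_of_int \<lfloor>t\<rfloor> \<le> -1" by linarith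
    moreover have t: "t < of_int \<lfloor>t\<rfloor> + 1" using floor_correct[of t] by simp
    ultimately have "\<bar>real_of_int \<lfloor>t\<rfloor>\<bar> = - of_int \<lfloor>t\<rfloor>" "\<bar>t\<bar> = - t"
      by (simp, intro abs_of_neg) linarith
    moreover have "1 + - of_int \<lfloor>t\<rfloor> \<le> 2 * (1 + - t)"
      using t \<open>real_of_int \<lfloor>t\<rfloor> \<le> -1\<close> by argo
    ultimately show ?thesis by simp
  next
    case True
    then have "\<bar>real_of_int \<lfloor>t\<rfloor>\<bar> = of_int \<lfloor>t\<rfloor>" "\<bar>t\<bar> = t" by simp_all
    then show ?thesis using of_int_floor_le[of t] True by argo
  qed
  then have "(1 + \<bar>real_of_int \<lfloor>t\<rfloor>\<bar>)\<^sup>2 \<le> (2 * (1 + \<bar>t\<bar>))\<^sup>2" by (intro power_mono) auto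
  then have "(1 + \<bar>real_of_int \<lfloor>t\<rfloor>\<bar>)\<^sup>2 \<le> 4 * (1 + \<bar>t\<bar>)\<^sup>2"
    unfolding power_mult_distrib by simp
  then show ?thesis by (simp add: divide_simps add_nonneg_eq_0_iff zero_less_power2)
qed

lemma floor_eq_imp_close:
  fixes a b :: real
  assumes "\<lfloor>a\<rfloor> = \<lfloor>b\<rfloor>"
  shows "\<bar>a - b\<bar> < 1"
proof -
  have "of_int \<lfloor>a\<rfloor> \<le> a" "a < of_int \<lfloor>a\<rfloor> + 1" "of_int \<lfloor>a\<rfloor> \<le> b" "b < of_int \<lfloor>a\<rfloor> + 1"
    using floor_correct[of a] floor_correct[of b] assms by auto
  then show ?thesis unfolding abs_less_iff by linarith
qed

locale dyadic =
  fixes D :: "real set set"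
  assumes grid: "dyadic_grid D"
begin

lemma half_open: "J \<in> D \<Longrightarrow> half_open_interval J"
  and length_power: "J \<in> D \<Longrightarrow> \<exists>k::int. ilength J = 2 powi k"
  using grid unfolding dyadic_grid_def by blast+

lemmas length_pos = half_open_interval_length_pos[OF half_open]
  and near_center = half_open_interval_near_center[OF half_open]
  and interior = half_open_interval_interior[OF half_open]
  and interval_lmeasurable = half_open_interval_lmeasurable[OF half_open]

lemma center_in: "J \<in> D \<Longrightarrow> icenter J \<in> J"
  by (rule interior) (auto simp: length_pos)

lemma cell_exists: "\<exists>J\<in>D. ilength J = 2 powi k \<and> x \<in> J"
proof -
  have "partition_on UNIV {I\<in>D. ilength I = 2 powi k}"
    using grid unfolding dyadic_grid_def by blast
  then show ?thesis by (auto simp: partition_on_def)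
qed

lemma same_length_eq:
  assumes "J \<in> D" "K \<in> D" "ilength J = ilength K" "x \<in> J" "x \<in> K"
  shows "J = K"
proof -
  obtain k :: int where k: "ilength J = 2 powi k" using length_power assms by blast
  have "partition_on UNIV {I\<in>D. ilength I = 2 powi k}"
    using grid unfolding dyadic_grid_def by blast
  then have "disjoint {I\<in>D. ilength I = 2 powi k}" by (simp add: partition_on_def)
  then show ?thesis using assms k unfolding disjoint_def by fastforce
qed

lemma nested:
  assumes "J \<in> D" "K \<in> D" "ilength J \<le> ilength K" "x \<in> J" "x \<in> K"
  shows "J \<subseteq> K"
proof -
  obtain k :: int where k: "ilength J = 2 powi k" using length_power assms by blast
  obtain l :: int where l: "ilength K = 2 powi l" using length_power assms by blast
  have "k \<le> l" using assms k l
    by (metis not_le one_less_numeral_iff power_int_strict_increasing semiring_norm(76))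
  have "\<forall>K\<in>D. ilength K = 2 powi (k + int n) \<longrightarrow> x \<in> K \<longrightarrow> J \<subseteq> K" for n
  proof (induction n)
    case 0
    show ?case
    proof (intro ballI impI)
      fix K assume K: "K \<in> D" "ilength K = 2 powi (k + int 0)" "x \<in> K"
      have "J = K" by (rule same_length_eq[OF assms(1) K(1) _ assms(4) K(3)]) (simp add: k K)
      then show "J \<subseteq> K" by simp
    qed
  next
    case (Suc n)
    show ?case
    proof (intro ballI impI)
      fix K assume K: "K \<in> D" "ilength K = 2 powi (k + int (Suc n))" "x \<in> K"
      have "k + int (Suc n) = (k + int n) + 1" by simp
      then have "ilength K = 2 powi ((k + int n) + 1)" using K(2) by (simp only:)
      then obtain K1 K2 where "K1 \<in> D" "K2 \<in> D" "ilength K1 = 2 powi (k + int n)"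
        "ilength K2 = 2 powi (k + int n)" "K = K1 \<union> K2"
        using grid K(1) unfolding dyadic_grid_def by blast
      then show "J \<subseteq> K" using Suc.IH K(3) by blast
    qed
  qed
  from this[of "nat (l - k)"] show ?thesis using \<open>k \<le> l\<close> l assms by auto
qed

lemma subset_length_le:
  assumes "J \<in> D" "K \<in> D" "J \<subseteq> K"
  shows "ilength J \<le> ilength K"
  using assms by (intro measure_mono_fmeasurable) (auto simp: interval_lmeasurable fmeasurableD)

lemma subset_same_length_eq:
  assumes "J \<in> D" "K \<in> D" "J \<subseteq> K" "ilength K \<le> ilength J"
  shows "J = K"
proof (rule same_length_eq[OF assms(1,2)])
  show "ilength J = ilength K" using subset_length_le[OF assms(1-3)] assms(4) by simp
  show "icenter J \<in> J" "icenter J \<in> K" using center_in[OF assms(1)] assms(3) by auto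
qed

lemma ancestor_exists:
  assumes "J \<in> D" "ilength J \<le> 2 powi k"
  obtains K where "K \<in> D" "ilength K = 2 powi k" "J \<subseteq> K"
proof -
  obtain K where "K \<in> D" "ilength K = 2 powi k" "icenter J \<in> K" using cell_exists by blast
  then show ?thesis using that nested[OF assms(1), of K] center_in[OF assms(1)] assms(2) by auto
qed

lemma strict_superset_length:
  assumes "J \<in> D" "K \<in> D" "J \<subset> K"
  shows "2 * ilength J \<le> ilength K"
proof -
  obtain k l :: int where kl: "ilength J = 2 powi k" "ilength K = 2 powi l"
    using length_power assms by blast
  have "ilength J < ilength K"
    using subset_same_length_eq[OF assms(1,2)] assms(3) by (metis not_le psubset_eq)
  then have "k < l"
    using kl by (metis linorder_not_less one_le_numeral power_int_increasing)
  then have "(2::real) powi (k + 1) \<le> 2 powi l" by (intro power_int_increasing) auto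
  then show ?thesis using kl by (simp add: power_int_add)
qed

lemma center_separation:
  assumes "J \<in> D" "K \<in> D" "ilength J = ilength K" "J \<noteq> K"
  shows "ilength J \<le> \<bar>icenter J - icenter K\<bar>"
proof (rule ccontr)
  assume "\<not> ?thesis"
  then have *: "\<bar>icenter J - icenter K\<bar> < ilength J" by simp
  define m where "m = (icenter J + icenter K) / 2"
  have "m - icenter J = - ((icenter J - icenter K) / 2)" "m - icenter K = (icenter J - icenter K) / 2"
    by (simp_all add: m_def field_simps)
  then have "\<bar>m - icenter J\<bar> = \<bar>icenter J - icenter K\<bar> / 2" "\<bar>m - icenter K\<bar> = \<bar>icenter J - icenter K\<bar> / 2"
    by (simp_all only: abs_minus_cancel abs_divide abs_numeral)
  then have "\<bar>m - icenter J\<bar> < ilength J / 2" "\<bar>m - icenter K\<bar> < ilength K / 2"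
    using * assms(3) by simp_all
  then have "m \<in> J" "m \<in> K" using interior[OF assms(1)] interior[OF assms(2)] by blast+
  then show False using same_length_eq assms by blast
qed

text \<open>The centres of intervals of one length are separated by that length, so after rescaling they have
distinct integer parts.\<close>

lemma lattice_sum_le:
  assumes "finite F" "F \<subseteq> D" "\<And>J. J \<in> F \<Longrightarrow> ilength J = s"
  shows "(\<Sum>J\<in>F. 1 / (rdist J x)\<^sup>2) \<le> 16"
proof -
  define \<phi> where "\<phi> J = \<lfloor>(x - icenter J) / ilength J\<rfloor>" for J
  have inj: "inj_on \<phi> F"
  proof (rule inj_onI, rule ccontr)
    fix J K assume JK: "J \<in> F" "K \<in> F" "\<phi> J = \<phi> K" "J \<noteq> K"
    have s: "s > 0" "ilength J = s" "ilength K = s" using assms JK length_pos by auto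
    have "s \<le> \<bar>icenter J - icenter K\<bar>" using center_separation[of J K] JK assms(2) s by auto
    moreover have "\<bar>(x - icenter J) / s - (x - icenter K) / s\<bar> < 1"
      using JK(3) by (intro floor_eq_imp_close) (simp add: \<phi>_def s)
    moreover have "(x - icenter J) / s - (x - icenter K) / s = (icenter K - icenter J) / s"
      by (simp add: diff_divide_distrib)
    ultimately show False using s by (simp add: abs_minus_commute)
  qed
  have "(\<Sum>J\<in>F. 1 / (rdist J x)\<^sup>2) \<le> (\<Sum>J\<in>F. 4 * (1 / (1 + \<bar>real_of_int (\<phi> J)\<bar>)\<^sup>2))"
  proof (rule sum_mono)
    fix J assume "J \<in> F"
    then have "rdist J x = 1 + \<bar>(x - icenter J) / ilength J\<bar>"
      using length_pos assms(2) by (auto simp: rdist_def)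
    then show "1 / (rdist J x)\<^sup>2 \<le> 4 * (1 / (1 + \<bar>real_of_int (\<phi> J)\<bar>)\<^sup>2)"
      unfolding \<phi>_def by (simp only: inverse_square_floor_le)
  qed
  also have "\<dots> = 4 * (\<Sum>k\<in>\<phi> ` F. 1 / (1 + \<bar>real_of_int k\<bar>)\<^sup>2)"
    by (subst sum.reindex[OF inj]) (simp add: sum_distrib_left)
  also have "\<dots> \<le> 4 * 4"
    using sum_inverse_squares_int_le[of "\<phi> ` F"] assms(1) by auto
  finally show ?thesis by simp
qed

lemma weighted_lattice_sum_le:
  assumes "finite F" "F \<subseteq> D" "\<And>J. J \<in> F \<Longrightarrow> 0 \<le> \<gamma> (ilength J)"
  shows "(\<Sum>J\<in>F. \<gamma> (ilength J) / (rdist J x)\<^sup>2) \<le> 16 * (\<Sum>s\<in>ilength ` F. \<gamma> s)"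
proof -
  have "(\<Sum>J\<in>F. \<gamma> (ilength J) / (rdist J x)\<^sup>2)
      = (\<Sum>s\<in>ilength ` F. \<Sum>J\<in>{J\<in>F. ilength J = s}. \<gamma> (ilength J) / (rdist J x)\<^sup>2)"
    by (rule sum.image_gen[OF assms(1)])
  also have "\<dots> = (\<Sum>s\<in>ilength ` F. \<gamma> s * (\<Sum>J\<in>{J\<in>F. ilength J = s}. 1 / (rdist J x)\<^sup>2))"
    by (simp add: sum_distrib_left)
  also have "\<dots> \<le> (\<Sum>s\<in>ilength ` F. \<gamma> s * 16)"
    using assms by (intro sum_mono mult_left_mono lattice_sum_le) auto
  finally show ?thesis by (simp add: sum_distrib_left mult.commute)
qed

lemma lengths_levels:
  assumes "finite F" "F \<subseteq> D"
  obtains S :: "int set" where "finite S" "ilength ` F = (\<lambda>i. 2 powi i) ` S"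
proof -
  have "ilength ` F \<subseteq> (\<lambda>i::int. 2 powi i) ` UNIV" using length_power assms(2) by fastforce
  then show ?thesis
    using finite_subset_image[of "ilength ` F"] that assms(1) by (metis finite_imageI)
qed

lemma level_le_iff: "(2::real) powi i \<le> 2 powi j \<longleftrightarrow> i \<le> j"
  by (metis linorder_not_le one_less_numeral_iff order_less_imp_le power_int_strict_increasing
      power_int_increasing one_le_numeral semiring_norm(76))

lemma inj_powers_of_two: "inj_on (\<lambda>i::int. (2::real) powi i) S"
  by (rule inj_onI) (metis level_le_iff order_antisym order_refl)

text \<open>Distinct lengths of grid intervals are distinct powers of two, so sums over the set of lengths that occur are
geometric sums; the longest length dominates here, and the shortest one in the lemma after it.
The square roots serve the almost orthogonality of step functions.\<close>

lemma sum_lengths_le: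
  assumes "finite F" "F \<subseteq> D" "K \<in> D" "\<And>J. J \<in> F \<Longrightarrow> ilength J \<le> ilength K"
  shows "(\<Sum>s\<in>ilength ` F. s) \<le> 2 * ilength K"
    and "(\<Sum>s\<in>ilength ` F. sqrt s) \<le> 4 * sqrt (ilength K)"
proof -
  obtain S :: "int set" where S: "finite S" "ilength ` F = (\<lambda>i. 2 powi i) ` S"
    by (rule lengths_levels[OF assms(1,2)])
  obtain k :: int where k: "ilength K = 2 powi k" using length_power assms by blast
  have "i \<le> k" if "i \<in> S" for i
  proof -
    have "(2::real) powi i \<in> ilength ` F" using S that by auto
    then have "(2::real) powi i \<le> 2 powi k" using assms(4) k by auto
    then show ?thesis by (simp add: level_le_iff)
  qed
  then show "(\<Sum>s\<in>ilength ` F. s) \<le> 2 * ilength K"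
    and "(\<Sum>s\<in>ilength ` F. sqrt s) \<le> 4 * sqrt (ilength K)"
    using sum_powers_of_two_le[OF S(1), of k] sum_sqrt_powers_of_two_le[OF S(1), of k]
    by (simp_all add: S(2) k sum.reindex inj_powers_of_two)
qed

lemma sum_inverse_lengths_le:
  assumes "finite F" "F \<subseteq> D" "K \<in> D" "\<And>J. J \<in> F \<Longrightarrow> ilength K \<le> ilength J"
  shows "(\<Sum>s\<in>ilength ` F. 1 / s) \<le> 2 / ilength K"
    and "(\<Sum>s\<in>ilength ` F. 1 / sqrt s) \<le> 4 / sqrt (ilength K)"
proof -
  obtain S :: "int set" where S: "finite S" "ilength ` F = (\<lambda>i. 2 powi i) ` S"
    by (rule lengths_levels[OF assms(1,2)])
  obtain k :: int where k: "ilength K = 2 powi k" using length_power assms by blast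
  have le: "i \<le> - k" if "i \<in> uminus ` S" for i
  proof -
    have "(2::real) powi (- i) \<in> ilength ` F" using S that by auto
    then have "(2::real) powi k \<le> 2 powi (-i)" using assms(4) k by auto
    then have "k \<le> - i" by (simp only: level_le_iff)
    then show ?thesis by simp
  qed
  show "(\<Sum>s\<in>ilength ` F. 1 / s) \<le> 2 / ilength K"
    using sum_powers_of_two_le[of "uminus ` S", OF finite_imageI[OF S(1)] le]
    by (simp add: S(2) k sum.reindex inj_powers_of_two power_int_minus divide_inverse)
  show "(\<Sum>s\<in>ilength ` F. 1 / sqrt s) \<le> 4 / sqrt (ilength K)"
    using sum_sqrt_powers_of_two_le[of "uminus ` S", OF finite_imageI[OF S(1)] le]
    by (simp add: S(2) k sum.reindex inj_powers_of_two power_int_minus divide_inverse real_sqrt_inverse)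
qed

lemma countable_grid: "countable D"
proof -
  define \<phi> where "\<phi> J = (THE k::int. ilength J = 2 powi k, \<lfloor>icenter J / ilength J\<rfloor>)" for J :: "real set"
  have "inj_on \<phi> D"
  proof (rule inj_onI, rule ccontr)
    fix J K assume JK: "J \<in> D" "K \<in> D" "\<phi> J = \<phi> K" "J \<noteq> K"
    have lev: "ilength I = 2 powi fst (\<phi> I)" if I: "I \<in> D" for I
    proof -
      obtain k :: int where k: "ilength I = 2 powi k" using length_power[OF I] by blast
      have "(THE k::int. ilength I = 2 powi k) = k"
        by (rule the_equality) (use k inj_powers_of_two[of UNIV] in \<open>auto simp: inj_on_def\<close>)
      then show ?thesis by (simp add: \<phi>_def k)
    qed
    have eq: "ilength J = ilength K" using JK lev by simp
    have "ilength J \<le> \<bar>icenter J - icenter K\<bar>" using center_separation JK eq by auto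
    moreover have "\<bar>icenter J / ilength J - icenter K / ilength J\<bar> < 1"
      using JK(3) by (intro floor_eq_imp_close) (simp add: \<phi>_def eq)
    moreover have "ilength J > 0" using length_pos JK by auto
    ultimately show False by (simp add: diff_divide_distrib[symmetric])
  qed
  then show ?thesis by (rule countable_image_inj_on[rotated]) auto
qed

end

section \<open>The space of square-integrable functions and Parseval's identity\<close>

lemma L2_measurable: "f \<in> L2 \<Longrightarrow> f \<in> borel_measurable lebesgue"
  and L2_square_integrable: "f \<in> L2 \<Longrightarrow> integrable lebesgue (\<lambda>x. (f x)\<^sup>2)"
  by (simp_all add: L2_def)

lemma L2_mult_integrable:
  assumes "f \<in> L2" "g \<in> L2"
  shows "integrable lebesgue (\<lambda>x. f x * g x)"
proof (rule Bochner_Integration.integrable_bound)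
  show "integrable lebesgue (\<lambda>x. (f x)\<^sup>2 + (g x)\<^sup>2)"
    using assms by (auto simp: L2_def)
  show "(\<lambda>x. f x * g x) \<in> borel_measurable lebesgue"
    using assms by (auto simp: L2_def)
  have "\<bar>a * b\<bar> \<le> a\<^sup>2 + b\<^sup>2" for a b :: real
  proof -
    have "2 * (\<bar>a\<bar> * \<bar>b\<bar>) \<le> a\<^sup>2 + b\<^sup>2" using sum_squares_bound[of "\<bar>a\<bar>" "\<bar>b\<bar>"] by simp
    moreover have "0 \<le> \<bar>a\<bar> * \<bar>b\<bar>" by simp
    ultimately show ?thesis unfolding abs_mult by linarith
  qed
  then show "AE x in lebesgue. norm (f x * g x) \<le> norm ((f x)\<^sup>2 + (g x)\<^sup>2)" by simp
qed

lemma L2_add: "f \<in> L2 \<Longrightarrow> g \<in> L2 \<Longrightarrow> (\<lambda>x. f x + g x) \<in> L2"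
  using L2_mult_integrable[of f g]
  by (auto simp: L2_def power2_sum mult.assoc)

lemma L2_scale: "f \<in> L2 \<Longrightarrow> (\<lambda>x. c * f x) \<in> L2"
  by (auto simp: L2_def power_mult_distrib)

lemma L2_diff: "f \<in> L2 \<Longrightarrow> g \<in> L2 \<Longrightarrow> (\<lambda>x. f x - g x) \<in> L2"
  using L2_add[of f "\<lambda>x. (-1) * g x"] L2_scale[of g "-1"] by simp

lemma L2_sum: "(\<And>i. i \<in> F \<Longrightarrow> e i \<in> L2) \<Longrightarrow> (\<lambda>x. \<Sum>i\<in>F. e i x) \<in> L2"
proof (induction F rule: infinite_finite_induct)
  case (insert i F)
  then show ?case using L2_add[of "e i" "\<lambda>x. \<Sum>i\<in>F. e i x"] by simp
qed (auto simp: L2_def)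

lemma L2_indicator: "A \<in> lmeasurable \<Longrightarrow> indicator A \<in> L2"
proof -
  assume A: "A \<in> lmeasurable"
  have "(\<lambda>x. (indicator A x)\<^sup>2 :: real) = indicator A"
    by (auto simp: indicator_def)
  then show ?thesis
    using A by (simp add: L2_def fmeasurableD lmeasurable_iff_integrable)
qed

lemma L2_inner_commute: "L2_inner f g = L2_inner g f"
  by (simp add: L2_inner_def mult.commute)

lemma L2_inner_self_nonneg: "0 \<le> L2_inner f f"
  by (simp add: L2_inner_def)

lemma L2_inner_add_left:
  "f \<in> L2 \<Longrightarrow> g \<in> L2 \<Longrightarrow> h \<in> L2 \<Longrightarrow> L2_inner (\<lambda>x. f x + g x) h = L2_inner f h + L2_inner g h"
  using L2_mult_integrable by (simp add: L2_inner_def distrib_right)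

lemma L2_inner_diff_left:
  "f \<in> L2 \<Longrightarrow> g \<in> L2 \<Longrightarrow> h \<in> L2 \<Longrightarrow> L2_inner (\<lambda>x. f x - g x) h = L2_inner f h - L2_inner g h"
  using L2_mult_integrable by (simp add: L2_inner_def left_diff_distrib)

lemma L2_inner_scale_left: "L2_inner (\<lambda>x. c * f x) h = c * L2_inner f h"
  by (simp add: L2_inner_def mult.assoc)

lemma L2_inner_sum_left:
  "(\<And>i. i \<in> F \<Longrightarrow> e i \<in> L2) \<Longrightarrow> h \<in> L2 \<Longrightarrow> L2_inner (\<lambda>x. \<Sum>i\<in>F. e i x) h = (\<Sum>i\<in>F. L2_inner (e i) h)"
  using L2_mult_integrable by (simp add: L2_inner_def sum_distrib_right Bochner_Integration.integral_sum)

lemma L2_inner_combination: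
  assumes "\<And>i. i \<in> F \<Longrightarrow> e i \<in> L2" "h \<in> L2"
  shows "L2_inner (\<lambda>x. \<Sum>i\<in>F. c i * e i x) h = (\<Sum>i\<in>F. c i * L2_inner (e i) h)"
  using L2_inner_sum_left[of F "\<lambda>i x. c i * e i x" h] assms L2_scale
  by (simp add: L2_inner_scale_left)

lemma L2_inner_diff_self:
  assumes "f \<in> L2" "g \<in> L2"
  shows "L2_inner (\<lambda>x. f x - g x) (\<lambda>x. f x - g x) = L2_inner f f - 2 * L2_inner f g + L2_inner g g"
proof -
  have d: "(\<lambda>x. f x - g x) \<in> L2" using L2_diff assms by blast
  have "L2_inner (\<lambda>x. f x - g x) (\<lambda>x. f x - g x)
      = L2_inner (\<lambda>x. f x - g x) f - L2_inner (\<lambda>x. f x - g x) g"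
    using L2_inner_diff_left[OF assms d] by (simp add: L2_inner_commute)
  then show ?thesis
    using L2_inner_diff_left[OF assms] assms by (simp add: L2_inner_commute)
qed

lemma L2_inner_indicator:
  assumes "A \<in> lmeasurable" "B \<in> lmeasurable"
  shows "L2_inner (indicator A) (indicator B) = vol (A \<inter> B)"
proof -
  have "(\<lambda>x. indicator A x * indicator B x :: real) = indicator (A \<inter> B)"
    by (auto simp: indicator_def)
  then show ?thesis by (simp add: L2_inner_def)
qed

context
  fixes A :: "'i set" and e :: "'i \<Rightarrow> real \<Rightarrow> real"
  assumes basis: "L2_orthonormal_basis A e"
begin

lemma basis_L2: "i \<in> A \<Longrightarrow> e i \<in> L2"
  and basis_orthonormal: "i \<in> A \<Longrightarrow> j \<in> A \<Longrightarrow> L2_inner (e i) (e j) = (if i = j then 1 else 0)"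
  and basis_dense: "f \<in> L2 \<Longrightarrow> \<epsilon> > 0 \<Longrightarrow>
    \<exists>F c. finite F \<and> F \<subseteq> A \<and> L2_norm (\<lambda>x. f x - (\<Sum>i\<in>F. c i * e i x)) < \<epsilon>"
  using basis unfolding L2_orthonormal_basis_def by blast+

lemma L2_inner_residual:
  fixes c :: "'i \<Rightarrow> real"
  assumes "finite F" "F \<subseteq> A" "f \<in> L2"
  defines "r \<equiv> \<lambda>x. f x - (\<Sum>i\<in>F. c i * e i x)"
  shows "L2_inner r r = L2_inner f f - (\<Sum>i\<in>F. (L2_inner f (e i))\<^sup>2) + (\<Sum>i\<in>F. (c i - L2_inner f (e i))\<^sup>2)"
proof -
  define s where "s = (\<lambda>x. \<Sum>i\<in>F. c i * e i x)"
  have eL: "\<And>i. i \<in> F \<Longrightarrow> e i \<in> L2" using assms basis_L2 by blast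
  have sL: "s \<in> L2" unfolding s_def by (intro L2_sum L2_scale eL)
  have fs: "L2_inner f s = (\<Sum>i\<in>F. c i * L2_inner f (e i))"
    using L2_inner_combination[of F e f c] eL assms(3) by (simp add: s_def L2_inner_commute)
  have es: "L2_inner (e i) s = c i" if "i \<in> F" for i
  proof -
    have "L2_inner (e i) s = (\<Sum>j\<in>F. c j * L2_inner (e j) (e i))"
      using L2_inner_combination[of F e "e i" c] eL that by (simp add: s_def L2_inner_commute)
    also have "\<dots> = (\<Sum>j\<in>F. if j = i then c j else 0)"
      using that assms(2) by (intro sum.cong) (auto simp: basis_orthonormal subset_iff)
    finally show ?thesis using assms(1) that by simp
  qed
  have ss: "L2_inner s s = (\<Sum>i\<in>F. c i * c i)"
    using L2_inner_combination[of F e s c] eL sL es by (simp add: s_def[symmetric])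
  have "L2_inner r r = L2_inner f f - 2 * L2_inner f s + L2_inner s s"
    using L2_inner_diff_self[OF assms(3) sL] by (simp add: r_def s_def)
  then show ?thesis
    by (simp add: fs ss power2_diff sum.distrib sum_subtractf sum_distrib_left algebra_simps power2_eq_square)
qed

lemma bessel:
  assumes "finite F" "F \<subseteq> A" "f \<in> L2"
  shows "(\<Sum>i\<in>F. (L2_inner f (e i))\<^sup>2) \<le> L2_inner f f"
  using L2_inner_residual[OF assms, of "\<lambda>i. L2_inner f (e i)"]
    L2_inner_self_nonneg[of "\<lambda>x. f x - (\<Sum>i\<in>F. L2_inner f (e i) * e i x)"] by simp

text \<open>The best approximation by a finite set of basis functions has the inner products as its coefficients,
so density of finite combinations bounds a partial sum of squares from below.\<close>

lemma bessel_approximation: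
  assumes "f \<in> L2" "\<epsilon> > 0"
  obtains F where "finite F" "F \<subseteq> A" "L2_inner f f - \<epsilon> < (\<Sum>i\<in>F. (L2_inner f (e i))\<^sup>2)"
proof -
  obtain F c where F: "finite F" "F \<subseteq> A" "L2_norm (\<lambda>x. f x - (\<Sum>i\<in>F. c i * e i x)) < sqrt \<epsilon>"
    using basis_dense[OF assms(1), of "sqrt \<epsilon>"] assms(2) by auto
  have "L2_inner f f - (\<Sum>i\<in>F. (L2_inner f (e i))\<^sup>2) + (\<Sum>i\<in>F. (c i - L2_inner f (e i))\<^sup>2) < \<epsilon>"
    using F(3) L2_inner_residual[OF F(1,2) assms(1), of c] by (simp add: L2_norm_def)
  moreover have "0 \<le> (\<Sum>i\<in>F. (c i - L2_inner f (e i))\<^sup>2)" by (intro sum_nonneg) auto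
  ultimately show ?thesis using that[OF F(1,2)] by linarith
qed

lemma parseval_square:
  assumes "f \<in> L2"
  shows "((\<lambda>i. (L2_inner f (e i))\<^sup>2) has_sum L2_inner f f) A"
proof -
  let ?s = "\<lambda>i. (L2_inner f (e i))\<^sup>2"
  have "bdd_above (sum ?s ` {F. F \<subseteq> A \<and> finite F})"
    by (rule bdd_aboveI[of _ "L2_inner f f"]) (use bessel[OF _ _ assms] in blast)
  then have summ: "?s summable_on A"
    by (intro nonneg_bdd_above_summable_on) auto
  have "infsum ?s A \<le> L2_inner f f"
    by (rule infsum_le_finite_sums[OF summ]) (rule bessel[OF _ _ assms])
  moreover have "L2_inner f f \<le> infsum ?s A"
  proof (rule field_le_epsilon)
    fix \<epsilon> :: real assume pos: "\<epsilon> > 0"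
    show "L2_inner f f \<le> infsum ?s A + \<epsilon>"
  proof -
    obtain F where F: "finite F" "F \<subseteq> A" "L2_inner f f - \<epsilon> < sum ?s F"
      using bessel_approximation[OF assms pos] .
    have "sum ?s F \<le> infsum ?s A" by (rule finite_sum_le_infsum[OF summ F(1,2)]) auto
    then show ?thesis using F(3) by linarith
  qed
  qed
  ultimately have "infsum ?s A = L2_inner f f" by (rule antisym)
  then show ?thesis using has_sum_infsum[OF summ] by simp
qed

text \<open>Polarisation of the case of squares.\<close>

lemma parseval:
  assumes "f \<in> L2" "g \<in> L2"
  shows "((\<lambda>i. L2_inner f (e i) * L2_inner g (e i)) has_sum L2_inner f g) A"
proof -
  have p: "((\<lambda>i. (L2_inner (\<lambda>x. f x + g x) (e i))\<^sup>2) has_sum L2_inner (\<lambda>x. f x + g x) (\<lambda>x. f x + g x)) A"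
    and m: "((\<lambda>i. (L2_inner (\<lambda>x. f x - g x) (e i))\<^sup>2) has_sum L2_inner (\<lambda>x. f x - g x) (\<lambda>x. f x - g x)) A"
    using assms L2_add L2_diff parseval_square by blast+
  have "L2_inner (\<lambda>x. f x + g x) (\<lambda>x. f x + g x) = L2_inner f f + 2 * L2_inner f g + L2_inner g g"
    using L2_inner_diff_self[of f "\<lambda>x. (-1) * g x"] L2_scale[of g "-1"] assms
    using L2_inner_scale_left[of "-1" g] by (simp add: L2_inner_def)
  then have tot: "L2_inner f g = (1/4) * (L2_inner (\<lambda>x. f x + g x) (\<lambda>x. f x + g x)
      - L2_inner (\<lambda>x. f x - g x) (\<lambda>x. f x - g x))"
    using L2_inner_diff_self[OF assms] by simp
  have summand: "L2_inner f (e i) * L2_inner g (e i) = (1/4) * ((L2_inner (\<lambda>x. f x + g x) (e i))\<^sup>2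
      - (L2_inner (\<lambda>x. f x - g x) (e i))\<^sup>2)" if "i \<in> A" for i
    using that assms basis_L2[OF that] 
    by (simp add: L2_inner_add_left L2_inner_diff_left power2_sum power2_diff)
  have "((\<lambda>i. (1/4) * (L2_inner (\<lambda>x. f x + g x) (e i))\<^sup>2 + (-1/4) * (L2_inner (\<lambda>x. f x - g x) (e i))\<^sup>2)
      has_sum (1/4) * L2_inner (\<lambda>x. f x + g x) (\<lambda>x. f x + g x)
        + (-1/4) * L2_inner (\<lambda>x. f x - g x) (\<lambda>x. f x - g x)) A"
    by (intro has_sum_add has_sum_cmult_right p m)
  then show ?thesis
    unfolding tot by (subst has_sum_cong[OF summand]) (simp_all add: right_diff_distrib)
qed

text \<open>The free parameter lets a small function be paired with a large one.\<close>

lemma coefficient_products_finite_sum_le: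
  assumes "f \<in> L2" "g \<in> L2" "finite F" "F \<subseteq> A" "t > 0"
  shows "(\<Sum>i\<in>F. \<bar>L2_inner f (e i) * L2_inner g (e i)\<bar>) \<le> (t * L2_inner f f + L2_inner g g / t) / 2"
proof -
  have "\<bar>a * b\<bar> \<le> (t * a\<^sup>2 + b\<^sup>2 / t) / 2" for a b :: real
  proof -
    have "0 \<le> (t * \<bar>a\<bar> - \<bar>b\<bar>)\<^sup>2 / t" using assms(5) by simp
    also have "\<dots> = t * a\<^sup>2 - 2 * \<bar>a * b\<bar> + b\<^sup>2 / t"
      using assms(5) by (simp add: power2_diff field_simps abs_mult power2_eq_square)
    finally show ?thesis by simp
  qed
  then have "(\<Sum>i\<in>F. \<bar>L2_inner f (e i) * L2_inner g (e i)\<bar>)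
      \<le> (\<Sum>i\<in>F. (t * (L2_inner f (e i))\<^sup>2 + (L2_inner g (e i))\<^sup>2 / t) / 2)"
    by (intro sum_mono) auto
  also have "\<dots> = (t * (\<Sum>i\<in>F. (L2_inner f (e i))\<^sup>2) + (\<Sum>i\<in>F. (L2_inner g (e i))\<^sup>2) / t) / 2"
    by (simp add: sum.distrib sum_distrib_left sum_divide_distrib[symmetric])
  also have "\<dots> \<le> (t * L2_inner f f + L2_inner g g / t) / 2"
    using bessel assms by (intro divide_right_mono add_mono mult_left_mono) auto
  finally show ?thesis .
qed

lemma coefficient_products_abs_summable:
  assumes "f \<in> L2" "g \<in> L2"
  shows "(\<lambda>i. norm (L2_inner f (e i) * L2_inner g (e i))) summable_on A"
proof (rule nonneg_bdd_above_summable_on)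
  show "bdd_above (sum (\<lambda>i. norm (L2_inner f (e i) * L2_inner g (e i))) ` {F. F \<subseteq> A \<and> finite F})"
    using coefficient_products_finite_sum_le[OF assms, of _ 1]
    by (intro bdd_aboveI[of _ "(1 * L2_inner f f + L2_inner g g / 1) / 2"]) auto
qed auto

end

lemma infsum_abs_le_of_finite_sums:
  fixes h :: "'i \<Rightarrow> real"
  assumes "\<And>F. finite F \<Longrightarrow> F \<subseteq> X \<Longrightarrow> (\<Sum>i\<in>F. \<bar>h i\<bar>) \<le> b"
  shows "\<bar>infsum h X\<bar> \<le> b"
proof -
  have s: "(\<lambda>i. norm (h i)) summable_on X"
    by (rule nonneg_bdd_above_summable_on) (auto intro!: bdd_aboveI[of _ b] assms)
  have "\<bar>infsum h X\<bar> \<le> infsum (\<lambda>i. \<bar>h i\<bar>) X"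
    using norm_infsum_bound[OF s] by simp
  also have "\<dots> \<le> b"
    using s by (intro infsum_le_finite_sums assms) auto
  finally show ?thesis .
qed

section \<open>Weighted masses and local densities\<close>

text \<open>The mass that a set has at an interval, with polynomial weight. The exponent 2
defines the local density and is summable over a level; the exponent 8 is the one that
wavelets obey, and its surplus is spent in the estimates.\<close>

definition mass :: "nat \<Rightarrow> real set \<Rightarrow> real set \<Rightarrow> real" where
  "mass p A J = (LINT x:A|lebesgue. 1 / rdist J x ^ p)"

lemma set_integrable_bounded:
  fixes \<phi> :: "real \<Rightarrow> real"
  assumes "A \<in> lmeasurable" "\<phi> \<in> borel_measurable lebesgue" "\<And>x. \<bar>\<phi> x\<bar> \<le> B"
  shows "set_integrable lebesgue A \<phi>"
  unfolding set_integrable_def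
proof (rule Bochner_Integration.integrable_bound)
  show "integrable lebesgue (\<lambda>x. B * indicator A x)"
    using assms(1) by (simp add: lmeasurable_iff_integrable)
  show "(\<lambda>x. indicator A x *\<^sub>R \<phi> x) \<in> borel_measurable lebesgue"
    using assms by (auto simp: fmeasurableD)
  show "AE x in lebesgue. norm (indicator A x *\<^sub>R \<phi> x) \<le> norm (B * indicator A x :: real)"
    using assms(3) by (auto simp: indicator_def intro: order_trans abs_ge_self)
qed

lemma measurable_inverse_rdist [measurable]: "(\<lambda>x. 1 / rdist J x ^ p) \<in> borel_measurable lebesgue"
proof -
  have "continuous_on UNIV (\<lambda>x. 1 / rdist J x ^ p)" by (intro continuous_intros) auto
  then show ?thesis by (intro measurable_completion) (simp add: borel_measurable_continuous_onI)
qed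

lemma inverse_rdist_bounds: "0 \<le> 1 / rdist J x ^ p" "1 / rdist J x ^ p \<le> 1"
  using rdist_ge_1[of J x] by (simp_all add: divide_simps)

lemma mass_integrable: "A \<in> lmeasurable \<Longrightarrow> set_integrable lebesgue A (\<lambda>x. 1 / rdist J x ^ p)"
  by (rule set_integrable_bounded[where B = 1]) (auto simp: inverse_rdist_bounds)

lemma mass_nonneg: "0 \<le> mass p A J"
  unfolding mass_def set_lebesgue_integral_def by (intro Bochner_Integration.integral_nonneg) (auto simp: indicator_def)

lemma mass_le_mass:
  assumes "A \<subseteq> B" "A \<in> lmeasurable" "B \<in> lmeasurable" "0 \<le> c"
    and "\<And>x. x \<in> A \<Longrightarrow> 1 / rdist J x ^ p \<le> c * (1 / rdist K x ^ q)"
  shows "mass p A J \<le> c * mass q B K"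
proof -
  have "mass p A J \<le> (LINT x:B|lebesgue. c * (1 / rdist K x ^ q))"
    unfolding mass_def set_lebesgue_integral_def
  proof (rule integral_mono)
    show "integrable lebesgue (\<lambda>x. indicator A x *\<^sub>R (1 / rdist J x ^ p))"
      using mass_integrable[OF assms(2)] by (simp add: set_integrable_def)
    show "integrable lebesgue (\<lambda>x. indicator B x *\<^sub>R (c * (1 / rdist K x ^ q)))"
      using set_integrable_mult_right[OF mass_integrable[OF assms(3), of K q], of c] by (simp add: set_integrable_def)
    show "indicator A x *\<^sub>R (1 / rdist J x ^ p) \<le> indicator B x *\<^sub>R (c * (1 / rdist K x ^ q))" for x
      using assms(1,4) assms(5)[of x] by (auto simp: indicator_def)
  qed
  also have "\<dots> = c * mass q B K" by (simp only: set_integral_mult_right mass_def)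
  finally show ?thesis .
qed

lemma mass_antimono_exponent:
  "A \<in> lmeasurable \<Longrightarrow> p \<le> q \<Longrightarrow> mass q A J \<le> mass p A J"
  using mass_le_mass[of A A 1 J q J p] by (simp add: rdist_power_antimono)

lemma mass_0: "A \<in> lmeasurable \<Longrightarrow> mass 0 A J = vol A"
  by (simp add: mass_def set_lebesgue_integral_def)

lemma mass_le_measure: "A \<in> lmeasurable \<Longrightarrow> mass p A J \<le> vol A"
  using mass_antimono_exponent[of A 0 p J] by (simp add: mass_0)

lemma sum_mass_le:
  assumes "finite F" "A \<in> lmeasurable" "\<And>x. x \<in> A \<Longrightarrow> (\<Sum>J\<in>F. \<gamma> J / rdist J x ^ p) \<le> b" 
  shows "(\<Sum>J\<in>F. \<gamma> J * mass p A J) \<le> b * vol A"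
proof -
  have int: "set_integrable lebesgue A (\<lambda>x. \<gamma> J * (1 / rdist J x ^ p))" for J
    using mass_integrable[OF assms(2)] by (intro set_integrable_mult_right) auto
  have "(\<Sum>J\<in>F. \<gamma> J * mass p A J) = (\<Sum>J\<in>F. LINT x:A|lebesgue. \<gamma> J * (1 / rdist J x ^ p))"
    by (simp only: set_integral_mult_right mass_def)
  also have "\<dots> = (LINT x:A|lebesgue. (\<Sum>J\<in>F. \<gamma> J * (1 / rdist J x ^ p)))"
    using int assms(1)
    unfolding set_lebesgue_integral_def set_integrable_def scaleR_sum_right
    by (subst Bochner_Integration.integral_sum) auto
  also have "\<dots> \<le> (LINT x:A|lebesgue. b)"
    unfolding set_lebesgue_integral_def
  proof (rule integral_mono)
    show "integrable lebesgue (\<lambda>x. indicator A x *\<^sub>R (\<Sum>J\<in>F. \<gamma> J * (1 / rdist J x ^ p)))"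
      using int unfolding set_integrable_def scaleR_sum_right by (intro Bochner_Integration.integrable_sum) auto
    show "integrable lebesgue (\<lambda>x. indicator A x *\<^sub>R b)"
      using assms(2) unfolding lmeasurable_iff_integrable by (rule integrable_scaleR_left)
    show "indicator A x *\<^sub>R (\<Sum>J\<in>F. \<gamma> J * (1 / rdist J x ^ p)) \<le> indicator A x *\<^sub>R b" for x
      using assms(3)[of x] by (auto simp: indicator_def)
  qed
  also have "\<dots> = b * vol A"
    by (simp add: set_lebesgue_integral_def)
  finally show ?thesis .
qed

definition local_density :: "real set \<Rightarrow> real set \<Rightarrow> real" where
  "local_density V J = mass 2 V J / ilength J"

abbreviation left_end :: "real set \<Rightarrow> real" where "left_end T \<equiv> icenter T - ilength T / 2"
abbreviation right_end :: "real set \<Rightarrow> real" where "right_end T \<equiv> icenter T + ilength T / 2"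

text \<open>If an endpoint of \<open>T\<close> separates \<open>x\<close> from the centre of \<open>J\<close>, the weight of \<open>J\<close> at \<open>x\<close> is at most its weight
at that endpoint. The sum over the two endpoints avoids deciding which of them it is.\<close>

definition edge :: "real set \<Rightarrow> real set \<Rightarrow> real" where
  "edge T J = 1 / (rdist J (left_end T))\<^sup>2 + 1 / (rdist J (right_end T))\<^sup>2"

abbreviation double :: "real set \<Rightarrow> real set" where
  "double T \<equiv> cball (icenter T) (ilength T)"

lemma edge_nonneg: "0 \<le> edge T J"
  by (simp add: edge_def)

lemma local_density_nonneg: "0 \<le> local_density V J"
  by (simp add: local_density_def mass_nonneg)

lemma square_inverse_mono: "0 < a \<Longrightarrow> a \<le> (b::real) \<Longrightarrow> 1 / b\<^sup>2 \<le> 1 / a\<^sup>2"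
  by (intro divide_left_mono power_mono) auto

context dyadic
begin

lemma mass_eq_density: "J \<in> D \<Longrightarrow> mass 2 V J = ilength J * local_density V J"
  using length_pos[of J] by (simp add: local_density_def)

lemma density_le_measure:
  assumes "V \<in> lmeasurable" "J \<in> D"
  shows "local_density V J \<le> vol V / ilength J"
  using mass_le_measure[OF assms(1), of 2 J] length_pos[OF assms(2)]
  by (simp add: local_density_def divide_right_mono)

lemma density_parent_le:
  assumes "V \<in> lmeasurable" "T \<in> D" "P \<in> D" "T \<subseteq> P" "ilength P = 2 * ilength T"
  shows "local_density V T \<le> 8 * local_density V P"
proof -
  have pos: "0 < ilength T" using assms length_pos by blast
  have c: "\<bar>icenter T - icenter P\<bar> \<le> ilength T"
    using near_center[OF assms(3), of "icenter T"] center_in[OF assms(2)] assms(4,5) by auto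
  have "mass 2 V T \<le> 4 * mass 2 V P"
  proof (rule mass_le_mass)
    fix x
    have "\<bar>x - icenter P\<bar> \<le> \<bar>x - icenter T\<bar> + ilength T" using c by linarith
    then have "\<bar>x - icenter P\<bar> / (2 * ilength T) \<le> (\<bar>x - icenter T\<bar> + ilength T) / (2 * ilength T)"
      using pos by (intro divide_right_mono) auto
    also have "\<dots> = \<bar>x - icenter T\<bar> / ilength T / 2 + 1 / 2"
      using pos by (simp add: field_simps)
    also have "\<dots> \<le> 2 * (\<bar>x - icenter T\<bar> / ilength T) + 1"
    proof -
      have "t / 2 + 1 / 2 \<le> 2 * t + 1" if "0 \<le> t" for t :: real using that by linarith
      then show ?thesis by (meson pos abs_ge_zero divide_nonneg_pos)
    qed
    finally have "rdist P x \<le> 2 * rdist T x"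
      by (simp add: rdist_def assms(5))
    then have "1 / (2 * rdist T x)\<^sup>2 \<le> 1 / (rdist P x)\<^sup>2" by (intro square_inverse_mono) auto
    then show "1 / (rdist T x)\<^sup>2 \<le> 4 * (1 / (rdist P x)\<^sup>2)" by (simp add: power_mult_distrib)
  qed (use assms in auto)
  then have "ilength T * local_density V T \<le> ilength T * (8 * local_density V P)"
    using mass_eq_density assms by simp
  then show ?thesis using pos by simp
qed

text \<open>The polynomial weight makes densities of intervals of equal length comparable, at the price of a power
of their distance.\<close>

lemma density_same_length_le:
  assumes "V \<in> lmeasurable" "J \<in> D" "Q \<in> D" "ilength J = ilength Q" "x \<in> Q"
  shows "local_density V J \<le> 4 * (rdist J x)\<^sup>2 * local_density V Q"
proof -
  define s where "s = ilength J"
  have s: "0 < s" "ilength J = s" "ilength Q = s" using assms length_pos s_def by auto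
  have c: "\<bar>x - icenter Q\<bar> \<le> s"
    using near_center[OF assms(3,5)] s by auto
  have "mass 2 V J \<le> 4 * (rdist J x)\<^sup>2 * mass 2 V Q"
  proof (rule mass_le_mass)
    fix y
    have "\<bar>y - icenter Q\<bar> \<le> \<bar>y - icenter J\<bar> + \<bar>x - icenter J\<bar> + s" using c by linarith
    then have "\<bar>y - icenter Q\<bar> / s \<le> (\<bar>y - icenter J\<bar> + \<bar>x - icenter J\<bar> + s) / s"
      using s by (intro divide_right_mono) auto
    also have "\<dots> = \<bar>y - icenter J\<bar> / s + \<bar>x - icenter J\<bar> / s + 1"
      using s by (simp add: field_simps)
    finally have "rdist Q y \<le> rdist J y + rdist J x" by (simp add: rdist_def s)
    also have "\<dots> \<le> 2 * rdist J x * rdist J y"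
    proof -
      have "rdist J y \<le> rdist J x * rdist J y" "rdist J x \<le> rdist J x * rdist J y"
        using mult_right_mono[OF rdist_ge_1[of J x], of "rdist J y"]
          mult_left_mono[OF rdist_ge_1[of J y], of "rdist J x"] by simp_all
      then show ?thesis by (simp only: mult.assoc)
    qed
    finally have "1 / (2 * rdist J x * rdist J y)\<^sup>2 \<le> 1 / (rdist Q y)\<^sup>2"
      by (intro square_inverse_mono) auto
    then show "1 / (rdist J y)\<^sup>2 \<le> 4 * (rdist J x)\<^sup>2 * (1 / (rdist Q y)\<^sup>2)"
      by (simp add: power_mult_distrib field_simps)
  qed (use assms in auto)
  then have "s * local_density V J \<le> s * (4 * (rdist J x)\<^sup>2 * local_density V Q)"
    using mass_eq_density assms s by (simp add: mult.left_commute)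
  then show ?thesis using s by simp
qed

lemma measure_double_le:
  assumes "V \<in> lmeasurable" "T \<in> D"
  shows "vol (V \<inter> double T) \<le> 4 * ilength T * local_density V T"
proof -
  have pos: "0 < ilength T" using assms length_pos by blast
  have V': "V \<inter> double T \<in> lmeasurable" using assms by (intro fmeasurable_Int_fmeasurable) auto
  have "mass 0 (V \<inter> double T) T \<le> 4 * mass 2 V T"
  proof (rule mass_le_mass)
    fix x assume "x \<in> V \<inter> double T"
    then have "\<bar>x - icenter T\<bar> \<le> ilength T" by (auto simp: dist_real_def abs_minus_commute)
    then have "rdist T x \<le> 2" using pos by (simp add: rdist_def)
    then have "1 / 2\<^sup>2 \<le> 1 / (rdist T x)\<^sup>2" by (intro square_inverse_mono) auto
    then show "1 / rdist T x ^ 0 \<le> 4 * (1 / (rdist T x)\<^sup>2)" by simp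
  qed (use assms V' in auto)
  then show ?thesis using mass_0[OF V'] mass_eq_density[OF assms(2), of V] by simp
qed

text \<open>Two points at distance \<open>d\<close> cannot both be near \<open>J\<close> unless \<open>J\<close> has length at least of order \<open>d\<close>. For \<open>y\<close> outside
\<open>double T\<close> the distance to a point of \<open>T\<close> is comparable with the distance to the centre of \<open>T\<close>.\<close>

lemma off_diagonal:
  assumes "T \<in> D" "J \<in> D" "x \<in> T" "y \<notin> double T"
  shows "ilength T / ilength J * rdist T y \<le> 4 * (rdist J x * rdist J y)"
proof -
  have pos: "0 < ilength T" "0 < ilength J" using assms length_pos by blast+
  have x: "\<bar>x - icenter T\<bar> \<le> ilength T / 2" using near_center assms by blast
  have y: "ilength T < \<bar>y - icenter T\<bar>" using assms(4) by (auto simp: dist_real_def abs_minus_commute)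
  have "ilength T * rdist T y = ilength T + \<bar>y - icenter T\<bar>" using pos by (simp add: rdist_def field_simps)
  also have "\<dots> \<le> 4 * \<bar>x - y\<bar>"
  proof -
    have "L + a \<le> 4 * d" if "b \<le> L / 2" "L < a" "a \<le> d + b" for L a b d :: real
      using that by linarith
    moreover have "\<bar>y - icenter T\<bar> \<le> \<bar>x - y\<bar> + \<bar>x - icenter T\<bar>" by linarith
    ultimately show ?thesis using x y by blast
  qed
  also have "\<dots> \<le> 4 * (\<bar>x - icenter J\<bar> + \<bar>y - icenter J\<bar>)"
    using abs_triangle_ineq4[of "x - icenter J" "y - icenter J"] by simp
  finally have "ilength T * rdist T y / ilength J \<le> 4 * (\<bar>x - icenter J\<bar> + \<bar>y - icenter J\<bar>) / ilength J"
    using pos by (intro divide_right_mono) auto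
  also have "\<dots> = 4 * ((rdist J x - 1) + (rdist J y - 1))"
    using pos by (simp add: rdist_def field_simps)
  also have "\<dots> \<le> 4 * (rdist J x * rdist J y)"
  proof -
    have "0 \<le> (rdist J x - 1) * (rdist J y - 1)" using rdist_ge_1 by (intro mult_nonneg_nonneg) auto
    then show ?thesis by (simp add: algebra_simps)
  qed
  finally show ?thesis by simp
qed

lemma rdist_edge_le:
  assumes "T \<in> D" "J \<in> D" "(x \<in> T \<and> icenter J \<notin> T) \<or> (x \<notin> T \<and> icenter J \<in> T)"
  shows "1 / (rdist J x)\<^sup>2 \<le> edge T J"
proof -
  have pos: "0 < ilength J" using assms length_pos by blast
  have one: "\<bar>p - q\<bar> \<ge> \<bar>left_end T - q\<bar> \<and> \<bar>p - q\<bar> \<ge> \<bar>left_end T - p\<bar> \<or>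
        \<bar>p - q\<bar> \<ge> \<bar>right_end T - q\<bar> \<and> \<bar>p - q\<bar> \<ge> \<bar>right_end T - p\<bar>"
    if "p \<in> T" "q \<notin> T" for p q
  proof -
    have p: "\<bar>p - icenter T\<bar> \<le> ilength T / 2" using near_center assms that by blast
    have q: "ilength T / 2 \<le> \<bar>q - icenter T\<bar>"
      using interior[OF assms(1), of q] that by (meson not_le)
    have p': "left_end T \<le> p" "p \<le> right_end T" using p unfolding abs_le_iff by linarith+
    have "q \<le> left_end T \<or> right_end T \<le> q" using q by (auto simp: abs_if split: if_splits)
    then show ?thesis using p' by auto
  qed
  have "\<bar>left_end T - icenter J\<bar> \<le> \<bar>x - icenter J\<bar> \<or> \<bar>right_end T - icenter J\<bar> \<le> \<bar>x - icenter J\<bar>"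
    using assms(3) one[of x "icenter J"] one[of "icenter J" x] by (auto simp: abs_minus_commute)
  then have "rdist J (left_end T) \<le> rdist J x \<or> rdist J (right_end T) \<le> rdist J x"
    using pos by (auto simp: rdist_def divide_right_mono)
  then have "1 / (rdist J x)\<^sup>2 \<le> 1 / (rdist J (left_end T))\<^sup>2 \<or> 1 / (rdist J x)\<^sup>2 \<le> 1 / (rdist J (right_end T))\<^sup>2"
    using square_inverse_mono by (metis rdist_pos(1))
  moreover have "0 \<le> 1 / (rdist J (left_end T))\<^sup>2" "0 \<le> 1 / (rdist J (right_end T))\<^sup>2" by simp_all
  ultimately show ?thesis unfolding edge_def by linarith
qed

text \<open>On each level the weights at one point sum to a constant, and the lengths of the levels below that of
\<open>T\<close> form a geometric series. Thus intervals separated from points by the boundary of \<open>T\<close>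
contribute only \<open>O(|T|)\<close> in total.\<close>

lemma sum_edge_le:
  assumes "T \<in> D" "finite F" "F \<subseteq> D" "\<And>J. J \<in> F \<Longrightarrow> ilength J \<le> ilength T"
  shows "(\<Sum>J\<in>F. ilength J * edge T J) \<le> 64 * ilength T"
proof -
  have pos: "0 \<le> ilength J" if "J \<in> F" for J using length_pos assms(3) that by (simp add: less_imp_le subset_iff)
  have one: "(\<Sum>J\<in>F. ilength J / (rdist J x)\<^sup>2) \<le> 32 * ilength T" for x
    using weighted_lattice_sum_le[OF assms(2,3), of "\<lambda>s. s" x] pos sum_lengths_le(1)[OF assms(2,3,1,4)] by simp
  have "(\<Sum>J\<in>F. ilength J * edge T J)
      = (\<Sum>J\<in>F. ilength J / (rdist J (left_end T))\<^sup>2) + (\<Sum>J\<in>F. ilength J / (rdist J (right_end T))\<^sup>2)"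
    by (simp add: edge_def distrib_left sum.distrib)
  then show ?thesis using one[of "left_end T"] one[of "right_end T"] by linarith
qed

text \<open>The weight is dominated by a sum over dyadic dilates; the finite truncation leaves an error that tends to
zero because \<open>V\<close> has finite measure.\<close>

lemma mass_le_shells:
  assumes V: "V \<in> lmeasurable" and Q: "Q \<in> D"
  shows "mass 2 V Q \<le> (\<Sum>k<n. 4 / 4 ^ k * vol (V \<inter> cball (icenter Q) (2 ^ k * ilength Q)))
    + 4 / 4 ^ n * vol V"
proof -
  define B where "B k = cball (icenter Q) (2 ^ k * ilength Q)" for k :: nat
  have pos: "0 < ilength Q" using Q length_pos by blast
  have far: "2 ^ k \<le> rdist Q x" if "x \<notin> B k" for k x
    using that pos by (auto simp: B_def rdist_def dist_real_def abs_minus_commute field_simps)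
  have pt: "1 / (rdist Q x)\<^sup>2 \<le> (\<Sum>k<n. 4 / 4 ^ k * indicator (B k) x) + 4 / 4 ^ n" for x
  proof (cases "\<exists>k<n. x \<in> B k")
    case True
    define k where "k = (LEAST k. x \<in> B k)"
    have k: "x \<in> B k" "k < n"
      using True unfolding k_def by (auto intro: LeastI le_less_trans[OF Least_le])
    have "1 / (rdist Q x)\<^sup>2 \<le> 4 / 4 ^ k"
    proof (cases k)
      case 0
      show ?thesis by (rule order_trans[OF inverse_rdist_bounds(2)]) (simp add: 0)
    next
      case (Suc j)
      then have "x \<notin> B j" using not_less_Least[of j "\<lambda>k. x \<in> B k"] by (simp add: k_def)
      then have "1 / (rdist Q x)\<^sup>2 \<le> 1 / (2 ^ j)\<^sup>2" using far by (intro square_inverse_mono) auto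
      also have "\<dots> = 4 / 4 ^ k" by (simp add: Suc power2_eq_square flip: power_mult_distrib)
      finally show ?thesis .
    qed
    also have "\<dots> \<le> (\<Sum>k<n. 4 / 4 ^ k * indicator (B k) x)"
      using k member_le_sum[where i = k and A = "{..<n}" and f = "\<lambda>k. 4 / 4 ^ k * indicat_real (B k) x"] by simp
    finally show ?thesis by (simp add: add_increasing2)
  next
    case False
    have "1 / (rdist Q x)\<^sup>2 \<le> 4 / 4 ^ n"
    proof (cases n)
      case 0
      show ?thesis by (rule order_trans[OF inverse_rdist_bounds(2)]) (simp add: 0)
    next
      case (Suc j)
      then have "1 / (rdist Q x)\<^sup>2 \<le> 1 / (2 ^ j)\<^sup>2" using far[of x j] False by (intro square_inverse_mono) auto
      also have "\<dots> = 4 / 4 ^ n" by (simp add: Suc power2_eq_square flip: power_mult_distrib)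
      finally show ?thesis .
    qed
    moreover have "0 \<le> (\<Sum>k<n. 4 / 4 ^ k * indicat_real (B k) x)" by (intro sum_nonneg) auto
    ultimately show ?thesis by linarith
  qed
  have VB: "V \<inter> B k \<in> lmeasurable" for k using V unfolding B_def by (intro fmeasurable_Int_fmeasurable) auto
  have "mass 2 V Q \<le> (\<integral>x. (\<Sum>k<n. 4 / 4 ^ k * indicator (V \<inter> B k) x) + 4 / 4 ^ n * indicator V x \<partial>lebesgue)"
    unfolding mass_def set_lebesgue_integral_def
  proof (rule integral_mono)
    show "integrable lebesgue (\<lambda>x. indicator V x *\<^sub>R (1 / rdist Q x ^ 2))"
      using mass_integrable[OF V] by (simp add: set_integrable_def)
    show "integrable lebesgue (\<lambda>x. (\<Sum>k<n. 4 / 4 ^ k * indicator (V \<inter> B k) x) + 4 / 4 ^ n * indicat_real V x)"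
      using V VB unfolding lmeasurable_iff_integrable
      by (intro Bochner_Integration.integrable_add Bochner_Integration.integrable_sum integrable_mult_right) auto
    show "indicator V x *\<^sub>R (1 / rdist Q x ^ 2) \<le> (\<Sum>k<n. 4 / 4 ^ k * indicator (V \<inter> B k) x) + 4 / 4 ^ n * indicat_real V x" for x
      using pt[of x] by (cases "x \<in> V") (auto simp: indicator_inter_arith)
  qed
  also have "\<dots> = (\<Sum>k<n. 4 / 4 ^ k * vol (V \<inter> B k)) + 4 / 4 ^ n * vol V"
    using V VB unfolding lmeasurable_iff_integrable
    by (subst Bochner_Integration.integral_add) (auto simp: Bochner_Integration.integral_sum)
  finally show ?thesis by (simp add: B_def)
qed

text \<open>If every dilate held little of \<open>V\<close>, the sum over shells would be below the assumed density. The balls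
found here are what the covering lemma needs.\<close>

lemma high_density_ball:
  assumes V: "V \<in> lmeasurable" and Q: "Q \<in> D" and \<epsilon>: "0 < \<epsilon>" "\<epsilon> \<le> local_density V Q"
  obtains k :: nat where "\<epsilon> / 16 * (2 ^ k * ilength Q) \<le> vol (V \<inter> cball (icenter Q) (2 ^ k * ilength Q))"
proof (rule ccontr)
  define B where "B k = cball (icenter Q) (2 ^ k * ilength Q)" for k :: nat
  define \<mu> where "\<mu> = vol V"
  assume "\<not> thesis"
  then have small: "vol (V \<inter> B k) < \<epsilon> / 16 * (2 ^ k * ilength Q)" for k
    using that unfolding B_def by (meson not_le)
  have pos: "0 < ilength Q" using Q length_pos by blast
  have main: "\<epsilon> * ilength Q \<le> \<epsilon> / 2 * ilength Q + 4 / 4 ^ n * \<mu>" for n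
  proof -
    have "\<epsilon> * ilength Q \<le> mass 2 V Q"
      using \<epsilon>(2) mass_eq_density[OF Q] pos by simp
    also have "\<dots> \<le> (\<Sum>k<n. 4 / 4 ^ k * vol (V \<inter> B k)) + 4 / 4 ^ n * \<mu>"
      unfolding B_def \<mu>_def by (rule mass_le_shells[OF V Q])
    also have "(\<Sum>k<n. 4 / 4 ^ k * vol (V \<inter> B k)) \<le> (\<Sum>k<n. \<epsilon> / 4 * ilength Q * (1/2) ^ k)"
    proof (rule sum_mono)
      fix k
      have "4 / 4 ^ k * vol (V \<inter> B k) \<le> 4 / 4 ^ k * (\<epsilon> / 16 * (2 ^ k * ilength Q))"
        using small[of k] by (intro mult_left_mono) auto
      also have "\<dots> = \<epsilon> / 4 * ilength Q * (2 ^ k / 4 ^ k)" by simp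
      also have "(2 ^ k / 4 ^ k) = (1/2 :: real) ^ k" by (simp flip: power_divide)
      finally show "4 / 4 ^ k * vol (V \<inter> B k) \<le> \<epsilon> / 4 * ilength Q * (1/2) ^ k" .
    qed
    also have "\<dots> = \<epsilon> / 4 * ilength Q * (\<Sum>k<n. (1/2) ^ k)" by (simp add: sum_distrib_left)
    also have "\<dots> \<le> \<epsilon> / 4 * ilength Q * 2"
    proof (rule mult_left_mono)
      have "(\<Sum>k<n. (1/2 :: real) ^ k) = 2 - 2 * (1/2) ^ n" by (induction n) auto
      then show "(\<Sum>k<n. (1/2 :: real) ^ k) \<le> 2" by simp
      show "0 \<le> \<epsilon> / 4 * ilength Q" using \<epsilon> pos by simp
    qed
    finally show ?thesis by simp
  qed
  obtain n where n: "8 * \<mu> / (\<epsilon> * ilength Q) < 4 ^ n" using real_arch_pow[of 4] by auto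
  have "8 * \<mu> < \<epsilon> * ilength Q * 4 ^ n" using n \<epsilon> pos by (simp add: divide_less_eq mult.commute)
  moreover have "\<epsilon> * ilength Q * 4 ^ n \<le> 8 * \<mu>" using main[of n] by (simp add: field_simps)
  ultimately show False by linarith
qed

lemma mass_tail_le:
  assumes V: "V \<in> lmeasurable" and J: "J \<in> D"
    and empty: "\<And>k. k < m \<Longrightarrow> V \<inter> cball (icenter J) (2 ^ k * ilength J) = {}"
  shows "mass 2 V J \<le> 16 / 2 ^ m * ilength J"
proof (rule ccontr)
  define B where "B k = cball (icenter J) (2 ^ k * ilength J)" for k :: nat
  define gap where "gap = mass 2 V J - 16 / 2 ^ m * ilength J"
  assume "\<not> ?thesis"
  then have gap: "0 < gap" by (simp add: gap_def)
  have pos: "0 < ilength J" using J length_pos by blast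
  have main: "mass 2 V J \<le> 16 / 2 ^ m * ilength J + 4 / 4 ^ (m + j) * vol V" for j
  proof -
    have "(\<Sum>k<m + j. 4 / 4 ^ k * vol (V \<inter> B k)) \<le> (\<Sum>k<m + j. (if k < m then 0 else 8 / 2 ^ k) * ilength J)"
    proof (rule sum_mono)
      fix k
      show "4 / 4 ^ k * vol (V \<inter> B k) \<le> (if k < m then 0 else 8 / 2 ^ k) * ilength J"
      proof (cases "k < m")
        case True
        then show ?thesis using empty[of k] by (simp add: B_def)
      next
        case False
        have "vol (V \<inter> B k) \<le> vol (B k)"
          using V by (intro measure_mono_fmeasurable) (auto simp: B_def intro: fmeasurableD)
        also have "\<dots> = 2 * 2 ^ k * ilength J"
          using pos by (simp add: B_def cball_eq_atLeastAtMost)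
        finally have "4 / 4 ^ k * vol (V \<inter> B k) \<le> 4 / 4 ^ k * (2 * 2 ^ k * ilength J)"
          by (intro mult_left_mono) auto
        also have "\<dots> = 8 * (2 ^ k / 4 ^ k) * ilength J" by simp
        also have "(2 ^ k / 4 ^ k) = (1/2 :: real) ^ k" by (simp flip: power_divide)
        finally show ?thesis using False by (simp add: power_divide)
      qed
    qed
    also have "\<dots> = (\<Sum>k<m + j. if k < m then 0 else 8 / 2 ^ k) * ilength J"
      by (simp only: sum_distrib_right)
    also have "(\<Sum>k<m + j. if k < m then 0 else 8 / 2 ^ k) = (16 / 2 ^ m - 16 / 2 ^ (m + j) :: real)"
    proof (induction j)
      case (Suc j)
      have "8 / 2 ^ (m + j) = (16 / 2 ^ (m + j) - 16 / 2 ^ (m + Suc j) :: real)" by simp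
      then show ?case using Suc.IH by simp
    qed simp
    also have "(16 / 2 ^ m - 16 / 2 ^ (m + j)) * ilength J \<le> 16 / 2 ^ m * ilength J"
      using pos by (intro mult_right_mono) auto
    finally show ?thesis using mass_le_shells[OF V J, of "m + j"] unfolding B_def by linarith
  qed
  obtain n where n: "4 * vol V / gap < 4 ^ n" using real_arch_pow[of 4] by auto
  also have "(4::real) ^ n \<le> 4 ^ (m + n)" by (intro power_increasing) auto
  finally have "4 / 4 ^ (m + n) * vol V < gap"
    using gap by (simp add: divide_less_eq mult.commute)
  then show False using main[of n] by (simp add: gap_def)
qed

lemma sum_disjoint_lengths_le:
  assumes "finite \<K>" "\<K> \<subseteq> D" "disjoint \<K>" "U \<in> lmeasurable" "\<Union>\<K> \<subseteq> U"
  shows "(\<Sum>K\<in>\<K>. ilength K) \<le> vol U"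
proof -
  have "(\<Sum>K\<in>\<K>. ilength K) = vol (\<Union>K\<in>\<K>. K)"
    using assms(1-3) interval_lmeasurable
    by (intro measure_UNION'[symmetric]) (auto simp: pairwise_def disjoint_def disjnt_def subset_iff)
  also have "\<dots> \<le> vol U"
    using assms interval_lmeasurable by (intro measure_mono_fmeasurable) (auto intro!: fmeasurableD fmeasurable.finite_Union)
  finally show ?thesis .
qed

text \<open>The weak-type bound for the maximal function of the local density. Each interval lies in a ball in which
\<open>V\<close> has measure at least \<open>\<epsilon> / 16\<close> times the radius; Vitali selects disjoint balls whose fivefold dilates cover, and
\<open>160 = 16 * 2 * 5\<close>.\<close>

lemma high_density_covering:
  assumes V: "V \<in> lmeasurable" and \<epsilon>: "0 < \<epsilon>"
    and \<K>: "finite \<K>" "\<K> \<subseteq> D" "disjoint \<K>"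
    and high: "\<And>K. K \<in> \<K> \<Longrightarrow> \<exists>Q\<in>D. K \<subseteq> Q \<and> \<epsilon> \<le> local_density V Q"
  shows "(\<Sum>K\<in>\<K>. ilength K) \<le> 160 / \<epsilon> * vol V"
proof -
  have "\<exists>a r. 0 < r \<and> K \<subseteq> cball a r \<and> \<epsilon> / 16 * r \<le> vol (V \<inter> cball a r)" if K: "K \<in> \<K>" for K
  proof -
    obtain Q where Q: "Q \<in> D" "K \<subseteq> Q" "\<epsilon> \<le> local_density V Q" using high K by blast
    obtain k :: nat where k: "\<epsilon> / 16 * (2 ^ k * ilength Q) \<le> vol (V \<inter> cball (icenter Q) (2 ^ k * ilength Q))"
      using high_density_ball[OF V Q(1) \<epsilon> Q(3)] by blast
    have pos: "0 < ilength Q" using Q length_pos by blast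
    have "ilength Q / 2 \<le> 2 ^ k * ilength Q"
    proof -
      have "(1/2::real) \<le> 2 ^ k" using one_le_power[of "2::real" k] by linarith
      then show ?thesis using mult_right_mono[of "1/2" "2 ^ k" "ilength Q"] pos by simp
    qed
    then have "Q \<subseteq> cball (icenter Q) (2 ^ k * ilength Q)"
      using near_center[OF Q(1)] by (force simp: dist_real_def abs_minus_commute)
    then show ?thesis using k pos Q(2)
      by (intro exI[of _ "icenter Q"] exI[of _ "2 ^ k * ilength Q"]) auto
  qed
  then obtain a r where ar: "\<And>K. K \<in> \<K> \<Longrightarrow> 0 < r K" "\<And>K. K \<in> \<K> \<Longrightarrow> K \<subseteq> cball (a K) (r K)"
    "\<And>K. K \<in> \<K> \<Longrightarrow> \<epsilon> / 16 * r K \<le> vol (V \<inter> cball (a K) (r K))"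
    by metis
  have cover: "\<Union>\<K> \<subseteq> (\<Union>K\<in>\<K>. cball (a K) (r K))" using ar(2) by blast
  have radii: "0 < r K \<and> r K \<le> (\<Sum>K\<in>\<K>. r K)" if "K \<in> \<K>" for K
    using ar(1) that \<K>(1) member_le_sum[where i = K and A = \<K> and f = r] less_imp_le by auto
  obtain \<C> where \<C>: "\<C> \<subseteq> \<K>"
    "pairwise (\<lambda>i j. disjnt (cball (a i) (r i)) (cball (a j) (r j))) \<C>"
    "\<Union>\<K> \<subseteq> (\<Union>K\<in>\<C>. cball (a K) (5 * r K))"
    by (rule Vitali_covering_lemma_cballs[OF cover radii])
  have fin: "finite \<C>" using \<C>(1) \<K>(1) finite_subset by blast
  have "(\<Sum>K\<in>\<K>. ilength K) \<le> vol (\<Union>K\<in>\<C>. cball (a K) (5 * r K))"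
    by (rule sum_disjoint_lengths_le[OF \<K> _ \<C>(3)]) (auto intro!: fmeasurable.finite_UN fin)
  also have "\<dots> \<le> (\<Sum>K\<in>\<C>. vol (cball (a K) (5 * r K)))"
    using fin by (intro measure_UNION_le) auto
  also have "\<dots> = (\<Sum>K\<in>\<C>. 160 / \<epsilon> * (\<epsilon> / 16 * r K))"
    using ar(1) \<C>(1) \<epsilon> by (intro sum.cong) (auto simp: cball_eq_atLeastAtMost subset_iff less_imp_le)
  also have "\<dots> \<le> (\<Sum>K\<in>\<C>. 160 / \<epsilon> * vol (V \<inter> cball (a K) (r K)))"
    using ar(3) \<C>(1) \<epsilon> by (intro sum_mono mult_left_mono) auto
  also have "\<dots> = 160 / \<epsilon> * (\<Sum>K\<in>\<C>. vol (V \<inter> cball (a K) (r K)))"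
    by (simp add: sum_distrib_left)
  also have "(\<Sum>K\<in>\<C>. vol (V \<inter> cball (a K) (r K))) = vol (\<Union>K\<in>\<C>. V \<inter> cball (a K) (r K))"
    using fin \<C>(2) V
    by (intro measure_UNION'[symmetric] fmeasurable_Int_fmeasurable) (auto simp: pairwise_def disjnt_def)
  also have "160 / \<epsilon> * \<dots> \<le> 160 / \<epsilon> * vol V"
    using \<epsilon> V fin
    by (intro mult_left_mono measure_mono_fmeasurable) (auto intro!: sets.finite_UN dest: fmeasurableD)
  finally show ?thesis .
qed

end

section \<open>Wavelet coefficients\<close>

text \<open>The eighth power supplies four inverse squares of the relative distance: one is spent where an
endpoint separates an interval from \<open>V\<close>, two on comparing densities, and one is integrated.\<close>

locale wavelet_basis = dyadic +
  fixes w :: "real \<Rightarrow> real" and C :: real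
  assumes decay: "\<bar>w x\<bar> \<le> C / (1 + \<bar>x\<bar>) ^ 8"
    and basis: "L2_orthonormal_basis D (wavelet w)"
begin

lemma C_nonneg: "0 \<le> C"
  using decay[of 0] by simp

lemmas wavelet_L2 = basis_L2[OF basis]

definition coef :: "real set \<Rightarrow> real set \<Rightarrow> real" where
  "coef A J = L2_inner (indicator A) (wavelet w J)"

text \<open>The part of the Parseval sum of \<open>1\<^sub>A\<close> and \<open>1\<^sub>B\<close> that comes from a family of intervals. Over the whole
grid it is \<open>|A \<inter> B|\<close>, hence it vanishes for disjoint sets.\<close>

definition pairing :: "real set \<Rightarrow> real set \<Rightarrow> real set set \<Rightarrow> real" where
  "pairing A B X = (\<Sum>\<^sub>\<infinity>J\<in>X. coef A J * coef B J)"

lemma wavelet_eq: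
  assumes "J \<in> D"
  shows "wavelet w J x = 1 / sqrt (ilength J) * w ((x - icenter J) / ilength J)"
proof -
  have "ilength J powr (-1/2) = 1 / sqrt (ilength J)"
    using powr_minus_divide[of "ilength J" "1/2"] powr_half_sqrt[of "ilength J"] length_pos[OF assms] by simp
  then show ?thesis unfolding wavelet_def by (rule arg_cong)
qed

lemma wavelet_le:
  assumes "J \<in> D"
  shows "\<bar>wavelet w J x\<bar> \<le> C / sqrt (ilength J) * (1 / rdist J x ^ 8)"
proof -
  have pos: "0 < ilength J" using assms length_pos by blast
  have "\<bar>wavelet w J x\<bar> = 1 / sqrt (ilength J) * \<bar>w ((x - icenter J) / ilength J)\<bar>"
    using pos by (simp add: wavelet_eq[OF assms] abs_mult)
  also have "\<dots> \<le> 1 / sqrt (ilength J) * (C / rdist J x ^ 8)"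
    using decay[of "(x - icenter J) / ilength J"] pos
    by (intro mult_left_mono) (simp_all add: rdist_def)
  finally show ?thesis by simp
qed

lemma coef_le:
  assumes "A \<in> lmeasurable" "J \<in> D"
  shows "\<bar>coef A J\<bar> \<le> C / sqrt (ilength J) * mass 8 A J"
proof -
  have "\<bar>coef A J\<bar> \<le> (\<integral>x. \<bar>indicator A x * wavelet w J x\<bar> \<partial>lebesgue)"
    unfolding coef_def L2_inner_def by (rule integral_abs_bound)
  also have "\<dots> \<le> (\<integral>x. C / sqrt (ilength J) * (indicator A x *\<^sub>R (1 / rdist J x ^ 8)) \<partial>lebesgue)"
  proof (rule integral_mono)
    show "integrable lebesgue (\<lambda>x. \<bar>indicator A x * wavelet w J x\<bar>)"
      using L2_mult_integrable[OF L2_indicator[OF assms(1)] wavelet_L2[OF assms(2)]] by simp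
    show "integrable lebesgue (\<lambda>x. C / sqrt (ilength J) * (indicator A x *\<^sub>R (1 / rdist J x ^ 8)))"
      using mass_integrable[OF assms(1)] unfolding set_integrable_def by (intro integrable_mult_right) auto
    show "\<bar>indicator A x * wavelet w J x\<bar> \<le> C / sqrt (ilength J) * (indicator A x *\<^sub>R (1 / rdist J x ^ 8))" for x
      using wavelet_le[OF assms(2), of x] by (simp add: indicator_def)
  qed
  also have "\<dots> = C / sqrt (ilength J) * mass 8 A J"
    unfolding mass_def set_lebesgue_integral_def by (rule integral_mult_right_zero)
  finally show ?thesis .
qed

lemma coef_le_density:
  assumes "A \<in> lmeasurable" "J \<in> D"
  shows "\<bar>coef A J\<bar> \<le> C * sqrt (ilength J) * local_density A J"
proof -
  have pos: "0 < ilength J" using assms length_pos by blast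
  have "\<bar>coef A J\<bar> \<le> C / sqrt (ilength J) * mass 2 A J"
  proof (rule order_trans[OF coef_le[OF assms]], rule mult_left_mono)
    show "mass 8 A J \<le> mass 2 A J" using mass_antimono_exponent[OF assms(1), of 2 8 J] by simp
    show "0 \<le> C / sqrt (ilength J)" using C_nonneg pos by simp
  qed
  also have "\<dots> = C * sqrt (ilength J) * local_density A J"
    using pos mass_eq_density[OF assms(2), of A] by (simp add: field_simps)
  finally show ?thesis .
qed

lemma coef_product_le:
  assumes "A \<in> lmeasurable" "B \<in> lmeasurable" "J \<in> D"
  shows "\<bar>coef A J * coef B J\<bar> \<le> C\<^sup>2 / ilength J * (mass 8 A J * mass 8 B J)"
proof -
  have pos: "0 < ilength J" using assms length_pos by blast
  have "\<bar>coef A J * coef B J\<bar> \<le> (C / sqrt (ilength J) * mass 8 A J) * (C / sqrt (ilength J) * mass 8 B J)"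
    unfolding abs_mult using coef_le assms by (intro mult_mono') auto
  also have "\<dots> = C\<^sup>2 / (sqrt (ilength J) * sqrt (ilength J)) * (mass 8 A J * mass 8 B J)"
    by (simp add: power2_eq_square)
  finally show ?thesis using pos by simp
qed

lemma coef_disjoint_Un:
  assumes "A \<in> lmeasurable" "B \<in> lmeasurable" "A \<inter> B = {}" "J \<in> D"
  shows "coef (A \<union> B) J = coef A J + coef B J"
proof -
  have "indicator (A \<union> B) = (\<lambda>x. indicator A x + indicator B x :: real)"
    using assms(3) by (intro ext) (auto simp: indicator_def)
  then show ?thesis
    using L2_inner_add_left[OF L2_indicator[OF assms(1)] L2_indicator[OF assms(2)] wavelet_L2[OF assms(4)]]
    by (simp add: coef_def)
qed

lemma coef_split:
  assumes "V \<in> lmeasurable" "A \<in> sets lebesgue" "J \<in> D"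
  shows "coef V J = coef (V \<inter> A) J + coef (V - A) J"
proof -
  have "coef ((V \<inter> A) \<union> (V - A)) J = coef (V \<inter> A) J + coef (V - A) J"
    using assms by (intro coef_disjoint_Un) (auto intro: fmeasurable_Int_fmeasurable fmeasurable_Diff)
  moreover have "(V \<inter> A) \<union> (V - A) = V" by blast
  ultimately show ?thesis by simp
qed

lemma coef_square_sum_le:
  assumes "A \<in> lmeasurable" "finite F" "F \<subseteq> D"
  shows "(\<Sum>J\<in>F. (coef A J)\<^sup>2) \<le> vol A"
  using bessel[OF basis assms(2,3) L2_indicator[OF assms(1)]] L2_inner_indicator[OF assms(1,1)]
  by (simp add: coef_def)

lemma pairing_summable:
  assumes "A \<in> lmeasurable" "B \<in> lmeasurable" "X \<subseteq> D"
  shows "(\<lambda>J. coef A J * coef B J) summable_on X" "(\<lambda>J. \<bar>coef A J * coef B J\<bar>) summable_on X"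
proof -
  have "(\<lambda>J. norm (coef A J * coef B J)) summable_on D"
    using coefficient_products_abs_summable[OF basis L2_indicator[OF assms(1)] L2_indicator[OF assms(2)]]
    by (simp add: coef_def)
  then have *: "(\<lambda>J. norm (coef A J * coef B J)) summable_on X"
    using assms(3) summable_on_subset_banach by blast
  then show "(\<lambda>J. coef A J * coef B J) summable_on X" by (rule abs_summable_summable)
  show "(\<lambda>J. \<bar>coef A J * coef B J\<bar>) summable_on X" using * by simp
qed

lemma pairing_all:
  assumes "A \<in> lmeasurable" "B \<in> lmeasurable"
  shows "pairing A B D = vol (A \<inter> B)"
  using parseval[OF basis L2_indicator[OF assms(1)] L2_indicator[OF assms(2)]] L2_inner_indicator[OF assms]
  unfolding pairing_def coef_def by (metis infsumI)

lemma pairing_Un: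
  assumes "A \<in> lmeasurable" "B \<in> lmeasurable" "X \<subseteq> D" "Y \<subseteq> D" "X \<inter> Y = {}"
  shows "pairing A B (X \<union> Y) = pairing A B X + pairing A B Y"
  unfolding pairing_def using assms by (intro infsum_Un_disjoint pairing_summable) auto

lemma pairing_split_left:
  assumes "V \<in> lmeasurable" "A \<in> sets lebesgue" "B \<in> lmeasurable" "X \<subseteq> D"
  shows "pairing V B X = pairing (V \<inter> A) B X + pairing (V - A) B X"
proof -
  have m: "V \<inter> A \<in> lmeasurable" "V - A \<in> lmeasurable"
    using assms by (auto intro: fmeasurable_Int_fmeasurable fmeasurable_Diff)
  have "pairing V B X = (\<Sum>\<^sub>\<infinity>J\<in>X. coef (V \<inter> A) J * coef B J + coef (V - A) J * coef B J)"
    unfolding pairing_def using coef_split[OF assms(1,2)] assms(4)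
    by (intro infsum_cong) (auto simp: distrib_right subset_iff)
  also have "\<dots> = pairing (V \<inter> A) B X + pairing (V - A) B X"
    unfolding pairing_def using m assms by (intro infsum_add pairing_summable)
  finally show ?thesis .
qed

lemma pairing_le:
  assumes "\<And>F. finite F \<Longrightarrow> F \<subseteq> X \<Longrightarrow> (\<Sum>J\<in>F. \<bar>coef A J * coef B J\<bar>) \<le> b"
  shows "\<bar>pairing A B X\<bar> \<le> b"
  unfolding pairing_def by (rule infsum_abs_le_of_finite_sums[OF assms])

lemma mass_off_diagonal:
  assumes "V \<in> lmeasurable" "T \<in> D" "J \<in> D" "x \<in> T"
  shows "mass 8 (V - double T) J \<le> 16 * (ilength J / ilength T)\<^sup>2 * (rdist J x)\<^sup>2 * mass 2 V T"
proof (rule mass_le_mass)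
  fix y assume y: "y \<in> V - double T"
  have pos: "0 < ilength T" "0 < ilength J" using assms length_pos by blast+
  have "ilength T / ilength J * rdist T y \<le> 4 * (rdist J x * rdist J y)"
    using off_diagonal assms y by blast
  then have "1 / (4 * (rdist J x * rdist J y))\<^sup>2 \<le> 1 / (ilength T / ilength J * rdist T y)\<^sup>2"
    using pos by (intro square_inverse_mono) auto
  then have "1 / (rdist J y)\<^sup>2 \<le> 16 * (ilength J / ilength T)\<^sup>2 * (rdist J x)\<^sup>2 * (1 / (rdist T y)\<^sup>2)"
    using pos by (simp add: power_mult_distrib power_divide field_simps)
  then show "1 / rdist J y ^ 8 \<le> 16 * (ilength J / ilength T)\<^sup>2 * (rdist J x)\<^sup>2 * (1 / (rdist T y)\<^sup>2)"
    using rdist_power_antimono[of 2 8 J y] by simp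
qed (use assms in \<open>auto intro: fmeasurable_Diff\<close>)

text \<open>Integrating the pointwise estimate over \<open>V \<inter> T\<close> gives the bound for the product without a double integral.\<close>

lemma mass_product_off_diagonal:
  assumes "V \<in> lmeasurable" "T \<in> D" "J \<in> D"
  shows "mass 8 (V - double T) J * mass 8 (V \<inter> T) J
    \<le> 16 * (ilength J)\<^sup>2 / ilength T * local_density V T * mass 2 (V \<inter> T) J"
proof -
  define M where "M = mass 8 (V - double T) J"
  define c where "c = 16 * (ilength J / ilength T)\<^sup>2 * mass 2 V T"
  have pos: "0 < ilength T" "0 < ilength J" using assms length_pos by blast+
  have c: "c = 16 * (ilength J)\<^sup>2 / ilength T * local_density V T"
    using mass_eq_density[OF assms(2), of V] pos by (simp add: c_def power2_eq_square)
  have VT: "V \<inter> T \<in> lmeasurable" using assms interval_lmeasurable by (auto intro: fmeasurable_Int_fmeasurable fmeasurableD)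
  have "0 \<le> c" by (simp add: c_def mass_nonneg)
  have "M * mass 8 (V \<inter> T) J \<le> c * mass 2 (V \<inter> T) J"
  proof (cases "M = 0")
    case True
    then show ?thesis using \<open>0 \<le> c\<close> by (simp add: mass_nonneg)
  next
    case False
    then have M: "0 < M" using mass_nonneg[of 8 "V - double T" J] by (simp add: M_def)
    have "mass 8 (V \<inter> T) J \<le> c / M * mass 2 (V \<inter> T) J"
    proof (rule mass_le_mass)
      fix x assume "x \<in> V \<inter> T"
      then have "M \<le> c * (rdist J x)\<^sup>2"
        using mass_off_diagonal[OF assms, of x] by (simp add: M_def c_def mult_ac)
      then have "1 / (rdist J x)\<^sup>2 \<le> c / M" using M by (simp add: field_simps)
      then have "1 / (rdist J x)\<^sup>2 * (1 / (rdist J x)\<^sup>2) \<le> c / M * (1 / (rdist J x)\<^sup>2)"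
        by (intro mult_right_mono) auto
      then have "1 / rdist J x ^ 4 \<le> c / M * (1 / (rdist J x)\<^sup>2)" by (simp flip: power_add)
      then show "1 / rdist J x ^ 8 \<le> c / M * (1 / (rdist J x)\<^sup>2)"
        using rdist_power_antimono[of 4 8 J x] by simp
    qed (use VT M \<open>0 \<le> c\<close> in auto)
    then show ?thesis using M by (simp add: field_simps)
  qed
  then show ?thesis by (simp add: M_def c)
qed

lemma sum_mass_inverse_length_le:
  assumes "A \<in> lmeasurable" "T \<in> D" "finite F" "F \<subseteq> D" "\<And>J. J \<in> F \<Longrightarrow> ilength T \<le> ilength J"
  shows "(\<Sum>J\<in>F. 1 / ilength J * mass 2 A J) \<le> 32 / ilength T * vol A"
proof (rule sum_mass_le[OF assms(3,1)])
  fix x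
  have "(\<Sum>J\<in>F. 1 / ilength J / (rdist J x)\<^sup>2) \<le> 16 * (\<Sum>s\<in>ilength ` F. 1 / s)"
    using assms by (intro weighted_lattice_sum_le) auto
  also have "\<dots> \<le> 16 * (2 / ilength T)"
    using sum_inverse_lengths_le(1)[OF assms(3,4,2,5)] by simp
  finally show "(\<Sum>J\<in>F. 1 / ilength J / (rdist J x)\<^sup>2) \<le> 32 / ilength T" by simp
qed

lemma sum_mass_length_le:
  assumes "A \<in> lmeasurable" "T \<in> D" "finite F" "F \<subseteq> D" "\<And>J. J \<in> F \<Longrightarrow> ilength J \<le> ilength T"
  shows "(\<Sum>J\<in>F. ilength J * mass 2 A J) \<le> 32 * ilength T * vol A"
proof (rule sum_mass_le[OF assms(3,1)])
  fix x
  have "(\<Sum>J\<in>F. ilength J / (rdist J x)\<^sup>2) \<le> 16 * (\<Sum>s\<in>ilength ` F. s)"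
    using assms by (intro weighted_lattice_sum_le) auto
  also have "\<dots> \<le> 16 * (2 * ilength T)"
    using sum_lengths_le(1)[OF assms(3,4,2,5)] by simp
  finally show "(\<Sum>J\<in>F. ilength J / (rdist J x)\<^sup>2) \<le> 32 * ilength T" by simp
qed

text \<open>The kernel estimate for the projection onto the scales coarser than \<open>T\<close>. The part of \<open>V\<close> near \<open>T\<close> is
summed absolutely over the longer intervals. The far part is disjoint from \<open>V \<inter> T\<close>, so its full Parseval sum
is zero and the sum over the longer intervals is minus that over the shorter ones, where both factors
are decaying tails.\<close>

lemma coarse_pairing_le:
  assumes V: "V \<in> lmeasurable" and T: "T \<in> D"
  shows "\<bar>pairing V (V \<inter> T) {J \<in> D. ilength T < ilength J}\<bar> \<le> 640 * C\<^sup>2 * local_density V T * vol (V \<inter> T)"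
proof -
  let ?X = "{J \<in> D. ilength T < ilength J}" and ?Y = "{J \<in> D. ilength J \<le> ilength T}"
  have pos: "0 < ilength T" using T length_pos by blast
  have VT: "V \<inter> T \<in> lmeasurable" and VN: "V \<inter> double T \<in> lmeasurable" and VF: "V - double T \<in> lmeasurable"
    using V T interval_lmeasurable by (auto intro: fmeasurable_Int_fmeasurable fmeasurableD fmeasurable_Diff)
  have "T \<subseteq> double T" using near_center[OF T] pos by (force simp: dist_real_def abs_minus_commute)
  have near: "\<bar>pairing (V \<inter> double T) (V \<inter> T) ?X\<bar> \<le> 128 * C\<^sup>2 * local_density V T * vol (V \<inter> T)"
  proof (rule pairing_le)
    fix F assume F: "finite F" "F \<subseteq> ?X"
    let ?m = "vol (V \<inter> double T)"
    have "(\<Sum>J\<in>F. \<bar>coef (V \<inter> double T) J * coef (V \<inter> T) J\<bar>) \<le> (\<Sum>J\<in>F. C\<^sup>2 * ?m * (1 / ilength J * mass 2 (V \<inter> T) J))"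
    proof (rule sum_mono)
      fix J assume "J \<in> F"
      then have J: "J \<in> D" "0 < ilength J" using F length_pos by auto
      have "\<bar>coef (V \<inter> double T) J * coef (V \<inter> T) J\<bar> \<le> C\<^sup>2 / ilength J * (mass 8 (V \<inter> double T) J * mass 8 (V \<inter> T) J)"
        by (rule coef_product_le[OF VN VT J(1)])
      also have "\<dots> \<le> C\<^sup>2 / ilength J * (?m * mass 2 (V \<inter> T) J)"
        using J(2) mass_le_measure[OF VN] mass_antimono_exponent[OF VT, of 2 8 J]
        by (intro mult_left_mono mult_mono) (auto simp: mass_nonneg)
      finally show "\<bar>coef (V \<inter> double T) J * coef (V \<inter> T) J\<bar> \<le> C\<^sup>2 * ?m * (1 / ilength J * mass 2 (V \<inter> T) J)"
        by (simp add: mult_ac)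
    qed
    also have "\<dots> = C\<^sup>2 * ?m * (\<Sum>J\<in>F. 1 / ilength J * mass 2 (V \<inter> T) J)"
      by (simp only: sum_distrib_left)
    also have "\<dots> \<le> C\<^sup>2 * ?m * (32 / ilength T * vol (V \<inter> T))"
      using F by (intro mult_left_mono sum_mass_inverse_length_le VT T) auto
    also have "\<dots> \<le> C\<^sup>2 * (4 * ilength T * local_density V T) * (32 / ilength T * vol (V \<inter> T))"
      using measure_double_le[OF V T] pos by (intro mult_right_mono mult_left_mono) auto
    also have "\<dots> = 128 * C\<^sup>2 * local_density V T * vol (V \<inter> T)" using pos by simp
    finally show "(\<Sum>J\<in>F. \<bar>coef (V \<inter> double T) J * coef (V \<inter> T) J\<bar>) \<le> 128 * C\<^sup>2 * local_density V T * vol (V \<inter> T)" .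
  qed
  have far: "\<bar>pairing (V - double T) (V \<inter> T) ?Y\<bar> \<le> 512 * C\<^sup>2 * local_density V T * vol (V \<inter> T)"
  proof (rule pairing_le)
    fix F assume F: "finite F" "F \<subseteq> ?Y"
    let ?c = "16 * C\<^sup>2 * local_density V T / ilength T"
    have "(\<Sum>J\<in>F. \<bar>coef (V - double T) J * coef (V \<inter> T) J\<bar>) \<le> (\<Sum>J\<in>F. ?c * (ilength J * mass 2 (V \<inter> T) J))"
    proof (rule sum_mono)
      fix J assume "J \<in> F"
      then have J: "J \<in> D" "0 < ilength J" using F length_pos by auto
      have "\<bar>coef (V - double T) J * coef (V \<inter> T) J\<bar> \<le> C\<^sup>2 / ilength J * (mass 8 (V - double T) J * mass 8 (V \<inter> T) J)"
        by (rule coef_product_le[OF VF VT J(1)])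
      also have "\<dots> \<le> C\<^sup>2 / ilength J * (16 * (ilength J)\<^sup>2 / ilength T * local_density V T * mass 2 (V \<inter> T) J)"
        using J(2) mass_product_off_diagonal[OF V T J(1)] by (intro mult_left_mono) auto
      also have "\<dots> = ?c * (ilength J * mass 2 (V \<inter> T) J)"
        using J(2) by (simp add: power2_eq_square)
      finally show "\<bar>coef (V - double T) J * coef (V \<inter> T) J\<bar> \<le> ?c * (ilength J * mass 2 (V \<inter> T) J)" .
    qed
    also have "\<dots> = ?c * (\<Sum>J\<in>F. ilength J * mass 2 (V \<inter> T) J)"
      by (simp only: sum_distrib_left)
    also have "\<dots> \<le> ?c * (32 * ilength T * vol (V \<inter> T))"
      using F pos local_density_nonneg by (intro mult_left_mono sum_mass_length_le VT T) auto
    also have "\<dots> = 512 * C\<^sup>2 * local_density V T * vol (V \<inter> T)" using pos by simp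
    finally show "(\<Sum>J\<in>F. \<bar>coef (V - double T) J * coef (V \<inter> T) J\<bar>) \<le> 512 * C\<^sup>2 * local_density V T * vol (V \<inter> T)" .
  qed
  have XY: "?X \<union> ?Y = D" "?X \<inter> ?Y = {}" by auto
  have empty: "(V - double T) \<inter> (V \<inter> T) = {}" using \<open>T \<subseteq> double T\<close> by blast
  \<comment> \<open>Disjointness exchanges the longer intervals for the shorter ones.\<close>
  have "pairing (V - double T) (V \<inter> T) ?X + pairing (V - double T) (V \<inter> T) ?Y = pairing (V - double T) (V \<inter> T) D"
    using pairing_Un[OF VF VT _ _ XY(2)] XY(1) by auto
  also have "\<dots> = 0" using pairing_all[OF VF VT] by (simp only: empty measure_empty)
  finally have "pairing (V - double T) (V \<inter> T) ?X = - pairing (V - double T) (V \<inter> T) ?Y" by simp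
  moreover have "pairing V (V \<inter> T) ?X = pairing (V \<inter> double T) (V \<inter> T) ?X + pairing (V - double T) (V \<inter> T) ?X"
    using V VT by (intro pairing_split_left) auto
  ultimately have "\<bar>pairing V (V \<inter> T) ?X\<bar> \<le> \<bar>pairing (V \<inter> double T) (V \<inter> T) ?X\<bar> + \<bar>pairing (V - double T) (V \<inter> T) ?Y\<bar>"
    by simp
  then show ?thesis using near far by (simp add: algebra_simps)
qed

end

section \<open>Intervals without a dense ancestor\<close>

context wavelet_basis
begin

text \<open>Asking for low density of all larger intervals as well makes the family closed under passing to larger
intervals, as a stopping argument requires.\<close>

definition sparse :: "real set \<Rightarrow> real \<Rightarrow> real set set" where
  "sparse V \<epsilon> = {J \<in> D. \<forall>Q\<in>D. J \<subseteq> Q \<longrightarrow> local_density V Q < \<epsilon>}"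

lemma not_sparse_dense_ancestor:
  "J \<in> D \<Longrightarrow> J \<notin> sparse V \<epsilon> \<Longrightarrow> \<exists>Q\<in>D. J \<subseteq> Q \<and> \<epsilon> \<le> local_density V Q"
  unfolding sparse_def by force

lemma sparse_upward: "J \<in> sparse V \<epsilon> \<Longrightarrow> K \<in> D \<Longrightarrow> J \<subseteq> K \<Longrightarrow> K \<in> sparse V \<epsilon>"
  unfolding sparse_def by blast

lemma long_sparse:
  assumes "V \<in> lmeasurable" "J \<in> D" "vol V < \<epsilon> * ilength J"
  shows "J \<in> sparse V \<epsilon>"
  unfolding sparse_def
proof (intro CollectI conjI ballI impI)
  fix Q assume Q: "Q \<in> D" "J \<subseteq> Q"
  have pos: "0 < ilength Q" "0 < ilength J" using Q assms length_pos by auto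
  have "0 < \<epsilon> * ilength J" using assms(3) measure_nonneg[of lebesgue V] by linarith
  then have "0 < \<epsilon>" using pos by (simp add: zero_less_mult_iff)
  then have "\<epsilon> * ilength J \<le> \<epsilon> * ilength Q" using subset_length_le[OF assms(2) Q] by simp
  then have "vol V / ilength Q < \<epsilon>" using assms(3) pos by (simp add: divide_less_eq)
  then show "local_density V Q < \<epsilon>" using density_le_measure[OF assms(1) Q(1)] by linarith
qed (rule assms)

end

text \<open>The sparse intervals are truncated at length \<open>2\<^sup>k\<close>, so that every point has a smallest one containing it
and the stopping intervals below partition the line.\<close>

locale stopping = wavelet_basis +
  fixes V :: "real set" and \<epsilon> :: real and k :: int
  assumes V: "V \<in> lmeasurable" and \<epsilon>: "0 < \<epsilon>"
begin

definition upper :: "real set set" where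
  "upper = {J \<in> sparse V \<epsilon>. 2 powi k < ilength J}"

text \<open>A top longer than \<open>2\<^sup>k\<close> has a dense ancestor, so the covering bound controls the total length of such
tops. A top of length \<open>2\<^sup>k\<close> is shorter than every interval of \<open>upper\<close>, and no interval
contained in it is longer than another top; it causes no error term.\<close>

definition tops :: "real set set" where
  "tops = {T \<in> D. T \<notin> upper \<and> (\<forall>Q\<in>D. T \<subset> Q \<longrightarrow> Q \<in> upper)}"

lemma upper_grid: "upper \<subseteq> D"
  by (auto simp: upper_def sparse_def)

lemma upper_density: "J \<in> upper \<Longrightarrow> local_density V J < \<epsilon>"
  by (auto simp: upper_def sparse_def)

lemma upper_upward:
  assumes "J \<in> upper" "K \<in> D" "J \<subseteq> K"
  shows "K \<in> upper"
  using sparse_upward[OF _ assms(2,3)] subset_length_le[OF _ assms(2,3)] assms(1) upper_grid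
  by (force simp: upper_def)

lemma tops_grid: "tops \<subseteq> D"
  by (auto simp: tops_def)

lemma tops_cover: "\<exists>T\<in>tops. x \<in> T"
proof -
  obtain c where c: "\<And>i::int. c i \<in> D \<and> ilength (c i) = 2 powi i \<and> x \<in> c i"
    using cell_exists[of _ x] by metis
  define P where "P m \<longleftrightarrow> (\<forall>m'\<ge>m. c (k + int m') \<in> upper)" for m :: nat
  obtain M where M: "vol V / (\<epsilon> * 2 powi k) < 2 ^ M"
    using real_arch_pow[of 2] by auto
  \<comment> \<open>Beyond level \<open>k + M\<close> every cell is so long that \<open>|V|\<close> cannot make it dense.\<close>
  have "P (Suc M)"
    unfolding P_def
  proof (intro allI impI)
    fix m' assume m': "Suc M \<le> m'"
    have l: "ilength (c (k + int m')) = 2 powi k * 2 ^ m'"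
      using c[of "k + int m'"] by (simp add: power_int_add)
    have "vol V < \<epsilon> * (2 powi k * 2 ^ M)"
      using M \<epsilon> by (simp add: divide_less_eq mult_ac)
    also have "\<dots> \<le> \<epsilon> * (2 powi k * 2 ^ m')"
      using m' \<epsilon> by (intro mult_left_mono power_increasing) auto
    finally have "c (k + int m') \<in> sparse V \<epsilon>"
      using l c by (intro long_sparse V) auto
    moreover have "(2::real) powi k * 1 < 2 powi k * 2 ^ m'"
      using m' by (intro mult_strict_left_mono one_less_power) auto
    ultimately show "c (k + int m') \<in> upper" using l by (simp add: upper_def)
  qed
  define m where "m = (LEAST m. P m)"
  have Pm: "P m" unfolding m_def using \<open>P (Suc M)\<close> by (rule LeastI)
  have "m \<noteq> 0"
  proof
    assume "m = 0"
    then have "c (k + int 0) \<in> upper" using Pm unfolding P_def by blast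
    then have "c k \<in> upper" by simp
    then show False using c[of k] by (simp add: upper_def)
  qed
  then obtain j where j: "m = Suc j" using not0_implies_Suc by blast
  have "\<not> P j" using not_less_Least[of j P] j by (simp add: m_def)
  then have low: "c (k + int j) \<notin> upper"
    using Pm j unfolding P_def by (metis le_antisym not_less_eq_eq)
  have "c (k + int j) \<in> tops"
    unfolding tops_def
  proof (intro CollectI conjI ballI impI low)
    show "c (k + int j) \<in> D" using c by blast
    fix Q assume Q: "Q \<in> D" "c (k + int j) \<subset> Q"
    have "2 * ilength (c (k + int j)) \<le> ilength Q"
      using strict_superset_length[OF _ Q] c by blast
    then have len: "(2::real) powi (k + int m) \<le> ilength Q"
      using c[of "k + int j"] j by (simp add: power_int_add)
    have "x \<in> Q" using Q c by blast
    then have "c (k + int m) \<subseteq> Q" using nested[of "c (k + int m)" Q x] c len Q by auto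
    moreover have "c (k + int m) \<in> upper" using Pm by (simp add: P_def)
    ultimately show "Q \<in> upper" using upper_upward Q by blast
  qed
  then show ?thesis using c by blast
qed

lemma tops_disjoint:
  assumes "T \<in> tops" "T' \<in> tops" "x \<in> T" "x \<in> T'"
  shows "T = T'"
proof -
  have *: "T = T'" if "T \<in> tops" "T' \<in> tops" "x \<in> T" "x \<in> T'" "ilength T \<le> ilength T'" for T T'
  proof -
    have "T \<subseteq> T'" using nested that tops_grid by blast
    then show ?thesis using that unfolding tops_def by blast
  qed
  show ?thesis using *[of T T'] *[of T' T] assms by (metis linear)
qed

lemma tops_parent:
  assumes "T \<in> tops"
  obtains P where "P \<in> upper" "T \<subseteq> P" "ilength P = 2 * ilength T"
proof -
  obtain i :: int where i: "ilength T = 2 powi i" using length_power assms tops_grid by blast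
  obtain P where P: "P \<in> D" "ilength P = 2 powi (i + 1)" "T \<subseteq> P"
    using ancestor_exists[of T "i + 1"] assms tops_grid i by (auto simp: power_int_add)
  then have "T \<noteq> P" using i by (auto simp: power_int_add)
  then have "P \<in> upper" using assms P by (auto simp: tops_def)
  then show ?thesis using that P i by (simp add: power_int_add)
qed

lemma tops_length_ge: "T \<in> tops \<Longrightarrow> 2 powi k \<le> ilength T"
proof -
  assume T: "T \<in> tops"
  obtain P where P: "P \<in> upper" "T \<subseteq> P" "ilength P = 2 * ilength T" by (rule tops_parent[OF T])
  obtain i :: int where i: "ilength T = 2 powi i" using length_power T tops_grid by blast
  have "(2::real) powi k < 2 powi (i + 1)" using P i by (simp add: upper_def power_int_add)
  then have "k < i + 1" by (metis level_le_iff not_le)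
  then show ?thesis using i level_le_iff by simp
qed

lemma tops_density_le: "T \<in> tops \<Longrightarrow> local_density V T \<le> 8 * \<epsilon>"
proof -
  assume T: "T \<in> tops"
  obtain P where P: "P \<in> upper" "T \<subseteq> P" "ilength P = 2 * ilength T" by (rule tops_parent[OF T])
  have "local_density V T \<le> 8 * local_density V P"
    using density_parent_le[OF V _ _ P(2,3)] T P(1) tops_grid upper_grid by blast
  then show ?thesis using upper_density[OF P(1)] by linarith
qed

lemma tops_dense:
  assumes "T \<in> tops" "2 powi k < ilength T"
  shows "\<exists>Q\<in>D. T \<subseteq> Q \<and> \<epsilon> \<le> local_density V Q"
proof (rule not_sparse_dense_ancestor)
  show "T \<in> D" using assms tops_grid by blast
  show "T \<notin> sparse V \<epsilon>" using assms by (auto simp: tops_def upper_def)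
qed

lemma sum_tops_length_le:
  assumes "finite \<T>" "\<T> \<subseteq> tops" "\<And>T. T \<in> \<T> \<Longrightarrow> 2 powi k < ilength T"
  shows "(\<Sum>T\<in>\<T>. ilength T) \<le> 160 / \<epsilon> * vol V"
proof (rule high_density_covering[OF V \<epsilon> assms(1)])
  show "\<T> \<subseteq> D" using assms tops_grid by blast
  show "disjoint \<T>" using tops_disjoint assms(2) unfolding disjoint_def by blast
  show "\<exists>Q\<in>D. T \<subseteq> Q \<and> \<epsilon> \<le> local_density V Q" if "T \<in> \<T>" for T
    using tops_dense assms that by blast
qed

lemma in_top:
  assumes "J \<in> D" "J \<notin> upper"
  obtains T where "T \<in> tops" "J \<subseteq> T"
proof -
  obtain T where T: "T \<in> tops" "icenter J \<in> T" using tops_cover by blast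
  have "J \<subseteq> T"
  proof (cases "ilength J \<le> ilength T")
    case True
    then show ?thesis using nested[OF assms(1)] T tops_grid center_in[OF assms(1)] by blast
  next
    case False
    then have "T \<subset> J"
      using nested[of T J "icenter J"] T tops_grid center_in[OF assms(1)] assms(1) by auto
    then show ?thesis using assms T by (auto simp: tops_def)
  qed
  then show ?thesis using that T by blast
qed

lemma Int_tops_lmeasurable: "T \<in> tops \<Longrightarrow> V \<inter> T \<in> lmeasurable"
  using V interval_lmeasurable tops_grid by (auto intro: fmeasurable_Int_fmeasurable fmeasurableD)

lemma mass_8_le_bound:
  assumes "A \<in> lmeasurable" "A \<subseteq> V" "0 \<le> e"
    and "\<And>x. x \<in> A \<Longrightarrow> 1 / (rdist J x)\<^sup>2 \<le> e"
  shows "mass 8 A J \<le> e * mass 2 V J"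
proof (rule mass_le_mass)
  fix x assume "x \<in> A"
  have "1 / rdist J x ^ 8 \<le> 1 / rdist J x ^ 4" by (intro rdist_power_antimono) simp
  also have "\<dots> = 1 / (rdist J x)\<^sup>2 * (1 / (rdist J x)\<^sup>2)" by (simp flip: power_add)
  also have "\<dots> \<le> e * (1 / (rdist J x)\<^sup>2)" using assms(4)[OF \<open>x \<in> A\<close>] by (intro mult_right_mono) auto
  finally show "1 / rdist J x ^ 8 \<le> e * (1 / (rdist J x)\<^sup>2)" .
qed (use assms V in auto)

text \<open>An interval of \<open>upper\<close> that is no longer than \<open>T\<close> cannot meet \<open>T\<close>, so an endpoint of \<open>T\<close> separates its centre from
\<open>V \<inter> T\<close>. Both coefficients carry a factor \<open>\<epsilon>\<close> because the interval itself is sparse.\<close>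

lemma fine_pairing_le:
  assumes T: "T \<in> tops"
  shows "\<bar>pairing V (V \<inter> T) (upper - {J \<in> D. ilength T < ilength J})\<bar>
    \<le> (if 2 powi k < ilength T then 64 * C\<^sup>2 * \<epsilon>\<^sup>2 * ilength T else 0)"
proof (rule pairing_le)
  fix F assume F: "finite F" "F \<subseteq> upper - {J \<in> D. ilength T < ilength J}"
  have TD: "T \<in> D" using T tops_grid by blast
  have FJ: "J \<in> D" "J \<in> upper" "0 < ilength J" "ilength J \<le> ilength T" "2 powi k < ilength T" "icenter J \<notin> T" if "J \<in> F" for J
  proof -
    show JD: "J \<in> D" "J \<in> upper" using F that upper_grid by auto
    then show le: "0 < ilength J" "ilength J \<le> ilength T" using F that length_pos by force+
    show "2 powi k < ilength T" using JD le by (simp add: upper_def)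
    show "icenter J \<notin> T"
    proof
      assume "icenter J \<in> T"
      then have "J \<subseteq> T" using nested[OF JD(1) TD le(2)] center_in[OF JD(1)] by blast
      then show False using upper_upward[OF JD(2) TD] T by (simp add: tops_def)
    qed
  qed
  show "(\<Sum>J\<in>F. \<bar>coef V J * coef (V \<inter> T) J\<bar>) \<le> (if 2 powi k < ilength T then 64 * C\<^sup>2 * \<epsilon>\<^sup>2 * ilength T else 0)"
  proof (cases "F = {}")
    case True
    then show ?thesis using length_pos[OF TD] by simp
  next
    case False
    have "(\<Sum>J\<in>F. \<bar>coef V J * coef (V \<inter> T) J\<bar>) \<le> (\<Sum>J\<in>F. C\<^sup>2 * \<epsilon>\<^sup>2 * (ilength J * edge T J))"
    proof (rule sum_mono)
      fix J assume J: "J \<in> F"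
      note FJ = FJ[OF J]
      have d: "local_density V J \<le> \<epsilon>" using upper_density[OF FJ(2)] by simp
      have "\<bar>coef V J\<bar> \<le> C * sqrt (ilength J) * local_density V J" by (rule coef_le_density[OF V FJ(1)])
      also have "\<dots> \<le> C * sqrt (ilength J) * \<epsilon>"
        using d C_nonneg FJ(3) by (intro mult_left_mono) auto
      finally have 1: "\<bar>coef V J\<bar> \<le> C * sqrt (ilength J) * \<epsilon>" .
      have "mass 8 (V \<inter> T) J \<le> edge T J * mass 2 V J"
        using rdist_edge_le[OF TD FJ(1)] FJ(6)
        by (intro mass_8_le_bound Int_tops_lmeasurable[OF T] edge_nonneg) auto
      also have "\<dots> \<le> edge T J * (ilength J * \<epsilon>)"
        using d FJ(3) mass_eq_density[OF FJ(1), of V] by (intro mult_left_mono edge_nonneg) auto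
      finally have m: "mass 8 (V \<inter> T) J \<le> edge T J * (ilength J * \<epsilon>)" .
      have "\<bar>coef (V \<inter> T) J\<bar> \<le> C / sqrt (ilength J) * mass 8 (V \<inter> T) J"
        by (rule coef_le[OF Int_tops_lmeasurable[OF T] FJ(1)])
      also have "\<dots> \<le> C / sqrt (ilength J) * (edge T J * (ilength J * \<epsilon>))"
        using m C_nonneg FJ(3) by (intro mult_left_mono) auto
      finally have 2: "\<bar>coef (V \<inter> T) J\<bar> \<le> C / sqrt (ilength J) * (edge T J * (ilength J * \<epsilon>))" .
      have "\<bar>coef V J * coef (V \<inter> T) J\<bar> \<le> (C * sqrt (ilength J) * \<epsilon>) * (C / sqrt (ilength J) * (edge T J * (ilength J * \<epsilon>)))"
        unfolding abs_mult using 1 2 by (intro mult_mono') auto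
      also have "\<dots> = C\<^sup>2 * \<epsilon>\<^sup>2 * (ilength J * edge T J)"
        using FJ(3) by (simp add: power2_eq_square)
      finally show "\<bar>coef V J * coef (V \<inter> T) J\<bar> \<le> C\<^sup>2 * \<epsilon>\<^sup>2 * (ilength J * edge T J)" .
    qed
    also have "\<dots> = C\<^sup>2 * \<epsilon>\<^sup>2 * (\<Sum>J\<in>F. ilength J * edge T J)" by (simp only: sum_distrib_left)
    also have "\<dots> \<le> C\<^sup>2 * \<epsilon>\<^sup>2 * (64 * ilength T)"
      using FJ F(1) by (intro mult_left_mono sum_edge_le[OF TD]) auto
    finally show ?thesis using False FJ(5) by auto
  qed
qed

text \<open>Here \<open>J\<close> lies below a larger top \<open>S\<close> and may be dense, but the ancestor of \<open>T\<close> of the length of \<open>J\<close> is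
sparse. Comparing densities gives \<open>u J \<le> 4 \<theta>\<^sup>2 \<epsilon>\<close> with \<open>\<theta>\<close> the relative distance from \<open>J\<close> to \<open>T\<close>: a dense \<open>J\<close> is
far from \<open>T\<close>. Using this twice yields the factor \<open>\<epsilon>\<^sup>2\<close>, which outweighs a large
coefficient at \<open>J\<close>.\<close>

lemma cross_mass_le:
  assumes T: "T \<in> tops" and J: "J \<in> D" "ilength T < ilength J" "J \<subseteq> S" and S: "S \<in> tops"
    and d: "local_density V J \<noteq> 0"
  shows "mass 8 (V \<inter> T) J \<le> 16 * \<epsilon>\<^sup>2 / (local_density V J)\<^sup>2 * edge S J * mass 2 (V \<inter> T) J"
proof (rule mass_le_mass)
  have SD: "S \<in> D" and TD: "T \<in> D" using S T tops_grid by auto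
  have dpos: "0 < local_density V J" using d local_density_nonneg[of V J] by simp
  show "0 \<le> 16 * \<epsilon>\<^sup>2 / (local_density V J)\<^sup>2 * edge S J" by (simp add: edge_nonneg)
  fix x assume x: "x \<in> V \<inter> T"
  have "T \<noteq> S" using J(2) subset_length_le[OF J(1) SD J(3)] by auto
  then have "x \<notin> S" using tops_disjoint T S x by blast
  then have e: "1 / (rdist J x)\<^sup>2 \<le> edge S J"
    using rdist_edge_le[OF SD J(1)] center_in[OF J(1)] J(3) by blast
  obtain i :: int where i: "ilength J = 2 powi i" using length_power J by blast
  obtain Q where Q: "Q \<in> D" "ilength Q = 2 powi i" "T \<subseteq> Q"
    using ancestor_exists[OF TD, of i] J(2) i by auto
  have "T \<noteq> Q" using Q i J(2) by auto
  then have "Q \<in> upper" using Q T by (auto simp: tops_def)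
  then have "local_density V Q \<le> \<epsilon>" using upper_density less_imp_le by blast
  moreover have "local_density V J \<le> 4 * (rdist J x)\<^sup>2 * local_density V Q"
    using density_same_length_le[OF V J(1) Q(1)] i Q x by auto
  ultimately have "local_density V J \<le> 4 * (rdist J x)\<^sup>2 * \<epsilon>"
    by (meson mult_left_mono order_trans mult_nonneg_nonneg zero_le_numeral zero_le_power2)
  then have f: "1 / (rdist J x)\<^sup>2 \<le> 4 * \<epsilon> / local_density V J"
    using dpos by (simp add: field_simps)
  have "1 / rdist J x ^ 8 = (1 / (rdist J x)\<^sup>2) * (1 / (rdist J x)\<^sup>2) * (1 / (rdist J x)\<^sup>2) * (1 / (rdist J x)\<^sup>2)"
    by (simp flip: power_add)
  also have "\<dots> \<le> (4 * \<epsilon> / local_density V J) * (4 * \<epsilon> / local_density V J) * edge S J * (1 / (rdist J x)\<^sup>2)"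
    using e f \<epsilon> dpos edge_nonneg by (intro mult_mono mult_nonneg_nonneg) auto
  also have "\<dots> = 16 * \<epsilon>\<^sup>2 / (local_density V J)\<^sup>2 * edge S J * (1 / (rdist J x)\<^sup>2)"
    by (simp add: power2_eq_square)
  finally show "1 / rdist J x ^ 8 \<le> 16 * \<epsilon>\<^sup>2 / (local_density V J)\<^sup>2 * edge S J * (1 / (rdist J x)\<^sup>2)" .
qed (use Int_tops_lmeasurable T in auto)

lemma indicator_Union_tops:
  assumes "finite \<T>" "\<T> \<subseteq> tops"
  shows "indicator (V \<inter> \<Union>\<T>) x = (\<Sum>T\<in>\<T>. indicat_real (V \<inter> T) x)"
proof (cases "\<exists>T\<in>\<T>. x \<in> V \<inter> T")
  case True
  then obtain T where T: "T \<in> \<T>" "x \<in> V \<inter> T" by blast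
  have "(\<Sum>T'\<in>\<T>. indicat_real (V \<inter> T') x) = (\<Sum>T'\<in>\<T>. if T' = T then 1 else 0)"
    using T tops_disjoint[of T _ x] assms by (intro sum.cong) (auto simp: indicator_def)
  then show ?thesis using assms(1) T by (auto simp: indicator_def)
next
  case False
  then have "(\<Sum>T\<in>\<T>. indicat_real (V \<inter> T) x) = 0"
    by (intro sum.neutral) (auto simp: indicator_def)
  then show ?thesis using False by (auto simp: indicator_def)
qed

lemma sum_mass_tops_le:
  assumes "finite \<T>" "\<T> \<subseteq> tops"
  shows "(\<Sum>T\<in>\<T>. mass p (V \<inter> T) J) \<le> mass p V J"
proof -
  have U: "V \<inter> \<Union>\<T> \<in> lmeasurable"
    using assms V tops_grid interval_lmeasurable
    by (intro fmeasurable_Int_fmeasurable V sets.finite_Union) (auto intro: fmeasurableD)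
  have "(\<Sum>T\<in>\<T>. mass p (V \<inter> T) J) = (\<integral>x. (\<Sum>T\<in>\<T>. indicator (V \<inter> T) x *\<^sub>R (1 / rdist J x ^ p)) \<partial>lebesgue)"
    using mass_integrable[OF Int_tops_lmeasurable] assms(2)
    unfolding mass_def set_lebesgue_integral_def set_integrable_def
    by (intro Bochner_Integration.integral_sum[symmetric]) auto
  also have "\<dots> = mass p (V \<inter> \<Union>\<T>) J"
    unfolding mass_def set_lebesgue_integral_def indicator_Union_tops[OF assms]
    by (simp only: scaleR_sum_left)
  also have "\<dots> \<le> mass p V J"
    using mass_le_mass[of "V \<inter> \<Union>\<T>" V 1 J p J p] U V by simp
  finally show ?thesis .
qed

text \<open>Summation over the tops first: the factor \<open>u J\<^sup>-\<^sup>2\<close> is cancelled by the coefficient and by the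
total mass at \<open>J\<close>.\<close>

lemma cross_sum_le:
  assumes \<T>: "finite \<T>" "\<T> \<subseteq> tops" and J: "J \<in> D" "J \<subseteq> S" and S: "S \<in> tops"
  shows "(\<Sum>T\<in>{T \<in> \<T>. ilength T < ilength J}. \<bar>coef V J * coef (V \<inter> T) J\<bar>)
    \<le> 16 * C\<^sup>2 * \<epsilon>\<^sup>2 * (ilength J * edge S J)"
proof (cases "local_density V J = 0")
  case True
  then have "coef V J = 0" using coef_le_density[OF V J(1)] by simp
  then show ?thesis using length_pos[OF J(1)] edge_nonneg[of S J] by simp
next
  case False
  define d where "d = local_density V J"
  have d: "0 < d" using False local_density_nonneg[of V J] by (simp add: d_def)
  have pos: "0 < ilength J" using J length_pos by blast
  let ?T = "{T \<in> \<T>. ilength T < ilength J}"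
  let ?c = "C\<^sup>2 * d * (16 * \<epsilon>\<^sup>2 / d\<^sup>2 * edge S J)"
  have "(\<Sum>T\<in>?T. \<bar>coef V J * coef (V \<inter> T) J\<bar>) \<le> (\<Sum>T\<in>?T. ?c * mass 2 (V \<inter> T) J)"
  proof (rule sum_mono)
    fix T assume T: "T \<in> ?T"
    then have Tt: "T \<in> tops" using \<T> by blast
    have "\<bar>coef (V \<inter> T) J\<bar> \<le> C / sqrt (ilength J) * mass 8 (V \<inter> T) J"
      by (rule coef_le[OF Int_tops_lmeasurable[OF Tt] J(1)])
    also have "\<dots> \<le> C / sqrt (ilength J) * (16 * \<epsilon>\<^sup>2 / d\<^sup>2 * edge S J * mass 2 (V \<inter> T) J)"
      using cross_mass_le[OF Tt J(1) _ J(2) S False] T C_nonneg pos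
      by (intro mult_left_mono) (auto simp: d_def)
    finally have 1: "\<bar>coef (V \<inter> T) J\<bar> \<le> C / sqrt (ilength J) * (16 * \<epsilon>\<^sup>2 / d\<^sup>2 * edge S J * mass 2 (V \<inter> T) J)" .
    have 2: "\<bar>coef V J\<bar> \<le> C * sqrt (ilength J) * d"
      using coef_le_density[OF V J(1)] by (simp add: d_def)
    have "\<bar>coef V J * coef (V \<inter> T) J\<bar>
      \<le> (C * sqrt (ilength J) * d) * (C / sqrt (ilength J) * (16 * \<epsilon>\<^sup>2 / d\<^sup>2 * edge S J * mass 2 (V \<inter> T) J))"
      unfolding abs_mult using 1 2 by (intro mult_mono') auto
    also have "\<dots> = ?c * mass 2 (V \<inter> T) J" using pos by (simp add: power2_eq_square)
    finally show "\<bar>coef V J * coef (V \<inter> T) J\<bar> \<le> ?c * mass 2 (V \<inter> T) J" .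
  qed
  also have "\<dots> = ?c * (\<Sum>T\<in>?T. mass 2 (V \<inter> T) J)" by (simp only: sum_distrib_left)
  also have "\<dots> \<le> ?c * mass 2 V J"
    using \<T> d edge_nonneg by (intro mult_left_mono sum_mass_tops_le) auto
  also have "\<dots> = 16 * C\<^sup>2 * \<epsilon>\<^sup>2 * (ilength J * edge S J)"
    using d mass_eq_density[OF J(1), of V] by (simp add: d_def[symmetric] power2_eq_square)
  finally show ?thesis .
qed

end

lemma has_sum_finite_sum:
  fixes f :: "'i \<Rightarrow> 'a \<Rightarrow> real"
  assumes "finite I" "\<And>i. i \<in> I \<Longrightarrow> (f i has_sum s i) X"
  shows "((\<lambda>x. \<Sum>i\<in>I. f i x) has_sum (\<Sum>i\<in>I. s i)) X"
  using assms by (induction I rule: finite_induct) (auto intro!: has_sum_add)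

text \<open>An interchange of summation that only needs bounds on finite sets.\<close>

lemma sum_infsum_le:
  fixes h :: "'i \<Rightarrow> 'a \<Rightarrow> real"
  assumes "finite I" "\<And>i. i \<in> I \<Longrightarrow> h i summable_on Y i"
    and "\<And>F. finite F \<Longrightarrow> (\<Sum>x\<in>F. \<Sum>i\<in>{i\<in>I. x \<in> Y i}. h i x) \<le> b"
  shows "(\<Sum>i\<in>I. infsum (h i) (Y i)) \<le> b"
proof -
  define g where "g i x = (if x \<in> Y i then h i x else 0)" for i x
  have "(g i has_sum infsum (h i) (Y i)) UNIV" if "i \<in> I" for i
    using has_sum_infsum[OF assms(2)[OF that]]
    by (rule has_sum_cong_neutral[THEN iffD1, rotated -1]) (auto simp: g_def)
  then have s: "((\<lambda>x. \<Sum>i\<in>I. g i x) has_sum (\<Sum>i\<in>I. infsum (h i) (Y i))) UNIV"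
    by (rule has_sum_finite_sum[OF assms(1)])
  show ?thesis
  proof (rule has_sum_le_finite_sums[OF s])
    fix F :: "'a set" assume "finite F"
    have "(\<Sum>i\<in>I. g i x) = (\<Sum>i\<in>{i\<in>I. x \<in> Y i}. h i x)" for x
      unfolding g_def using assms(1) by (simp add: sum.inter_filter)
    then show "(\<Sum>x\<in>F. \<Sum>i\<in>I. g i x) \<le> b" using assms(3)[OF \<open>finite F\<close>] by simp
  qed
qed

context stopping
begin

text \<open>The intervals are grouped by the top that contains them; such a top is longer than some other top, hence longer
than the truncation length and dense.\<close>

lemma cross_pairing_le:
  assumes \<T>: "finite \<T>" "\<T> \<subseteq> tops"
  shows "(\<Sum>T\<in>\<T>. \<bar>pairing V (V \<inter> T) ({J \<in> D. ilength T < ilength J} - upper)\<bar>)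
    \<le> 163840 * C\<^sup>2 * \<epsilon> * vol V"
proof -
  define Y where "Y T = {J \<in> D. ilength T < ilength J} - upper" for T
  define h where "h T J = \<bar>coef V J * coef (V \<inter> T) J\<bar>" for T J
  have summ: "h T summable_on Y T" if "T \<in> \<T>" for T
    using pairing_summable(2)[OF V Int_tops_lmeasurable, of T "Y T"] that \<T>(2)
    unfolding h_def by (auto simp: Y_def)
  have "\<bar>pairing V (V \<inter> T) (Y T)\<bar> \<le> infsum (h T) (Y T)" if "T \<in> \<T>" for T
    using norm_infsum_bound[of "\<lambda>J. coef V J * coef (V \<inter> T) J" "Y T"] summ[OF that]
    by (simp add: h_def[abs_def] pairing_def)
  then have "(\<Sum>T\<in>\<T>. \<bar>pairing V (V \<inter> T) (Y T)\<bar>) \<le> (\<Sum>T\<in>\<T>. infsum (h T) (Y T))"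
    by (rule sum_mono)
  also have "\<dots> \<le> 163840 * C\<^sup>2 * \<epsilon> * vol V"
  proof (rule sum_infsum_le[OF \<T>(1) summ])
    fix F :: "real set set" assume F: "finite F"
    have "\<exists>S. J \<in> D - upper \<longrightarrow> S \<in> tops \<and> J \<subseteq> S" for J
      using in_top[of J] by blast
    then obtain top where top: "\<And>J. J \<in> D - upper \<Longrightarrow> top J \<in> tops \<and> J \<subseteq> top J" by metis
    define F' where "F' = {J \<in> F. J \<in> D - upper \<and> (\<exists>T\<in>\<T>. ilength T < ilength J)}"
    have fin: "finite F'" using F by (simp add: F'_def)
    have F': "J \<in> D" "top J \<in> tops" "top J \<in> D" "J \<subseteq> top J" "ilength J \<le> ilength (top J)" "2 powi k < ilength (top J)" if JF: "J \<in> F'" for J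
    proof -
      show 1: "J \<in> D" "top J \<in> tops" "J \<subseteq> top J" using JF top unfolding F'_def by blast+
      then show 2: "top J \<in> D" using tops_grid by blast
      show 3: "ilength J \<le> ilength (top J)" by (rule subset_length_le[OF 1(1) 2 1(3)])
      obtain T where "T \<in> \<T>" "ilength T < ilength J" using JF unfolding F'_def by blast
      then show "2 powi k < ilength (top J)" using tops_length_ge[of T] \<T>(2) 3 by force
    qed
    have "(\<Sum>J\<in>F. \<Sum>T\<in>{T \<in> \<T>. J \<in> Y T}. h T J) = (\<Sum>J\<in>F'. \<Sum>T\<in>{T \<in> \<T>. J \<in> Y T}. h T J)"
      using F by (intro sum.mono_neutral_right) (auto simp: F'_def Y_def intro!: sum.neutral)
    also have "\<dots> \<le> (\<Sum>J\<in>F'. 16 * C\<^sup>2 * \<epsilon>\<^sup>2 * (ilength J * edge (top J) J))"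
    proof (rule sum_mono)
      fix J assume J: "J \<in> F'"
      have "(\<Sum>T\<in>{T \<in> \<T>. J \<in> Y T}. h T J) \<le> (\<Sum>T\<in>{T \<in> \<T>. ilength T < ilength J}. h T J)"
        using \<T>(1) by (intro sum_mono2) (auto simp: Y_def h_def)
      also have "\<dots> \<le> 16 * C\<^sup>2 * \<epsilon>\<^sup>2 * (ilength J * edge (top J) J)"
        unfolding h_def by (rule cross_sum_le[OF \<T> F'(1,4,2)[OF J]])
      finally show "(\<Sum>T\<in>{T \<in> \<T>. J \<in> Y T}. h T J) \<le> 16 * C\<^sup>2 * \<epsilon>\<^sup>2 * (ilength J * edge (top J) J)" .
    qed
    also have "\<dots> = 16 * C\<^sup>2 * \<epsilon>\<^sup>2 * (\<Sum>J\<in>F'. ilength J * edge (top J) J)" by (simp only: sum_distrib_left)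
    also have "(\<Sum>J\<in>F'. ilength J * edge (top J) J) = (\<Sum>S\<in>top ` F'. \<Sum>J\<in>{J \<in> F'. top J = S}. ilength J * edge (top J) J)"
      by (rule sum.image_gen[OF fin])
    also have "\<dots> \<le> (\<Sum>S\<in>top ` F'. 64 * ilength S)"
    proof (rule sum_mono)
      fix S assume S: "S \<in> top ` F'"
      have "(\<Sum>J\<in>{J \<in> F'. top J = S}. ilength J * edge (top J) J) = (\<Sum>J\<in>{J \<in> F'. top J = S}. ilength J * edge S J)"
        by (rule sum.cong) auto
      also have "\<dots> \<le> 64 * ilength S"
      proof (rule sum_edge_le)
        show "S \<in> D" "{J \<in> F'. top J = S} \<subseteq> D" using S F'(1,3) by auto
        show "ilength J \<le> ilength S" if "J \<in> {J \<in> F'. top J = S}" for J using F'(5)[of J] that by auto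
      qed (use fin in simp)
      finally show "(\<Sum>J\<in>{J \<in> F'. top J = S}. ilength J * edge (top J) J) \<le> 64 * ilength S" .
    qed
    also have "\<dots> = 64 * (\<Sum>S\<in>top ` F'. ilength S)" by (simp only: sum_distrib_left)
    also have "\<dots> \<le> 64 * (160 / \<epsilon> * vol V)"
      using fin F' by (intro mult_left_mono sum_tops_length_le) auto
    also have "16 * C\<^sup>2 * \<epsilon>\<^sup>2 * \<dots> = 163840 * C\<^sup>2 * \<epsilon> * vol V"
      using \<epsilon> by (simp add: power2_eq_square)
    finally show "(\<Sum>J\<in>F. \<Sum>T\<in>{T \<in> \<T>. J \<in> Y T}. h T J) \<le> 163840 * C\<^sup>2 * \<epsilon> * vol V"
      by (simp add: mult_left_mono)
  qed
  finally show ?thesis by (simp only: Y_def)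
qed

lemma upper_pairing_top:
  assumes T: "T \<in> tops"
  defines "X \<equiv> {J \<in> D. ilength T < ilength J}"
  shows "pairing V (V \<inter> T) upper = pairing V (V \<inter> T) X - pairing V (V \<inter> T) (X - upper) + pairing V (V \<inter> T) (upper - X)"
proof -
  note VT = Int_tops_lmeasurable[OF T]
  have X: "X \<subseteq> D" by (auto simp: X_def)
  have "pairing V (V \<inter> T) ((X \<inter> upper) \<union> (X - upper)) = pairing V (V \<inter> T) (X \<inter> upper) + pairing V (V \<inter> T) (X - upper)"
    using X upper_grid by (intro pairing_Un V VT) auto
  moreover have "pairing V (V \<inter> T) ((X \<inter> upper) \<union> (upper - X)) = pairing V (V \<inter> T) (X \<inter> upper) + pairing V (V \<inter> T) (upper - X)"
    using X upper_grid by (intro pairing_Un V VT) auto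
  moreover have "(X \<inter> upper) \<union> (X - upper) = X" "(X \<inter> upper) \<union> (upper - X) = upper" by auto
  ultimately show ?thesis by simp
qed

lemma pairing_Union_tops:
  assumes \<T>: "finite \<T>" "\<T> \<subseteq> tops"
  shows "pairing V (V \<inter> \<Union>\<T>) upper = (\<Sum>T\<in>\<T>. pairing V (V \<inter> T) upper)"
proof -
  have "coef (V \<inter> \<Union>\<T>) J = (\<Sum>T\<in>\<T>. coef (V \<inter> T) J)" if "J \<in> D" for J
    unfolding coef_def indicator_Union_tops[OF \<T>, abs_def]
    using \<T> wavelet_L2[OF that] by (intro L2_inner_sum_left L2_indicator Int_tops_lmeasurable) auto
  then have "pairing V (V \<inter> \<Union>\<T>) upper = (\<Sum>\<^sub>\<infinity>J\<in>upper. \<Sum>T\<in>\<T>. coef V J * coef (V \<inter> T) J)"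
    unfolding pairing_def using upper_grid by (intro infsum_cong) (auto simp: sum_distrib_left subset_iff)
  also have "\<dots> = (\<Sum>T\<in>\<T>. pairing V (V \<inter> T) upper)"
    unfolding pairing_def using \<T> upper_grid
    by (intro infsumI has_sum_finite_sum has_sum_infsum pairing_summable V Int_tops_lmeasurable) auto
  finally show ?thesis .
qed

lemma sum_measure_tops_le:
  assumes "finite \<T>" "\<T> \<subseteq> tops"
  shows "(\<Sum>T\<in>\<T>. vol (V \<inter> T)) \<le> vol V"
  using sum_mass_tops_le[OF assms, of 0 "{}"] mass_0[OF V] mass_0[OF Int_tops_lmeasurable] assms(2)
  by (simp add: subset_iff)

lemma upper_pairing_Union_le:
  assumes \<T>: "finite \<T>" "\<T> \<subseteq> tops"
  shows "\<bar>pairing V (V \<inter> \<Union>\<T>) upper\<bar> \<le> 179200 * C\<^sup>2 * \<epsilon> * vol V"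
proof -
  let ?X = "\<lambda>T. {J \<in> D. ilength T < ilength J}"
  have "\<bar>pairing V (V \<inter> \<Union>\<T>) upper\<bar> \<le> (\<Sum>T\<in>\<T>. \<bar>pairing V (V \<inter> T) upper\<bar>)"
    unfolding pairing_Union_tops[OF \<T>] by (rule sum_abs)
  also have "\<dots> \<le> (\<Sum>T\<in>\<T>. \<bar>pairing V (V \<inter> T) (?X T)\<bar> + \<bar>pairing V (V \<inter> T) (?X T - upper)\<bar> + \<bar>pairing V (V \<inter> T) (upper - ?X T)\<bar>)"
  proof (rule sum_mono)
    fix T assume "T \<in> \<T>"
    then have "T \<in> tops" using \<T> by blast
    have "\<bar>a - b + c\<bar> \<le> \<bar>a\<bar> + \<bar>b\<bar> + \<bar>c\<bar>" for a b c :: real by simp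
    then show "\<bar>pairing V (V \<inter> T) upper\<bar> \<le> \<bar>pairing V (V \<inter> T) (?X T)\<bar> + \<bar>pairing V (V \<inter> T) (?X T - upper)\<bar> + \<bar>pairing V (V \<inter> T) (upper - ?X T)\<bar>"
      unfolding upper_pairing_top[OF \<open>T \<in> tops\<close>] .
  qed
  also have "\<dots> = (\<Sum>T\<in>\<T>. \<bar>pairing V (V \<inter> T) (?X T)\<bar>) + (\<Sum>T\<in>\<T>. \<bar>pairing V (V \<inter> T) (?X T - upper)\<bar>)
      + (\<Sum>T\<in>\<T>. \<bar>pairing V (V \<inter> T) (upper - ?X T)\<bar>)"
    by (simp only: sum.distrib)
  finally have total: "\<bar>pairing V (V \<inter> \<Union>\<T>) upper\<bar> \<le> \<dots>" .
  have coarse: "(\<Sum>T\<in>\<T>. \<bar>pairing V (V \<inter> T) (?X T)\<bar>) \<le> 5120 * C\<^sup>2 * \<epsilon> * vol V"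
  proof -
    have "(\<Sum>T\<in>\<T>. \<bar>pairing V (V \<inter> T) (?X T)\<bar>) \<le> (\<Sum>T\<in>\<T>. 5120 * C\<^sup>2 * \<epsilon> * vol (V \<inter> T))"
    proof (rule sum_mono)
      fix T assume "T \<in> \<T>"
      then have T: "T \<in> tops" "T \<in> D" using \<T> tops_grid by auto
      have "\<bar>pairing V (V \<inter> T) (?X T)\<bar> \<le> 640 * C\<^sup>2 * local_density V T * vol (V \<inter> T)"
        by (rule coarse_pairing_le[OF V T(2)])
      also have "\<dots> \<le> 640 * C\<^sup>2 * (8 * \<epsilon>) * vol (V \<inter> T)"
        using tops_density_le[OF T(1)] by (intro mult_right_mono mult_left_mono) auto
      finally show "\<bar>pairing V (V \<inter> T) (?X T)\<bar> \<le> 5120 * C\<^sup>2 * \<epsilon> * vol (V \<inter> T)" by simp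
    qed
    also have "\<dots> = 5120 * C\<^sup>2 * \<epsilon> * (\<Sum>T\<in>\<T>. vol (V \<inter> T))" by (simp only: sum_distrib_left)
    also have "\<dots> \<le> 5120 * C\<^sup>2 * \<epsilon> * vol V"
      using \<epsilon> by (intro mult_left_mono sum_measure_tops_le \<T>) auto
    finally show ?thesis .
  qed
  have fine: "(\<Sum>T\<in>\<T>. \<bar>pairing V (V \<inter> T) (upper - ?X T)\<bar>) \<le> 10240 * C\<^sup>2 * \<epsilon> * vol V"
  proof -
    have "(\<Sum>T\<in>\<T>. \<bar>pairing V (V \<inter> T) (upper - ?X T)\<bar>) \<le> (\<Sum>T\<in>\<T>. if 2 powi k < ilength T then 64 * C\<^sup>2 * \<epsilon>\<^sup>2 * ilength T else 0)"
      using \<T> by (intro sum_mono fine_pairing_le) auto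
    also have "\<dots> = (\<Sum>T\<in>{T \<in> \<T>. 2 powi k < ilength T}. 64 * C\<^sup>2 * \<epsilon>\<^sup>2 * ilength T)"
      using \<T>(1) by (simp only: sum.inter_filter)
    also have "\<dots> = 64 * C\<^sup>2 * \<epsilon>\<^sup>2 * (\<Sum>T\<in>{T \<in> \<T>. 2 powi k < ilength T}. ilength T)" by (simp only: sum_distrib_left)
    also have "\<dots> \<le> 64 * C\<^sup>2 * \<epsilon>\<^sup>2 * (160 / \<epsilon> * vol V)"
      using \<T> by (intro mult_left_mono sum_tops_length_le) auto
    finally show ?thesis using \<epsilon> by (simp add: power2_eq_square)
  qed
  show ?thesis using total coarse fine cross_pairing_le[OF \<T>] by linarith
qed

text \<open>The grid is countable and the tops cover the line, so finitely many tops capture \<open>V\<close> up to small measure.\<close>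

lemma tops_exhaust:
  assumes "0 < \<delta>"
  obtains \<T> where "finite \<T>" "\<T> \<subseteq> tops" "vol (V - \<Union>\<T>) < \<delta>"
proof -
  have ne: "tops \<noteq> {}" and ct: "countable tops"
    using tops_cover countable_grid tops_grid countable_subset by blast+
  define t where "t = from_nat_into tops"
  have rt: "range t = tops" using ne ct by (simp add: t_def)
  define A where "A n = V - \<Union>(t ` {..<n})" for n
  have tm: "t i \<in> sets lebesgue" for i
    using rt tops_grid interval_lmeasurable by (metis fmeasurableD rangeI subsetD)
  have A: "A n \<in> lmeasurable" for n
    unfolding A_def using tm V by (intro fmeasurable_Diff sets.finite_Union) auto
  have "(\<lambda>n. vol (A n)) \<longlonglongrightarrow> vol (\<Inter>n. A n)"
  proof (rule Lim_measure_decseq)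
    show "range A \<subseteq> sets lebesgue" using A by (auto intro: fmeasurableD)
    show "decseq A" by (auto simp: A_def decseq_def)
    show "emeasure lebesgue (A n) \<noteq> \<infinity>" for n using A[of n] by (auto simp only: fmeasurable_def infinity_ennreal_def)
  qed
  moreover have "(\<Inter>n. A n) = {}"
  proof (rule ccontr)
    assume "(\<Inter>n. A n) \<noteq> {}"
    then obtain x where x: "\<And>n. x \<in> A n" by blast
    obtain i where "x \<in> t i" using tops_cover[of x] rt by (metis imageE)
    then show False using x[of "Suc i"] by (auto simp: A_def)
  qed
  ultimately have "(\<lambda>n. vol (A n)) \<longlonglongrightarrow> 0" by simp
  then obtain n where "vol (A n) < \<delta>"
    using assms by (metis (no_types, lifting) order_tendstoD(2) eventually_sequentially order_refl)
  then show ?thesis using that[of "t ` {..<n}"] rt by (auto simp: A_def)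
qed

text \<open>Finitely many tops leave a remainder of \<open>V\<close> of measure at most \<open>\<epsilon>\<^sup>2 |V|\<close>, and the weighted form of the Cauchy-Schwarz
inequality with parameter \<open>\<epsilon>\<close> bounds its contribution by \<open>\<epsilon> |V|\<close>.\<close>

lemma upper_pairing_le: "pairing V V upper \<le> (179200 * C\<^sup>2 + 1) * \<epsilon> * vol V"
proof -
  have "\<exists>\<T>. finite \<T> \<and> \<T> \<subseteq> tops \<and> vol (V - \<Union>\<T>) \<le> \<epsilon>\<^sup>2 * vol V"
  proof (cases "vol V = 0")
    case True
    then show ?thesis by (intro exI[of _ "{}"]) simp
  next
    case False
    then have "0 < \<epsilon>\<^sup>2 * vol V" using \<epsilon> by (simp add: zero_less_measure_iff)
    then show ?thesis using tops_exhaust less_imp_le by metis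
  qed
  then obtain \<T> where \<T>: "finite \<T>" "\<T> \<subseteq> tops" "vol (V - \<Union>\<T>) \<le> \<epsilon>\<^sup>2 * vol V"
    by blast
  have U: "\<Union>\<T> \<in> sets lebesgue"
    using \<T> tops_grid interval_lmeasurable by (intro sets.finite_Union) (auto intro: fmeasurableD)
  have R: "V - \<Union>\<T> \<in> lmeasurable" using V U by (rule fmeasurable_Diff)
  have "\<bar>pairing (V - \<Union>\<T>) V upper\<bar> \<le> \<epsilon> * vol V"
  proof (rule pairing_le)
    fix F assume F: "finite F" "F \<subseteq> upper"
    have "(\<Sum>J\<in>F. \<bar>coef V J * coef (V - \<Union>\<T>) J\<bar>) \<le> (\<epsilon> * vol V + vol (V - \<Union>\<T>) / \<epsilon>) / 2"
      using coefficient_products_finite_sum_le[OF basis L2_indicator[OF V] L2_indicator[OF R] F(1) _ \<epsilon>]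
        F upper_grid by (auto simp: coef_def L2_inner_indicator V R)
    also have "\<dots> \<le> (\<epsilon> * vol V + \<epsilon>\<^sup>2 * vol V / \<epsilon>) / 2"
      using \<T>(3) \<epsilon> by (intro divide_right_mono add_left_mono) auto
    also have "\<dots> = \<epsilon> * vol V" using \<epsilon> by (simp add: power2_eq_square)
    finally show "(\<Sum>J\<in>F. \<bar>coef (V - \<Union>\<T>) J * coef V J\<bar>) \<le> \<epsilon> * vol V"
      by (simp add: mult.commute)
  qed
  moreover have "pairing V V upper = pairing (V \<inter> \<Union>\<T>) V upper + pairing (V - \<Union>\<T>) V upper"
    by (rule pairing_split_left[OF V U V upper_grid])
  moreover have "pairing (V \<inter> \<Union>\<T>) V upper = pairing V (V \<inter> \<Union>\<T>) upper"
    by (simp add: pairing_def mult.commute)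
  ultimately show ?thesis using upper_pairing_Union_le[OF \<T>(1,2)] by (simp add: algebra_simps)
qed

end

context wavelet_basis
begin

text \<open>A finite family lies above some truncation length, and the bound does not depend on that length.\<close>

lemma sparse_sum_le:
  assumes "V \<in> lmeasurable" "0 < \<epsilon>" "finite F" "F \<subseteq> sparse V \<epsilon>"
  shows "(\<Sum>J\<in>F. (coef V J)\<^sup>2) \<le> (179200 * C\<^sup>2 + 1) * \<epsilon> * vol V"
proof -
  have FD: "F \<subseteq> D" using assms(4) by (auto simp: sparse_def)
  have "\<exists>k::int. \<forall>J\<in>F. 2 powi k < ilength J"
    using assms(3) FD
  proof (induction F rule: finite_induct)
    case (insert J F)
    then obtain k :: int where k: "\<forall>K\<in>F. 2 powi k < ilength K" by blast
    obtain j :: int where j: "ilength J = 2 powi j" using length_power insert by blast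
    have "2 powi (min k (j - 1)) < ilength J"
    proof -
      have "min k (j - 1) < j" by linarith
      from power_int_strict_increasing[OF this, of "2::real"] show ?thesis by (simp add: j)
    qed
    moreover have "2 powi (min k (j - 1)) < ilength K" if "K \<in> F" for K
    proof -
      have "(2::real) powi (min k (j - 1)) \<le> 2 powi k" by (rule power_int_increasing) simp_all
      also have "\<dots> < ilength K" using k that by blast
      finally show ?thesis .
    qed
    ultimately show ?case by blast
  qed auto
  then obtain k :: int where k: "\<forall>J\<in>F. 2 powi k < ilength J" by blast
  interpret stopping D w C V \<epsilon> k by unfold_locales (rule assms)+
  have "(\<Sum>J\<in>F. (coef V J)\<^sup>2) = (\<Sum>J\<in>F. coef V J * coef V J)" by (simp add: power2_eq_square)
  also have "\<dots> \<le> pairing V V upper"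
    unfolding pairing_def using k assms(3,4) upper_grid
    by (intro finite_sum_le_infsum pairing_summable assms(1)) (auto simp: upper_def)
  also have "\<dots> \<le> (179200 * C\<^sup>2 + 1) * \<epsilon> * vol V" by (rule upper_pairing_le)
  finally show ?thesis .
qed

section \<open>Low local_density below a dense interval\<close>

text \<open>Bessel's inequality for the part of \<open>V\<close> near \<open>K\<close>; the part far from \<open>K\<close> is seen by \<open>J \<subseteq> K\<close> only through the tail,
which gains a power of \<open>|J| / |K|\<close> and makes the sum over all scales geometric.\<close>

lemma subtree_sum_le:
  assumes V: "V \<in> lmeasurable" and K: "K \<in> D" "local_density V K \<le> 1"
    and F: "finite F" "F \<subseteq> D" "\<And>J. J \<in> F \<Longrightarrow> J \<subseteq> K"
  shows "(\<Sum>J\<in>F. (coef V J)\<^sup>2) \<le> (8 + 1024 * C\<^sup>2) * local_density V K * ilength K"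
proof -
  define d where "d = local_density V K"
  have d: "0 \<le> d" "d \<le> 1" using local_density_nonneg K(2) by (simp_all add: d_def)
  have pos: "0 < ilength K" using K length_pos by blast
  have FJ: "J \<in> D" "0 < ilength J" "ilength J \<le> ilength K" "icenter J \<in> K" if "J \<in> F" for J
  proof -
    show J: "J \<in> D" using that F by blast
    then show "0 < ilength J" by (rule length_pos)
    show "ilength J \<le> ilength K" by (rule subset_length_le[OF J K(1) F(3)[OF that]])
    show "icenter J \<in> K" using center_in[OF J] F(3)[OF that] by blast
  qed
  have N: "V \<inter> double K \<in> lmeasurable" and R: "V - double K \<in> lmeasurable"
    using V by (auto intro: fmeasurable_Int_fmeasurable fmeasurable_Diff)
  have far: "(coef (V - double K) J)\<^sup>2 \<le> 256 * C\<^sup>2 * d\<^sup>2 / ilength K * (ilength J)\<^sup>2" if "J \<in> F" for J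
  proof -
    note J = FJ[OF that]
    have "mass 8 (V - double K) J \<le> 16 * (ilength J / ilength K)\<^sup>2 * (rdist J (icenter J))\<^sup>2 * mass 2 V K"
      by (rule mass_off_diagonal[OF V K(1) J(1,4)])
    also have "\<dots> = 16 * (ilength J)\<^sup>2 / ilength K * d"
      using pos mass_eq_density[OF K(1), of V] by (simp add: rdist_def d_def power2_eq_square)
    finally have m: "mass 8 (V - double K) J \<le> 16 * (ilength J)\<^sup>2 / ilength K * d" .
    have "\<bar>coef (V - double K) J\<bar> \<le> C / sqrt (ilength J) * mass 8 (V - double K) J"
      by (rule coef_le[OF R J(1)])
    also have "\<dots> \<le> C / sqrt (ilength J) * (16 * (ilength J)\<^sup>2 / ilength K * d)"
      using m C_nonneg J(2) by (intro mult_left_mono) auto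
    finally have "\<bar>coef (V - double K) J\<bar>\<^sup>2 \<le> (C / sqrt (ilength J) * (16 * (ilength J)\<^sup>2 / ilength K * d))\<^sup>2"
      by (intro power_mono) auto
    also have "\<dots> = 256 * C\<^sup>2 * d\<^sup>2 / ilength K * (ilength J)\<^sup>2 * (ilength J / ilength K)"
      using pos J(2) by (simp add: power_mult_distrib power_divide) (simp add: power2_eq_square power_numeral_reduce field_simps)
    also have "\<dots> \<le> 256 * C\<^sup>2 * d\<^sup>2 / ilength K * (ilength J)\<^sup>2 * 1"
      using pos J(3) by (intro mult_left_mono) auto
    finally show ?thesis by simp
  qed
  have squares: "(\<Sum>J\<in>F. (ilength J)\<^sup>2) \<le> 2 * (ilength K)\<^sup>2"
  proof -
    have "(\<Sum>J\<in>F. (ilength J)\<^sup>2) = (\<Sum>s\<in>ilength ` F. \<Sum>J\<in>{J \<in> F. ilength J = s}. (ilength J)\<^sup>2)"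
      by (rule sum.image_gen[OF F(1)])
    also have "\<dots> \<le> (\<Sum>s\<in>ilength ` F. s * ilength K)"
    proof (rule sum_mono)
      fix s assume "s \<in> ilength ` F"
      then have s: "0 < s" using FJ by auto
      have "(\<Sum>J\<in>{J \<in> F. ilength J = s}. (ilength J)\<^sup>2) = s * (\<Sum>J\<in>{J \<in> F. ilength J = s}. ilength J)"
        by (simp add: sum_distrib_left power2_eq_square)
      also have "\<dots> \<le> s * ilength K"
      proof (intro mult_left_mono sum_disjoint_lengths_le)
        show "disjoint {J \<in> F. ilength J = s}"
          unfolding disjoint_def using same_length_eq F(2) by (auto simp: subset_iff)
      qed (use F s K interval_lmeasurable in auto)
      finally show "(\<Sum>J\<in>{J \<in> F. ilength J = s}. (ilength J)\<^sup>2) \<le> s * ilength K" .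
    qed
    also have "\<dots> = (\<Sum>s\<in>ilength ` F. s) * ilength K" by (simp only: sum_distrib_right)
    also have "\<dots> \<le> 2 * ilength K * ilength K"
      using sum_lengths_le(1)[OF F(1,2) K(1)] FJ pos by (intro mult_right_mono) auto
    finally show ?thesis by (simp add: power2_eq_square)
  qed
  have "(\<Sum>J\<in>F. (coef V J)\<^sup>2) \<le> (\<Sum>J\<in>F. 2 * (coef (V \<inter> double K) J)\<^sup>2 + 2 * (256 * C\<^sup>2 * d\<^sup>2 / ilength K * (ilength J)\<^sup>2))"
  proof (rule sum_mono)
    fix J assume J: "J \<in> F"
    have "(a + b)\<^sup>2 \<le> 2 * a\<^sup>2 + 2 * b\<^sup>2" for a b :: real
      using sum_squares_bound[of a b] by (simp add: power2_sum)
    then have "(coef V J)\<^sup>2 \<le> 2 * (coef (V \<inter> double K) J)\<^sup>2 + 2 * (coef (V - double K) J)\<^sup>2"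
      using coef_split[OF V _ FJ(1)[OF J], of "double K"] by simp
    then show "(coef V J)\<^sup>2 \<le> 2 * (coef (V \<inter> double K) J)\<^sup>2 + 2 * (256 * C\<^sup>2 * d\<^sup>2 / ilength K * (ilength J)\<^sup>2)"
      using far[OF J] by linarith
  qed
  also have "\<dots> = 2 * (\<Sum>J\<in>F. (coef (V \<inter> double K) J)\<^sup>2) + 2 * (256 * C\<^sup>2 * d\<^sup>2 / ilength K * (\<Sum>J\<in>F. (ilength J)\<^sup>2))"
    by (simp only: sum.distrib sum_distrib_left)
  also have "\<dots> \<le> 2 * (4 * ilength K * d) + 2 * (256 * C\<^sup>2 * d\<^sup>2 / ilength K * (2 * (ilength K)\<^sup>2))"
    using coef_square_sum_le[OF N F(1,2)] measure_double_le[OF V K(1)] squares pos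
    by (intro add_mono mult_left_mono) (auto simp: d_def)
  also have "\<dots> = 8 * d * ilength K + 1024 * C\<^sup>2 * d * ilength K * d"
    using pos by (simp add: power2_eq_square)
  also have "\<dots> \<le> 8 * d * ilength K + 1024 * C\<^sup>2 * d * ilength K * 1"
    using pos d by (intro add_left_mono mult_left_mono) auto
  also have "\<dots> = (8 + 1024 * C\<^sup>2) * local_density V K * ilength K" by (simp add: d_def algebra_simps)
  finally show ?thesis .
qed

text \<open>It suffices to sum over the maximal members of the family: they are disjoint, and none of them is sparse, so
the covering bound applies to them.\<close>

lemma low_density_sum_le:
  assumes V: "V \<in> lmeasurable" and \<epsilon>: "0 < \<epsilon>" and \<delta>: "0 < \<delta>" "\<delta> \<le> 1" and F: "finite F" "F \<subseteq> D"
    and low: "\<And>J. J \<in> F \<Longrightarrow> J \<notin> sparse V \<epsilon> \<and> local_density V J < \<delta>"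
  shows "(\<Sum>J\<in>F. (coef V J)\<^sup>2) \<le> (8 + 1024 * C\<^sup>2) * \<delta> * (160 / \<epsilon>) * vol V"
proof -
  define \<M> where "\<M> = {K \<in> F. \<forall>K'\<in>F. K \<subseteq> K' \<longrightarrow> K = K'}"
  have \<M>: "finite \<M>" "\<M> \<subseteq> D" using F by (auto simp: \<M>_def)
  have \<M>': "K \<notin> sparse V \<epsilon>" "local_density V K < \<delta>" if "K \<in> \<M>" for K using that low by (auto simp: \<M>_def)
  have disj: "disjoint \<M>"
    unfolding disjoint_def
  proof (intro ballI impI, rule ccontr)
    fix K K' assume K: "K \<in> \<M>" "K' \<in> \<M>" "K \<noteq> K'" "K \<inter> K' \<noteq> {}"
    then obtain x where x: "x \<in> K" "x \<in> K'" by blast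
    have "K \<subseteq> K' \<or> K' \<subseteq> K" using nested[of K K' x] nested[of K' K x] K x \<M>(2) by (metis linear subsetD)
    then show False using K by (auto simp: \<M>_def)
  qed
  have "\<exists>K\<in>\<M>. J \<subseteq> K" if "J \<in> F" for J
    using finite_has_maximal2[OF F(1) that] by (auto simp: \<M>_def)
  then obtain \<mu> where \<mu>: "\<And>J. J \<in> F \<Longrightarrow> \<mu> J \<in> \<M> \<and> J \<subseteq> \<mu> J" by metis
  have "(\<Sum>J\<in>F. (coef V J)\<^sup>2) = (\<Sum>K\<in>\<M>. \<Sum>J\<in>{J \<in> F. \<mu> J = K}. (coef V J)\<^sup>2)"
    using \<mu> F(1) \<M>(1) by (intro sum.group[symmetric]) auto
  also have "\<dots> \<le> (\<Sum>K\<in>\<M>. (8 + 1024 * C\<^sup>2) * \<delta> * ilength K)"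
  proof (rule sum_mono)
    fix K assume K: "K \<in> \<M>"
    then have KD: "K \<in> D" "0 \<le> ilength K" using \<M>(2) by auto
    have "(\<Sum>J\<in>{J \<in> F. \<mu> J = K}. (coef V J)\<^sup>2) \<le> (8 + 1024 * C\<^sup>2) * local_density V K * ilength K"
      using F \<mu> \<M>'(2)[OF K] \<delta> by (intro subtree_sum_le V KD) auto
    also have "\<dots> \<le> (8 + 1024 * C\<^sup>2) * \<delta> * ilength K"
      using \<M>'(2)[OF K] KD by (intro mult_right_mono mult_left_mono) auto
    finally show "(\<Sum>J\<in>{J \<in> F. \<mu> J = K}. (coef V J)\<^sup>2) \<le> (8 + 1024 * C\<^sup>2) * \<delta> * ilength K" .
  qed
  also have "\<dots> = (8 + 1024 * C\<^sup>2) * \<delta> * (\<Sum>K\<in>\<M>. ilength K)" by (simp only: sum_distrib_left)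
  also have "\<dots> \<le> (8 + 1024 * C\<^sup>2) * \<delta> * (160 / \<epsilon> * vol V)"
    using \<delta> \<M>(2) \<M>'(1)
    by (intro mult_left_mono high_density_covering[OF V \<epsilon> \<M>(1,2) disj] not_sparse_dense_ancestor) auto
  finally show ?thesis by (simp add: mult.assoc)
qed

end

section \<open>Almost orthogonal step functions\<close>

text \<open>Schur's test for the Gram matrix, followed by \<open>0 \<le> \<parallel>f - h / K\<parallel>\<^sup>2\<close> for the synthesised function \<open>h\<close>.\<close>

lemma almost_orthogonal_bessel:
  assumes F: "finite F" and \<phi>: "\<And>J. J \<in> F \<Longrightarrow> \<phi> J \<in> L2" and f: "f \<in> L2" and K: "0 < K"
    and rows: "\<And>J. J \<in> F \<Longrightarrow> (\<Sum>J'\<in>F. \<bar>L2_inner (\<phi> J) (\<phi> J')\<bar>) \<le> K"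
  shows "(\<Sum>J\<in>F. (L2_inner f (\<phi> J))\<^sup>2) \<le> K * L2_inner f f"
proof -
  define a where "a J = L2_inner f (\<phi> J)" for J
  define G where "G J J' = \<bar>L2_inner (\<phi> J) (\<phi> J')\<bar>" for J J'
  define h where "h = (\<lambda>x. \<Sum>J\<in>F. a J * \<phi> J x)"
  define X where "X = (\<Sum>J\<in>F. (a J)\<^sup>2)"
  have h: "h \<in> L2" unfolding h_def by (intro L2_sum L2_scale \<phi>)
  have fh: "L2_inner f h = X"
    using L2_inner_combination[of F \<phi> f a] \<phi> f
    by (simp add: h_def X_def a_def L2_inner_commute power2_eq_square)
  have hJ: "L2_inner (\<phi> J) h = (\<Sum>J'\<in>F. a J' * L2_inner (\<phi> J') (\<phi> J))" if "J \<in> F" for J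
    using L2_inner_combination[of F \<phi> "\<phi> J" a] \<phi> that by (simp add: h_def L2_inner_commute)
  have "L2_inner h h = (\<Sum>J\<in>F. a J * L2_inner (\<phi> J) h)"
    using L2_inner_combination[of F \<phi> h a] \<phi> h by (simp add: h_def[symmetric])
  also have "\<dots> = (\<Sum>J\<in>F. \<Sum>J'\<in>F. a J * a J' * L2_inner (\<phi> J') (\<phi> J))"
    using hJ by (simp add: sum_distrib_left mult.assoc)
  also have "\<dots> \<le> (\<Sum>J\<in>F. \<Sum>J'\<in>F. (a J)\<^sup>2 / 2 * G J J' + (a J')\<^sup>2 / 2 * G J' J)"
  proof (intro sum_mono)
    fix J J'
    have "a J * a J' * L2_inner (\<phi> J') (\<phi> J) \<le> \<bar>a J * a J'\<bar> * G J J'"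
      unfolding G_def by (subst L2_inner_commute) (metis abs_ge_self abs_mult)
    also have "\<dots> \<le> ((a J)\<^sup>2 + (a J')\<^sup>2) / 2 * G J J'"
    proof (rule mult_right_mono)
      show "\<bar>a J * a J'\<bar> \<le> ((a J)\<^sup>2 + (a J')\<^sup>2) / 2"
        using sum_squares_bound[of "\<bar>a J\<bar>" "\<bar>a J'\<bar>"] by (simp add: abs_mult)
    qed (simp add: G_def)
    also have "\<dots> = (a J)\<^sup>2 / 2 * G J J' + (a J')\<^sup>2 / 2 * G J' J"
      by (simp add: G_def L2_inner_commute field_simps)
    finally show "a J * a J' * L2_inner (\<phi> J') (\<phi> J) \<le> (a J)\<^sup>2 / 2 * G J J' + (a J')\<^sup>2 / 2 * G J' J" .
  qed
  also have "\<dots> = (\<Sum>J\<in>F. \<Sum>J'\<in>F. (a J)\<^sup>2 / 2 * G J J') + (\<Sum>J\<in>F. \<Sum>J'\<in>F. (a J')\<^sup>2 / 2 * G J' J)"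
    by (simp only: sum.distrib)
  also have "(\<Sum>J\<in>F. \<Sum>J'\<in>F. (a J')\<^sup>2 / 2 * G J' J) = (\<Sum>J\<in>F. \<Sum>J'\<in>F. (a J)\<^sup>2 / 2 * G J J')"
    by (rule sum.swap)
  also have "(\<Sum>J\<in>F. \<Sum>J'\<in>F. (a J)\<^sup>2 / 2 * G J J') + (\<Sum>J\<in>F. \<Sum>J'\<in>F. (a J)\<^sup>2 / 2 * G J J')
      = (\<Sum>J\<in>F. (a J)\<^sup>2 * (\<Sum>J'\<in>F. G J J'))"
    unfolding sum.distrib[symmetric] sum_distrib_left by (intro sum.cong) auto
  also have "\<dots> \<le> (\<Sum>J\<in>F. (a J)\<^sup>2 * K)"
    using rows unfolding G_def by (intro sum_mono mult_left_mono) auto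
  also have "\<dots> = K * X" by (simp add: X_def sum_distrib_left mult.commute)
  finally have hh: "L2_inner h h \<le> K * X" .
  \<comment> \<open>The choice of \<open>t\<close> minimises the quadratic bound below.\<close>
  define t where "t = 1 / K"
  have "0 \<le> L2_inner (\<lambda>x. f x - t * h x) (\<lambda>x. f x - t * h x)" by (rule L2_inner_self_nonneg)
  also have "\<dots> = L2_inner f f - 2 * (t * X) + t * t * L2_inner h h"
  proof -
    have 1: "L2_inner f (\<lambda>x. t * h x) = t * X"
      using L2_inner_scale_left[of t h f] fh L2_inner_commute[of f h]
        L2_inner_commute[of f "\<lambda>x. t * h x"] by simp
    have 2: "L2_inner (\<lambda>x. t * h x) (\<lambda>x. t * h x) = t * t * L2_inner h h"
      using L2_inner_scale_left[of t h h] L2_inner_scale_left[of t h "\<lambda>x. t * h x"]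
        L2_inner_commute[of h "\<lambda>x. t * h x"] by simp
    show ?thesis
      using L2_inner_diff_self[OF f L2_scale[OF h, of t]] unfolding 1 2 .
  qed
  also have "\<dots> \<le> L2_inner f f - 2 * (t * X) + t * t * (K * X)"
    using hh by (intro add_left_mono mult_left_mono) auto
  also have "\<dots> = L2_inner f f - X / K" using K by (simp add: t_def field_simps)
  finally have "X / K \<le> L2_inner f f" by simp
  then show ?thesis using K by (simp add: X_def a_def divide_le_eq mult.commute)
qed

definition scaled :: "real \<Rightarrow> real \<Rightarrow> real set \<Rightarrow> real set" where
  "scaled a b J = {icenter J + a * ilength J..icenter J + b * ilength J}"

lemma scaled_lmeasurable: "scaled a b J \<in> lmeasurable"
  by (simp add: scaled_def)

lemma measure_scaled: "a \<le> b \<Longrightarrow> 0 < ilength J \<Longrightarrow> vol (scaled a b J) = (b - a) * ilength J"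
  by (simp add: scaled_def left_diff_distrib)

lemma scaled_mono:
  assumes "0 \<le> ilength J" "a' \<le> a" "b \<le> b'"
  shows "scaled a b J \<subseteq> scaled a' b' J"
  using mult_right_mono[OF assms(2,1)] mult_right_mono[OF assms(3,1)] by (auto simp: scaled_def)

text \<open>The difference of the averages over a large dilate of \<open>J\<close> and over a rescaled copy of \<open>[a, b]\<close>. It has mean
zero, and \<open>[a, b] \<subseteq> [-R, R]\<close> keeps its support within the dilate.\<close>

definition step :: "real \<Rightarrow> real \<Rightarrow> real \<Rightarrow> real set \<Rightarrow> real \<Rightarrow> real" where
  "step R a b J x = indicator (scaled (-R) R J) x / (2 * R) - indicator (scaled a b J) x / (b - a)"

lemma step_L2: "step R a b J \<in> L2"
proof -
  have "(\<lambda>x. (1 / (2 * R)) * indicator (scaled (-R) R J) x - (1 / (b - a)) * indicator (scaled a b J) x) \<in> L2"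
    by (intro L2_diff L2_scale L2_indicator scaled_lmeasurable)
  then show ?thesis by (simp add: step_def[abs_def])
qed

lemma inner_step:
  assumes "V \<in> lmeasurable"
  shows "L2_inner (indicator V) (step R a b J)
    = vol (V \<inter> scaled (-R) R J) / (2 * R) - vol (V \<inter> scaled a b J) / (b - a)"
proof -
  have "L2_inner (step R a b J) (indicator V)
      = L2_inner (\<lambda>x. (1 / (2 * R)) * indicator (scaled (-R) R J) x - (1 / (b - a)) * indicator (scaled a b J) x) (indicator V)"
    by (simp add: step_def[abs_def])
  also have "\<dots> = (1 / (2 * R)) * L2_inner (indicator (scaled (-R) R J)) (indicator V)
      - (1 / (b - a)) * L2_inner (indicator (scaled a b J)) (indicator V)"
    unfolding L2_inner_scale_left[symmetric]
    using assms by (intro L2_inner_diff_left L2_scale L2_indicator scaled_lmeasurable)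
  finally show ?thesis
    using assms by (simp add: L2_inner_commute[of _ "step R a b J"] L2_inner_indicator scaled_lmeasurable Int_commute)
qed

lemma indicator_constant:
  fixes l u p q x y :: real
  assumes "l \<notin> {p..q}" "u \<notin> {p..q}" "x \<in> {p..q}" "y \<in> {p..q}"
  shows "indicat_real {l..u} x = indicat_real {l..u} y"
  using assms by (auto simp: indicator_def)

context dyadic
begin

context
  fixes R a b :: real
  assumes R: "0 < R" and ab: "a < b" "- R \<le> a" "b \<le> R"
begin

abbreviation step_height :: real where "step_height \<equiv> 1 / (2 * R) + 1 / (b - a)"

lemma step_support: "J \<in> D \<Longrightarrow> x \<notin> scaled (-R) R J \<Longrightarrow> step R a b J x = 0"
proof -
  assume J: "J \<in> D" and x: "x \<notin> scaled (-R) R J"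
  have "scaled a b J \<subseteq> scaled (-R) R J"
    using length_pos[OF J] ab by (intro scaled_mono) auto
  then have "x \<notin> scaled a b J" using x by blast
  then show ?thesis using x by (simp add: step_def)
qed

lemma step_abs_le:
  "\<bar>step R a b J x\<bar> \<le> indicator (scaled (-R) R J) x / (2 * R) + indicator (scaled a b J) x / (b - a)"
proof -
  have "\<bar>u - v\<bar> \<le> u + v" if "0 \<le> u" "0 \<le> v" for u v :: real using that by linarith
  then show ?thesis unfolding step_def using R ab by simp
qed

lemma step_bound: "\<bar>step R a b J x\<bar> \<le> step_height"
proof (rule order_trans[OF step_abs_le], rule add_mono)
  show "indicat_real (scaled (-R) R J) x / (2 * R) \<le> 1 / (2 * R)"
    using R by (intro divide_right_mono) (auto simp: indicator_def)
  show "indicat_real (scaled a b J) x / (b - a) \<le> 1 / (b - a)"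
    using ab by (intro divide_right_mono) (auto simp: indicator_def)
qed

text \<open>A function of mean zero is orthogonal to anything constant on its support.\<close>

lemma step_far_inner_zero:
  assumes J: "J \<in> D" and J': "J' \<in> D"
    and far: "\<And>\<sigma>. \<sigma> \<in> {-R, R, a, b} \<Longrightarrow> icenter J + \<sigma> * ilength J \<notin> scaled (-R) R J'"
  shows "L2_inner (step R a b J) (step R a b J') = 0"
proof -
  have pos: "0 < ilength J'" using J' length_pos by blast
  define c where "c = step R a b J (icenter J')"
  have "icenter J' \<in> scaled (-R) R J'" using R pos by (simp add: scaled_def)
  then have "step R a b J x = c" if "x \<in> scaled (-R) R J'" for x
    using indicator_constant[OF _ _ that[unfolded scaled_def] \<open>icenter J' \<in> _\<close>[unfolded scaled_def]] far
    unfolding c_def step_def scaled_def by (smt (verit, best) insertCI)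
  then have eq: "step R a b J x * step R a b J' x = c * (step R a b J' x * indicator (scaled (-R) R J') x)" for x
    using step_support[OF J', of x] by (cases "x \<in> scaled (-R) R J'") auto
  have "L2_inner (step R a b J) (step R a b J') = c * L2_inner (indicator (scaled (-R) R J')) (step R a b J')"
    unfolding L2_inner_def eq integral_mult_right_zero by (simp only: mult.commute)
  also have "L2_inner (indicator (scaled (-R) R J')) (step R a b J') = 0"
  proof -
    have "scaled (-R) R J' \<inter> scaled a b J' = scaled a b J'"
      using ab pos by (intro Int_absorb1 scaled_mono) auto
    then show ?thesis
      using R ab pos by (simp add: inner_step scaled_lmeasurable measure_scaled)
  qed
  finally show ?thesis by simp
qed

lemma step_inner_le:
  assumes J: "J \<in> D" and J': "J' \<in> D"
  shows "\<bar>L2_inner (step R a b J) (step R a b J')\<bar> \<le> 2 * step_height * ilength J'"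
proof -
  have pos: "0 < ilength J'" using J' length_pos by blast
  have H: "0 \<le> step_height" using R ab by simp
  let ?g = "\<lambda>x. indicator (scaled (-R) R J') x / (2 * R) + indicator (scaled a b J') x / (b - a) :: real"
  have int: "integrable lebesgue (indicator (scaled c d J') :: real \<Rightarrow> real)" for c d
    using scaled_lmeasurable lmeasurable_iff_integrable by blast
  have "\<bar>L2_inner (step R a b J) (step R a b J')\<bar> \<le> (\<integral>x. \<bar>step R a b J x * step R a b J' x\<bar> \<partial>lebesgue)"
    unfolding L2_inner_def by (rule integral_abs_bound)
  also have "\<dots> \<le> (\<integral>x. step_height * ?g x \<partial>lebesgue)"
  proof (rule integral_mono)
    show "integrable lebesgue (\<lambda>x. \<bar>step R a b J x * step R a b J' x\<bar>)"
      using L2_mult_integrable[OF step_L2 step_L2] by (rule integrable_abs)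
    show "integrable lebesgue (\<lambda>x. step_height * ?g x)" using int by auto
    show "\<bar>step R a b J x * step R a b J' x\<bar> \<le> step_height * ?g x" for x
      unfolding abs_mult
    proof (intro mult_mono step_bound H abs_ge_zero)
      show "\<bar>step R a b J' x\<bar> \<le> ?g x" by (rule step_abs_le)
    qed
  qed
  also have "\<dots> = step_height * (vol (scaled (-R) R J') / (2 * R) + vol (scaled a b J') / (b - a))"
    using int by simp
  also have "\<dots> = 2 * step_height * ilength J'"
    using R ab pos by (simp add: measure_scaled)
  finally show ?thesis .
qed

text \<open>By the mean-zero property, the step functions of two intervals interact only if a jump of the longer one
falls into the dilate of the shorter one. On each level this leaves boundedly many partners, and the
normalised inner product is of the order of the square root of the ratio of the lengths, which is
summable over the levels in both directions.\<close>

lemma step_row_sum_le: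
  assumes F: "finite F" "F \<subseteq> D" and J: "J \<in> D"
  shows "(\<Sum>J'\<in>F. \<bar>L2_inner (step R a b J) (step R a b J')\<bar> / sqrt (ilength J * ilength J'))
    \<le> 640 * step_height * (1 + 2 * R)\<^sup>2"
proof -
  define H where "H = step_height"
  have H: "0 \<le> H" using R ab by (simp add: H_def)
  define g where "g J' = \<bar>L2_inner (step R a b J) (step R a b J')\<bar> / sqrt (ilength J * ilength J')" for J'
  define p where "p \<sigma> = icenter J + \<sigma> * ilength J" for \<sigma>
  let ?S = "{-R, R, a, b}"
  have pos: "0 < ilength J" using J length_pos by blast
  let ?A = "{J' \<in> F. ilength J' \<le> ilength J}" and ?B = "{J' \<in> F. ilength J < ilength J'}"
  have ratio: "s / sqrt (s * t) = sqrt s / sqrt t" if "0 < s" "0 < t" for s t :: real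
    using that by (simp add: real_sqrt_mult real_div_sqrt field_simps)
  have small: "g J' \<le> 2 * H * (1 + 2 * R)\<^sup>2 / sqrt (ilength J) * (\<Sum>\<sigma>\<in>?S. sqrt (ilength J') / (rdist J' (p \<sigma>))\<^sup>2)"
    if J': "J' \<in> ?A" for J'
  proof (cases "\<exists>\<sigma>\<in>?S. p \<sigma> \<in> scaled (-R) R J'")
    case False
    have "L2_inner (step R a b J) (step R a b J') = 0"
    proof (rule step_far_inner_zero[OF J])
      show "J' \<in> D" using J' F(2) by blast
      show "icenter J + \<sigma> * ilength J \<notin> scaled (-R) R J'" if "\<sigma> \<in> ?S" for \<sigma>
        using False that unfolding p_def by blast
    qed
    then have "g J' = 0" by (simp add: g_def)
    then show ?thesis using H pos by (simp add: sum_nonneg)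
  next
    case True
    then obtain \<sigma> where \<sigma>: "\<sigma> \<in> ?S" "p \<sigma> \<in> scaled (-R) R J'" by blast
    have J'D: "J' \<in> D" "0 < ilength J'" using J' F(2) length_pos by auto
    have "\<bar>p \<sigma> - icenter J'\<bar> \<le> R * ilength J'" using \<sigma>(2) by (auto simp: scaled_def abs_le_iff)
    then have "\<bar>p \<sigma> - icenter J'\<bar> / ilength J' \<le> R" using J'D by (simp add: divide_le_eq)
    then have "rdist J' (p \<sigma>) \<le> 1 + 2 * R" using R unfolding rdist_def by linarith
    then have "1 / (1 + 2 * R)\<^sup>2 \<le> 1 / (rdist J' (p \<sigma>))\<^sup>2" by (intro square_inverse_mono) auto
    then have one: "1 \<le> (1 + 2 * R)\<^sup>2 * (1 / (rdist J' (p \<sigma>))\<^sup>2)" using R by (simp add: field_simps)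
    have "g J' \<le> 2 * H * ilength J' / sqrt (ilength J * ilength J')"
      unfolding g_def H_def using step_inner_le[OF J J'D(1)] pos J'D by (intro divide_right_mono) auto
    also have "\<dots> = 2 * H * (ilength J' / sqrt (ilength J' * ilength J))" by (simp add: mult.commute)
    also have "\<dots> = 2 * H / sqrt (ilength J) * sqrt (ilength J') * 1"
      unfolding ratio[OF J'D(2) pos] by simp
    also have "\<dots> \<le> 2 * H / sqrt (ilength J) * sqrt (ilength J') * ((1 + 2 * R)\<^sup>2 * (1 / (rdist J' (p \<sigma>))\<^sup>2))"
      using one H pos J'D by (intro mult_left_mono) auto
    also have "\<dots> = 2 * H * (1 + 2 * R)\<^sup>2 / sqrt (ilength J) * (sqrt (ilength J') / (rdist J' (p \<sigma>))\<^sup>2)" by simp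
    also have "\<dots> \<le> 2 * H * (1 + 2 * R)\<^sup>2 / sqrt (ilength J) * (\<Sum>\<sigma>\<in>?S. sqrt (ilength J') / (rdist J' (p \<sigma>))\<^sup>2)"
    proof (rule mult_left_mono)
      show "sqrt (ilength J') / (rdist J' (p \<sigma>))\<^sup>2 \<le> (\<Sum>\<sigma>\<in>?S. sqrt (ilength J') / (rdist J' (p \<sigma>))\<^sup>2)"
        using \<sigma>(1) J'D by (intro member_le_sum) auto
      show "0 \<le> 2 * H * (1 + 2 * R)\<^sup>2 / sqrt (ilength J)" using H pos by simp
    qed
    finally show ?thesis .
  qed
  have "sum g ?A \<le> (\<Sum>J'\<in>?A. 2 * H * (1 + 2 * R)\<^sup>2 / sqrt (ilength J) * (\<Sum>\<sigma>\<in>?S. sqrt (ilength J') / (rdist J' (p \<sigma>))\<^sup>2))"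
    by (intro sum_mono small)
  also have "\<dots> = 2 * H * (1 + 2 * R)\<^sup>2 / sqrt (ilength J) * (\<Sum>\<sigma>\<in>?S. \<Sum>J'\<in>?A. sqrt (ilength J') / (rdist J' (p \<sigma>))\<^sup>2)"
    by (subst sum.swap) (simp only: sum_distrib_left)
  also have "\<dots> \<le> 2 * H * (1 + 2 * R)\<^sup>2 / sqrt (ilength J) * (\<Sum>\<sigma>\<in>?S. 64 * sqrt (ilength J))"
  proof (intro mult_left_mono sum_mono)
    fix \<sigma>
    have "(\<Sum>J'\<in>?A. sqrt (ilength J') / (rdist J' (p \<sigma>))\<^sup>2) \<le> 16 * (\<Sum>s\<in>ilength ` ?A. sqrt s)"
      using F by (intro weighted_lattice_sum_le) auto
    also have "\<dots> \<le> 16 * (4 * sqrt (ilength J))"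
      using F J by (intro mult_left_mono sum_lengths_le(2)) auto
    finally show "(\<Sum>J'\<in>?A. sqrt (ilength J') / (rdist J' (p \<sigma>))\<^sup>2) \<le> 64 * sqrt (ilength J)" by simp
  qed (use H pos in simp)
  also have "\<dots> \<le> 2 * H * (1 + 2 * R)\<^sup>2 / sqrt (ilength J) * (4 * (64 * sqrt (ilength J)))"
  proof (rule mult_left_mono)
    have "card ?S \<le> 4" using card_length[of "[-R, R, a, b]"] by simp
    then have "real (card ?S) * (64 * sqrt (ilength J)) \<le> 4 * (64 * sqrt (ilength J))"
      using pos by (intro mult_right_mono) auto
    then show "(\<Sum>\<sigma>\<in>?S. 64 * sqrt (ilength J)) \<le> 4 * (64 * sqrt (ilength J))" by (simp only: sum_constant)
  qed (use H pos in simp)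
  also have "\<dots> = 512 * H * (1 + 2 * R)\<^sup>2" using pos by simp
  finally have A: "sum g ?A \<le> 512 * H * (1 + 2 * R)\<^sup>2" .
  have large: "g J' \<le> 2 * H * (1 + 2 * R)\<^sup>2 * sqrt (ilength J) * (1 / sqrt (ilength J') / (rdist J' (icenter J))\<^sup>2)"
    if J': "J' \<in> ?B" for J'
  proof (cases "\<exists>\<sigma>\<in>?S. icenter J' + \<sigma> * ilength J' \<in> scaled (-R) R J")
    case False
    have "J' \<in> D" using J' F(2) by auto
    then have "L2_inner (step R a b J') (step R a b J) = 0"
      using False by (intro step_far_inner_zero J) blast+
    then have "g J' = 0" by (simp add: g_def L2_inner_commute)
    then show ?thesis using H pos by simp
  next
    case True
    then obtain \<sigma> where \<sigma>: "\<sigma> \<in> ?S" "icenter J' + \<sigma> * ilength J' \<in> scaled (-R) R J" by blast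
    have J'D: "J' \<in> D" "0 < ilength J'" "ilength J < ilength J'" using J' F(2) length_pos by auto
    have "\<bar>\<sigma>\<bar> \<le> R" using \<sigma>(1) ab R by auto
    then have 1: "\<bar>\<sigma> * ilength J'\<bar> \<le> R * ilength J'" using J'D by (simp add: abs_mult mult_right_mono)
    have 2: "\<bar>icenter J' + \<sigma> * ilength J' - icenter J\<bar> \<le> R * ilength J" using \<sigma>(2) by (auto simp: scaled_def abs_le_iff)
    have 3: "R * ilength J \<le> R * ilength J'" using J'D R by simp
    have "\<bar>icenter J - icenter J'\<bar> \<le> \<bar>icenter J' + \<sigma> * ilength J' - icenter J\<bar> + \<bar>\<sigma> * ilength J'\<bar>" by simp
    also have "\<dots> \<le> 2 * R * ilength J'" using 1 2 3 by simp
    finally have "\<bar>icenter J - icenter J'\<bar> / ilength J' \<le> 2 * R" using J'D by (simp add: divide_le_eq)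
    then have "rdist J' (icenter J) \<le> 1 + 2 * R" unfolding rdist_def by linarith
    then have "1 / (1 + 2 * R)\<^sup>2 \<le> 1 / (rdist J' (icenter J))\<^sup>2" by (intro square_inverse_mono) auto
    then have one: "1 \<le> (1 + 2 * R)\<^sup>2 * (1 / (rdist J' (icenter J))\<^sup>2)" using R by (simp add: field_simps)
    have "g J' \<le> 2 * H * ilength J / sqrt (ilength J * ilength J')"
      unfolding g_def H_def using step_inner_le[OF J'D(1) J] pos J'D
      by (intro divide_right_mono) (auto simp: L2_inner_commute)
    also have "\<dots> = 2 * H * (ilength J / sqrt (ilength J * ilength J'))" by simp
    also have "\<dots> = 2 * H * sqrt (ilength J) / sqrt (ilength J') * 1"
      unfolding ratio[OF pos J'D(2)] by simp
    also have "\<dots> \<le> 2 * H * sqrt (ilength J) / sqrt (ilength J') * ((1 + 2 * R)\<^sup>2 * (1 / (rdist J' (icenter J))\<^sup>2))"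
      using one H pos J'D by (intro mult_left_mono) auto
    also have "\<dots> = 2 * H * (1 + 2 * R)\<^sup>2 * sqrt (ilength J) * (1 / sqrt (ilength J') / (rdist J' (icenter J))\<^sup>2)" by simp
    finally show ?thesis .
  qed
  have "sum g ?B \<le> (\<Sum>J'\<in>?B. 2 * H * (1 + 2 * R)\<^sup>2 * sqrt (ilength J) * (1 / sqrt (ilength J') / (rdist J' (icenter J))\<^sup>2))"
    by (intro sum_mono large)
  also have "\<dots> = 2 * H * (1 + 2 * R)\<^sup>2 * sqrt (ilength J) * (\<Sum>J'\<in>?B. 1 / sqrt (ilength J') / (rdist J' (icenter J))\<^sup>2)"
    by (simp only: sum_distrib_left)
  also have "\<dots> \<le> 2 * H * (1 + 2 * R)\<^sup>2 * sqrt (ilength J) * (16 * (4 / sqrt (ilength J)))"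
  proof (rule mult_left_mono)
    have "(\<Sum>J'\<in>?B. 1 / sqrt (ilength J') / (rdist J' (icenter J))\<^sup>2) \<le> 16 * (\<Sum>s\<in>ilength ` ?B. 1 / sqrt s)"
      using F by (intro weighted_lattice_sum_le) auto
    also have "\<dots> \<le> 16 * (4 / sqrt (ilength J))"
      using F J by (intro mult_left_mono sum_inverse_lengths_le(2)) auto
    finally show "(\<Sum>J'\<in>?B. 1 / sqrt (ilength J') / (rdist J' (icenter J))\<^sup>2) \<le> 16 * (4 / sqrt (ilength J))" .
  qed (use H pos in simp)
  also have "\<dots> = 128 * H * (1 + 2 * R)\<^sup>2" using pos by simp
  finally have B: "sum g ?B \<le> 128 * H * (1 + 2 * R)\<^sup>2" .
  have "sum g F = sum g (?A \<union> ?B)" by (rule arg_cong[of _ _ "sum g"]) auto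
  also have "\<dots> = sum g ?A + sum g ?B" using F(1) by (intro sum.union_disjoint) auto
  also have "\<dots> \<le> 640 * H * (1 + 2 * R)\<^sup>2" using A B by simp
  finally show ?thesis by (simp add: g_def H_def)
qed

lemma step_bessel:
  assumes V: "V \<in> lmeasurable" and F: "finite F" "F \<subseteq> D"
  shows "(\<Sum>J\<in>F. (L2_inner (indicator V) (step R a b J))\<^sup>2 / ilength J)
    \<le> 640 * step_height * (1 + 2 * R)\<^sup>2 * vol V"
proof -
  define \<phi> where "\<phi> J = (\<lambda>x. 1 / sqrt (ilength J) * step R a b J x)" for J
  have in1: "L2_inner (\<phi> J) f = L2_inner (step R a b J) f / sqrt (ilength J)" for J f
    by (simp only: \<phi>_def L2_inner_scale_left) simp
  have in2: "L2_inner f (\<phi> J) = L2_inner f (step R a b J) / sqrt (ilength J)" for J f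
    using in1[of J f] by (simp only: L2_inner_commute)
  have "(\<Sum>J\<in>F. (L2_inner (indicator V) (\<phi> J))\<^sup>2) \<le> 640 * step_height * (1 + 2 * R)\<^sup>2 * L2_inner (indicator V) (indicator V)"
  proof (rule almost_orthogonal_bessel[OF F(1) _ L2_indicator[OF V]])
    show "\<phi> J \<in> L2" for J unfolding \<phi>_def by (intro L2_scale step_L2)
    have "0 < step_height" using R ab by (intro add_pos_pos) auto
    then show "0 < 640 * step_height * (1 + 2 * R)\<^sup>2" using R by simp
    show "(\<Sum>J'\<in>F. \<bar>L2_inner (\<phi> J) (\<phi> J')\<bar>) \<le> 640 * step_height * (1 + 2 * R)\<^sup>2" if "J \<in> F" for J
    proof -
      have "(\<Sum>J'\<in>F. \<bar>L2_inner (\<phi> J) (\<phi> J')\<bar>)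
          = (\<Sum>J'\<in>F. \<bar>L2_inner (step R a b J) (step R a b J')\<bar> / sqrt (ilength J * ilength J'))"
        by (simp add: in1 in2 real_sqrt_mult abs_mult)
      then show ?thesis using step_row_sum_le[OF F] that F(2) by auto
    qed
  qed
  then show ?thesis
    using F(2) by (simp add: in2 power_divide L2_inner_indicator V)
qed

end

end

section \<open>Dense intervals of low energy\<close>

lemma mass_split:
  assumes "A \<in> lmeasurable" "B \<in> sets lebesgue"
  shows "mass p A J = mass p (A \<inter> B) J + mass p (A - B) J"
proof -
  have m: "A \<inter> B \<in> lmeasurable" "A - B \<in> lmeasurable"
    using assms by (auto intro: fmeasurable_Int_fmeasurable fmeasurable_Diff)
  have "mass p ((A \<inter> B) \<union> (A - B)) J = mass p (A \<inter> B) J + mass p (A - B) J"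
    unfolding mass_def by (intro set_integral_Un mass_integrable m) auto
  then show ?thesis by (simp add: Int_Diff_Un)
qed

context wavelet_basis
begin

text \<open>The factor with which the square of a coefficient enters the integral of the square function.\<close>

definition energy :: "real set \<Rightarrow> real set \<Rightarrow> real" where
  "energy V J = (LINT x:V|lebesgue. (wavelet w J x)\<^sup>2)"

lemma energy_integrable:
  assumes "V \<in> sets lebesgue" "J \<in> D"
  shows "set_integrable lebesgue V (\<lambda>x. (wavelet w J x)\<^sup>2)"
  using L2_square_integrable[OF wavelet_L2[OF assms(2)]] assms(1)
  unfolding set_integrable_def by (intro integrable_mult_indicator)

lemma wavelet_square:
  assumes "J \<in> D"
  shows "(w ((x - icenter J) / ilength J))\<^sup>2 = ilength J * (wavelet w J x)\<^sup>2"
  using length_pos[OF assms] by (simp add: wavelet_eq[OF assms] power_mult_distrib power_divide)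

text \<open>Where \<open>|w|\<close> exceeds the first term, the decay of \<open>w\<close> confines \<open>t\<close> to a bounded region and forces \<open>|w| \<ge> \<tau>\<^sup>2 / C\<close>, so
\<open>|w|\<close> is controlled by its square.\<close>

lemma decay_interpolation:
  assumes "0 < \<tau>"
  shows "\<bar>w t\<bar> \<le> \<tau> / (1 + \<bar>t\<bar>)\<^sup>2 + C / \<tau>\<^sup>2 * (w t)\<^sup>2"
proof (cases "\<bar>w t\<bar> \<le> \<tau> / (1 + \<bar>t\<bar>)\<^sup>2")
  case True
  then show ?thesis using C_nonneg by (simp add: add_increasing2)
next
  case False
  define q where "q = (1 + \<bar>t\<bar>)\<^sup>2"
  have q: "1 \<le> q" unfolding q_def by (rule one_le_power) simp
  have wq: "\<tau> < \<bar>w t\<bar> * q" using False q unfolding q_def[symmetric] by (simp add: divide_less_eq not_le)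
  have "\<bar>w t\<bar> * q ^ 4 \<le> C"
  proof -
    have "q ^ 4 = (1 + \<bar>t\<bar>) ^ 8" by (simp add: q_def flip: power_mult)
    then have "\<bar>w t\<bar> \<le> C / q ^ 4" using decay[of t] by (simp only:)
    then show ?thesis using q by (simp add: le_divide_eq)
  qed
  have "\<bar>w t\<bar> * q\<^sup>2 \<le> \<bar>w t\<bar> * q ^ 4"
    using q by (intro mult_left_mono power_increasing) auto
  then have wqq: "\<bar>w t\<bar> * q\<^sup>2 \<le> C" using \<open>\<bar>w t\<bar> * q ^ 4 \<le> C\<close> by linarith
  have "\<tau>\<^sup>2 \<le> (\<bar>w t\<bar> * q)\<^sup>2" using wq assms by (intro power_mono) auto
  also have "\<dots> = \<bar>w t\<bar> * (\<bar>w t\<bar> * q\<^sup>2)" by (simp add: power2_eq_square)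
  also have "\<dots> \<le> \<bar>w t\<bar> * C" using wqq by (intro mult_left_mono) auto
  finally have "\<bar>w t\<bar> * \<tau>\<^sup>2 \<le> \<bar>w t\<bar> * (\<bar>w t\<bar> * C)" by (intro mult_left_mono) auto
  then have "\<bar>w t\<bar> \<le> C / \<tau>\<^sup>2 * (w t)\<^sup>2" using assms by (simp add: field_simps power2_eq_square)
  moreover have "0 \<le> \<tau> / (1 + \<bar>t\<bar>)\<^sup>2" using assms by simp
  ultimately show ?thesis by linarith
qed

text \<open>A coefficient is small relative to \<open>sqrt |J|\<close> if the energy is small, since the first term of the interpolation
integrates to at most \<open>16 \<tau>\<close>.\<close>

lemma coef_le_energy:
  assumes V: "V \<in> lmeasurable" and J: "J \<in> D" and \<tau>: "0 < \<tau>"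
  shows "\<bar>coef V J\<bar> \<le> sqrt (ilength J) * (16 * \<tau> + C / \<tau>\<^sup>2 * energy V J)"
proof -
  define s where "s = ilength J"
  have s: "0 < s" using length_pos[OF J] by (simp add: s_def)
  have pt: "\<bar>wavelet w J x\<bar> \<le> \<tau> / sqrt s * (1 / (rdist J x)\<^sup>2) + C / \<tau>\<^sup>2 * sqrt s * (wavelet w J x)\<^sup>2" for x
  proof -
    let ?t = "(x - icenter J) / s"
    have "\<bar>wavelet w J x\<bar> = \<bar>w ?t\<bar> / sqrt s"
      using s by (simp add: wavelet_eq[OF J] abs_mult s_def)
    also have "\<dots> \<le> (\<tau> / (1 + \<bar>?t\<bar>)\<^sup>2 + C / \<tau>\<^sup>2 * (w ?t)\<^sup>2) / sqrt s"
      using decay_interpolation[OF \<tau>, of ?t] s by (intro divide_right_mono) auto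
    also have "\<dots> = (\<tau> * (1 / (rdist J x)\<^sup>2) + C / \<tau>\<^sup>2 * (s * (wavelet w J x)\<^sup>2)) / sqrt s"
      using wavelet_square[OF J, of x] s by (simp add: rdist_def s_def)
    also have "\<dots> = \<tau> / sqrt s * (1 / (rdist J x)\<^sup>2) + C / \<tau>\<^sup>2 * (s / sqrt s) * (wavelet w J x)\<^sup>2"
      by (simp add: add_divide_distrib mult_ac)
    also have "s / sqrt s = sqrt s" using s by (simp add: real_div_sqrt)
    finally show ?thesis .
  qed
  have i1: "integrable lebesgue (\<lambda>x. indicator V x *\<^sub>R (1 / (rdist J x)\<^sup>2))"
    using mass_integrable[OF V] by (simp add: set_integrable_def)
  have i2: "integrable lebesgue (\<lambda>x. indicator V x *\<^sub>R (wavelet w J x)\<^sup>2)"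
    using energy_integrable[OF fmeasurableD[OF V] J] by (simp add: set_integrable_def)
  have "\<bar>coef V J\<bar> \<le> (\<integral>x. \<bar>indicator V x * wavelet w J x\<bar> \<partial>lebesgue)"
    unfolding coef_def L2_inner_def by (rule integral_abs_bound)
  also have "\<dots> \<le> (\<integral>x. \<tau> / sqrt s * (indicator V x *\<^sub>R (1 / (rdist J x)\<^sup>2))
      + C / \<tau>\<^sup>2 * sqrt s * (indicator V x *\<^sub>R (wavelet w J x)\<^sup>2) \<partial>lebesgue)"
  proof (rule integral_mono)
    show "integrable lebesgue (\<lambda>x. \<bar>indicator V x * wavelet w J x\<bar>)"
      using L2_mult_integrable[OF L2_indicator[OF V] wavelet_L2[OF J]] by (rule integrable_abs)
    show "integrable lebesgue (\<lambda>x. \<tau> / sqrt s * (indicator V x *\<^sub>R (1 / (rdist J x)\<^sup>2))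
      + C / \<tau>\<^sup>2 * sqrt s * (indicator V x *\<^sub>R (wavelet w J x)\<^sup>2))"
      using i1 i2 by (intro Bochner_Integration.integrable_add integrable_mult_right) auto
    show "\<bar>indicator V x * wavelet w J x\<bar> \<le> \<tau> / sqrt s * (indicator V x *\<^sub>R (1 / (rdist J x)\<^sup>2))
      + C / \<tau>\<^sup>2 * sqrt s * (indicator V x *\<^sub>R (wavelet w J x)\<^sup>2)" for x
      using pt[of x] by (cases "x \<in> V") auto
  qed
  also have "\<dots> = \<tau> / sqrt s * mass 2 V J + C / \<tau>\<^sup>2 * sqrt s * energy V J"
    using i1 i2 unfolding mass_def energy_def set_lebesgue_integral_def
    by (subst Bochner_Integration.integral_add) (simp_all only: integrable_mult_right integral_mult_right_zero)
  also have "\<dots> \<le> \<tau> / sqrt s * (16 * s) + C / \<tau>\<^sup>2 * sqrt s * energy V J"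
    using mass_tail_le[OF V J, of 0] \<tau> s by (intro add_right_mono mult_left_mono) (auto simp: s_def)
  also have "\<dots> = 16 * \<tau> * (s / sqrt s) + C / \<tau>\<^sup>2 * sqrt s * energy V J" by simp
  also have "s / sqrt s = sqrt s" using s by (simp add: real_div_sqrt)
  finally show ?thesis by (simp add: s_def algebra_simps)
qed

lemma energy_nonneg: "0 \<le> energy V J"
  unfolding energy_def set_lebesgue_integral_def by (intro Bochner_Integration.integral_nonneg) auto

lemma measure_scaled_le_energy:
  assumes V: "V \<in> lmeasurable" and J: "J \<in> D" and "0 \<le> c"
    and c: "\<And>t. t \<in> {a..b} \<Longrightarrow> c \<le> (w t)\<^sup>2"
  shows "c * vol (V \<inter> scaled a b J) \<le> ilength J * energy V J"
proof -
  have pos: "0 < ilength J" using J length_pos by blast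
  have VH: "V \<inter> scaled a b J \<in> lmeasurable"
    using V scaled_lmeasurable by (auto intro: fmeasurable_Int_fmeasurable fmeasurableD)
  have "(\<integral>x. c * indicator (V \<inter> scaled a b J) x \<partial>lebesgue)
      \<le> (\<integral>x. ilength J * (indicator V x *\<^sub>R (wavelet w J x)\<^sup>2) \<partial>lebesgue)"
  proof (rule integral_mono)
    show "integrable lebesgue (\<lambda>x. c * indicator (V \<inter> scaled a b J) x :: real)"
      using VH unfolding lmeasurable_iff_integrable by (rule integrable_mult_right)
    show "integrable lebesgue (\<lambda>x. ilength J * (indicator V x *\<^sub>R (wavelet w J x)\<^sup>2))"
      using energy_integrable[OF fmeasurableD[OF V] J] unfolding set_integrable_def by (rule integrable_mult_right)
    show "c * indicator (V \<inter> scaled a b J) x \<le> ilength J * (indicator V x *\<^sub>R (wavelet w J x)\<^sup>2)" for x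
    proof (cases "x \<in> V \<inter> scaled a b J")
      case True
      then have "(x - icenter J) / ilength J \<in> {a..b}"
        using pos by (auto simp: scaled_def field_simps)
      then have "c \<le> ilength J * (wavelet w J x)\<^sup>2" using c wavelet_square[OF J, of x] by metis
      then show ?thesis using True by simp
    qed (use pos in simp)
  qed
  then show ?thesis unfolding energy_def set_lebesgue_integral_def by simp
qed

text \<open>Beyond \<open>R |J|\<close> the weight integrates to at most \<open>\<delta> |J| / 2\<close>, so half of the density comes from the dilate. Low energy
leaves little room for \<open>V\<close> in the rescaled \<open>[a, b]\<close>, where \<open>w\<^sup>2 \<ge> c\<close>; the threshold for the energy makes
the second average at most half of the lower bound for the first.\<close>

lemma dense_low_energy_step:
  assumes V: "V \<in> lmeasurable" and J: "J \<in> D"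
    and c: "0 < c" "\<And>t. t \<in> {a..b} \<Longrightarrow> c \<le> (w t)\<^sup>2" and ab: "a < b"
    and \<delta>: "0 < \<delta>" "\<delta> \<le> local_density V J" and R: "R = 2 ^ m" "16 / \<delta> \<le> R"
    and \<eta>: "energy V J \<le> c * (b - a) * \<delta> / (8 * R)"
  shows "\<delta> / (8 * R) * ilength J \<le> L2_inner (indicator V) (step R a b J)"
proof -
  define s where "s = ilength J"
  have s: "0 < s" using length_pos[OF J] by (simp add: s_def)
  have Rpos: "0 < R" using R(1) by simp
  let ?N = "scaled (-R) R J"
  have Nball: "?N = cball (icenter J) (2 ^ m * ilength J)"
    by (simp add: scaled_def cball_eq_atLeastAtMost R(1))
  have VN: "V \<inter> ?N \<in> lmeasurable" "V - ?N \<in> lmeasurable"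
    using V scaled_lmeasurable by (auto intro: fmeasurable_Int_fmeasurable fmeasurable_Diff fmeasurableD)
  have "mass 2 (V - ?N) J \<le> 16 / 2 ^ Suc m * ilength J"
  proof (rule mass_tail_le[OF VN(2) J])
    fix k assume "k < Suc m"
    then have "2 ^ k * ilength J \<le> 2 ^ m * ilength J"
      using s by (intro mult_right_mono power_increasing) (auto simp: s_def)
    then show "(V - ?N) \<inter> cball (icenter J) (2 ^ k * ilength J) = {}"
      unfolding Nball using subset_cball by blast
  qed
  also have "\<dots> = 8 / R * s" by (simp add: R(1) s_def)
  also have "\<dots> \<le> \<delta> / 2 * s"
    using R(2) \<delta>(1) Rpos s by (intro mult_right_mono) (auto simp: field_simps)
  finally have tail: "mass 2 (V - ?N) J \<le> \<delta> / 2 * s" .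
  have "\<delta> * s \<le> mass 2 V J" using \<delta>(2) s mass_eq_density[OF J, of V] by (simp add: s_def)
  also have "\<dots> = mass 2 (V \<inter> ?N) J + mass 2 (V - ?N) J"
    using scaled_lmeasurable by (intro mass_split V fmeasurableD)
  also have "\<dots> \<le> vol (V \<inter> ?N) + \<delta> / 2 * s"
    using tail mass_le_measure[OF VN(1)] by (intro add_mono)
  finally have N: "\<delta> / 2 * s \<le> vol (V \<inter> ?N)" by simp
  have "c * vol (V \<inter> scaled a b J) \<le> s * energy V J"
    unfolding s_def using c by (intro measure_scaled_le_energy V J) auto
  also have "\<dots> \<le> s * (c * (b - a) * \<delta> / (8 * R))" using \<eta> s by (intro mult_left_mono) auto
  also have "\<dots> = c * ((b - a) * (\<delta> / (8 * R) * s))" by simp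
  finally have "vol (V \<inter> scaled a b J) \<le> (b - a) * (\<delta> / (8 * R) * s)" using c(1) by (simp only: mult_le_cancel_left_pos)
  then have H: "vol (V \<inter> scaled a b J) / (b - a) \<le> \<delta> / (8 * R) * s"
    using ab by (simp add: divide_le_eq mult.commute)
  have "2 * (\<delta> / (8 * R) * s) = (\<delta> / 2 * s) / (2 * R)" using Rpos by simp
  also have "\<dots> \<le> vol (V \<inter> ?N) / (2 * R)" using N Rpos by (intro divide_right_mono) auto
  finally show ?thesis using H inner_step[OF V, of R a b J] by (simp add: s_def)
qed

text \<open>The lengths are summed with the Bessel inequality for step functions, and \<open>\<tau>\<close> remains free to make the
total small, because neither \<open>R\<close> nor the Bessel constant involves it.\<close>

lemma dense_low_energy_sum_le:
  assumes V: "V \<in> lmeasurable" and F: "finite F" "F \<subseteq> D"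
    and c: "0 < c" "\<And>t. t \<in> {a..b} \<Longrightarrow> c \<le> (w t)\<^sup>2"
    and ab: "a < b" "- R \<le> a" "b \<le> R" and \<delta>: "0 < \<delta>" and R: "R = 2 ^ m" "16 / \<delta> \<le> R"
    and \<tau>: "0 < \<tau>" and \<eta>: "\<eta> \<le> c * (b - a) * \<delta> / (8 * R)" "C * \<eta> / \<tau>\<^sup>2 \<le> 16 * \<tau>"
    and bad: "\<And>J. J \<in> F \<Longrightarrow> \<delta> \<le> local_density V J \<and> energy V J \<le> \<eta>"
  shows "(\<Sum>J\<in>F. (coef V J)\<^sup>2)
    \<le> (32 * \<tau>)\<^sup>2 * ((8 * R / \<delta>)\<^sup>2 * (640 * (1 / (2 * R) + 1 / (b - a)) * (1 + 2 * R)\<^sup>2)) * vol V"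
proof -
  have Rpos: "0 < R" using R(1) by simp
  have "(\<Sum>J\<in>F. (coef V J)\<^sup>2)
      \<le> (\<Sum>J\<in>F. (32 * \<tau>)\<^sup>2 * ((8 * R / \<delta>)\<^sup>2 * ((L2_inner (indicator V) (step R a b J))\<^sup>2 / ilength J)))"
  proof (rule sum_mono)
    fix J assume JF: "J \<in> F"
    then have J: "J \<in> D" "0 < ilength J" using F(2) length_pos by auto
    define \<alpha> where "\<alpha> = L2_inner (indicator V) (step R a b J)"
    have "energy V J \<le> c * (b - a) * \<delta> / (8 * R)" using bad[OF JF] \<eta>(1) by linarith
    then have "\<delta> / (8 * R) * ilength J \<le> \<alpha>"
      unfolding \<alpha>_def using bad[OF JF] by (intro dense_low_energy_step[OF V J(1) c ab(1) \<delta> _ R]) auto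
    then have "(\<delta> / (8 * R) * ilength J)\<^sup>2 \<le> \<alpha>\<^sup>2" using \<delta> Rpos J by (intro power_mono) auto
    then have len: "ilength J \<le> (8 * R / \<delta>)\<^sup>2 * (\<alpha>\<^sup>2 / ilength J)"
      using \<delta> Rpos J by (simp add: power_mult_distrib power_divide) (simp add: field_simps power2_eq_square)
    have "C / \<tau>\<^sup>2 * energy V J \<le> C / \<tau>\<^sup>2 * \<eta>"
      using bad[OF JF] C_nonneg \<tau> by (intro mult_left_mono) auto
    then have "16 * \<tau> + C / \<tau>\<^sup>2 * energy V J \<le> 32 * \<tau>" using \<eta>(2) by simp
    then have "\<bar>coef V J\<bar> \<le> sqrt (ilength J) * (32 * \<tau>)"
      using coef_le_energy[OF V J(1) \<tau>] J(2) by (meson mult_left_mono order_trans real_sqrt_ge_zero less_imp_le)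
    then have "\<bar>coef V J\<bar>\<^sup>2 \<le> (sqrt (ilength J) * (32 * \<tau>))\<^sup>2" by (intro power_mono) auto
    also have "\<dots> = (32 * \<tau>)\<^sup>2 * ilength J" using J(2) by (simp add: power_mult_distrib)
    also have "\<dots> \<le> (32 * \<tau>)\<^sup>2 * ((8 * R / \<delta>)\<^sup>2 * (\<alpha>\<^sup>2 / ilength J))"
      using len by (intro mult_left_mono) auto
    finally show "(coef V J)\<^sup>2 \<le> (32 * \<tau>)\<^sup>2 * ((8 * R / \<delta>)\<^sup>2 * ((L2_inner (indicator V) (step R a b J))\<^sup>2 / ilength J))"
      by (simp add: \<alpha>_def)
  qed
  also have "\<dots> = (32 * \<tau>)\<^sup>2 * ((8 * R / \<delta>)\<^sup>2 * (\<Sum>J\<in>F. (L2_inner (indicator V) (step R a b J))\<^sup>2 / ilength J))"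
    by (simp only: sum_distrib_left)
  also have "\<dots> \<le> (32 * \<tau>)\<^sup>2 * ((8 * R / \<delta>)\<^sup>2 * (640 * (1 / (2 * R) + 1 / (b - a)) * (1 + 2 * R)\<^sup>2 * vol V))"
    by (intro mult_left_mono step_bessel Rpos ab V F) auto
  finally show ?thesis by (simp add: mult.assoc)
qed

section \<open>The lower bound\<close>

lemma square_function_integral_ge:
  assumes V: "V \<in> lmeasurable" and G: "finite G" "G \<subseteq> D"
  shows "ennreal (\<Sum>J\<in>G. (coef V J)\<^sup>2 * energy V J)
    \<le> (\<integral>\<^sup>+x\<in>V. (wavelet_square_function D w (indicator V) x)\<^sup>2 \<partial>lebesgue)"
proof -
  have Vs: "V \<in> sets lebesgue" using V by (rule fmeasurableD)
  have meas: "(\<lambda>x. wavelet w J x) \<in> borel_measurable lebesgue" if "J \<in> D" for J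
    using L2_measurable[OF wavelet_L2[OF that]] .
  have one: "(\<integral>\<^sup>+x. ennreal ((coef V J)\<^sup>2 * (wavelet w J x)\<^sup>2) * indicator V x \<partial>lebesgue) = ennreal ((coef V J)\<^sup>2 * energy V J)"
    if "J \<in> D" for J
  proof -
    have "(\<integral>\<^sup>+x. ennreal ((coef V J)\<^sup>2 * (wavelet w J x)\<^sup>2) * indicator V x \<partial>lebesgue)
        = (\<integral>\<^sup>+x. ennreal ((coef V J)\<^sup>2 * (indicator V x *\<^sub>R (wavelet w J x)\<^sup>2)) \<partial>lebesgue)"
      by (intro nn_integral_cong) (auto simp: indicator_def)
    also have "\<dots> = ennreal (\<integral>x. (coef V J)\<^sup>2 * (indicator V x *\<^sub>R (wavelet w J x)\<^sup>2) \<partial>lebesgue)"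
    proof (rule nn_integral_eq_integral)
      show "integrable lebesgue (\<lambda>x. (coef V J)\<^sup>2 * (indicator V x *\<^sub>R (wavelet w J x)\<^sup>2))"
        using energy_integrable[OF Vs that] unfolding set_integrable_def by (rule integrable_mult_right)
    qed auto
    also have "(\<integral>x. (coef V J)\<^sup>2 * (indicator V x *\<^sub>R (wavelet w J x)\<^sup>2) \<partial>lebesgue) = (coef V J)\<^sup>2 * energy V J"
      unfolding energy_def set_lebesgue_integral_def by (rule integral_mult_right_zero)
    finally show ?thesis .
  qed
  have "ennreal (\<Sum>J\<in>G. (coef V J)\<^sup>2 * energy V J) = (\<Sum>J\<in>G. ennreal ((coef V J)\<^sup>2 * energy V J))"
    by (intro sum_ennreal[symmetric]) (simp add: energy_nonneg)
  also have "\<dots> = (\<Sum>J\<in>G. \<integral>\<^sup>+x. ennreal ((coef V J)\<^sup>2 * (wavelet w J x)\<^sup>2) * indicator V x \<partial>lebesgue)"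
    using G(2) one by (intro sum.cong) auto
  also have "\<dots> = (\<integral>\<^sup>+x. (\<Sum>J\<in>G. ennreal ((coef V J)\<^sup>2 * (wavelet w J x)\<^sup>2) * indicator V x) \<partial>lebesgue)"
  proof (rule nn_integral_sum[symmetric])
    fix J assume "J \<in> G"
    then have [measurable]: "wavelet w J \<in> borel_measurable lebesgue" using meas G(2) by blast
    have [measurable]: "V \<in> sets lebesgue" by (rule Vs)
    show "(\<lambda>x. ennreal ((coef V J)\<^sup>2 * (wavelet w J x)\<^sup>2) * indicator V x) \<in> borel_measurable lebesgue"
      by measurable
  qed
  also have "\<dots> \<le> (\<integral>\<^sup>+x. (wavelet_square_function D w (indicator V) x)\<^sup>2 * indicator V x \<partial>lebesgue)"
  proof (rule nn_integral_mono)
    fix x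
    have "(\<Sum>J\<in>G. ennreal ((coef V J)\<^sup>2 * (wavelet w J x)\<^sup>2)) \<le> (\<Sum>\<^sub>\<infinity>J\<in>D. ennreal ((coef V J)\<^sup>2 * (wavelet w J x)\<^sup>2))"
      using G by (subst nonneg_infsum_complete) (auto intro!: SUP_upper)
    then show "(\<Sum>J\<in>G. ennreal ((coef V J)\<^sup>2 * (wavelet w J x)\<^sup>2) * indicator V x)
        \<le> (wavelet_square_function D w (indicator V) x)\<^sup>2 * indicator V x"
      unfolding wavelet_square_function_power2 coef_def sum_distrib_right[symmetric]
      by (intro mult_right_mono) auto
  qed
  finally show ?thesis .
qed

theorem square_function_lower_bound:
  assumes c: "0 < c" "\<And>t. t \<in> {a..b} \<Longrightarrow> c \<le> (w t)\<^sup>2" and ab: "a < b"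
  shows "\<exists>\<eta>::real. \<eta> > 0 \<and> (\<forall>V\<in>lmeasurable.
    (\<integral>\<^sup>+x\<in>V. (wavelet_square_function D w (indicator V) x)\<^sup>2 \<partial>lebesgue) \<ge> ennreal \<eta> * emeasure lebesgue V)"
proof -
  define A where "A = 179200 * C\<^sup>2 + 1"
  define B where "B = 8 + 1024 * C\<^sup>2"
  define \<epsilon> where "\<epsilon> = 1 / (8 * A)"
  define \<delta> where "\<delta> = min 1 (\<epsilon> / (1280 * B))"
  have A: "0 < A" and B: "0 < B" by (simp_all add: A_def B_def add_nonneg_pos add_pos_nonneg)
  have \<epsilon>: "0 < \<epsilon>" "A * \<epsilon> = 1 / 8" using A by (simp_all add: \<epsilon>_def)
  have \<delta>: "0 < \<delta>" "\<delta> \<le> 1" "\<delta> \<le> \<epsilon> / (1280 * B)" using \<epsilon> B by (simp_all add: \<delta>_def)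
  have "B * \<delta> * (160 / \<epsilon>) \<le> B * (\<epsilon> / (1280 * B)) * (160 / \<epsilon>)"
    using \<delta>(3) B \<epsilon> by (intro mult_right_mono mult_left_mono) auto
  then have B\<delta>: "B * \<delta> * (160 / \<epsilon>) \<le> 1 / 8" using B \<epsilon> by simp
  obtain m where m: "max (16 / \<delta>) (max \<bar>a\<bar> \<bar>b\<bar>) < (2::real) ^ m" 
    using real_arch_pow[of 2 "max (16 / \<delta>) (max \<bar>a\<bar> \<bar>b\<bar>)"] by (auto simp del: max_less_iff_conj)
  define R :: real where "R = 2 ^ m"
  have R: "0 < R" "16 / \<delta> \<le> R" "- R \<le> a" "b \<le> R" using m by (auto simp: R_def)
  define S where "S = (8 * R / \<delta>)\<^sup>2 * (640 * (1 / (2 * R) + 1 / (b - a)) * (1 + 2 * R)\<^sup>2)"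
  have S: "0 \<le> S" using R ab by (simp add: S_def)
  \<comment> \<open>This makes \<open>(32 \<tau>)\<^sup>2 S = S / (1 + 8 S)\<^sup>2\<close>.\<close>
  define \<tau> where "\<tau> = 1 / (32 * (1 + 8 * S))"
  have \<tau>: "0 < \<tau>" using S by (simp add: \<tau>_def)
  have \<tau>S: "(32 * \<tau>)\<^sup>2 * S \<le> 1 / 8"
  proof -
    have "8 * S \<le> (1 + 8 * S)\<^sup>2" using S by (simp add: power2_eq_square algebra_simps)
    moreover have "32 * \<tau> = 1 / (1 + 8 * S)" using S by (simp add: \<tau>_def field_simps)
    moreover have "0 < (1 + 8 * S)\<^sup>2" using S by (intro zero_less_power) simp
    ultimately show ?thesis by (simp add: power_divide divide_le_eq)
  qed
  \<comment> \<open>The first bound is the threshold of the step-function argument; the second one makes the energy term in the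
coefficient bound at most \<open>16 \<tau>\<close>, with \<open>C + 1\<close> in place of \<open>C\<close> to avoid division by zero.\<close>
  define \<eta> where "\<eta> = min (c * (b - a) * \<delta> / (8 * R)) (16 * \<tau> * \<tau>\<^sup>2 / (C + 1))"
  have \<eta>: "0 < \<eta>" "\<eta> \<le> c * (b - a) * \<delta> / (8 * R)"
    using c ab \<delta> R \<tau> C_nonneg by (simp_all add: \<eta>_def)
  have "\<eta> * (C + 1) \<le> 16 * \<tau> * \<tau>\<^sup>2"
    using C_nonneg by (simp add: \<eta>_def pos_le_divide_eq[symmetric])
  then have "C * \<eta> \<le> 16 * \<tau> * \<tau>\<^sup>2" using \<eta>(1) by (simp add: algebra_simps)
  then have \<eta>C: "C * \<eta> / \<tau>\<^sup>2 \<le> 16 * \<tau>" using \<tau> by (simp add: divide_le_eq)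
  have main: "ennreal (\<eta> / 2) * emeasure lebesgue V
      \<le> (\<integral>\<^sup>+x\<in>V. (wavelet_square_function D w (indicator V) x)\<^sup>2 \<partial>lebesgue)" if V: "V \<in> lmeasurable" for V
  proof (cases "vol V = 0")
    case True
    then have "emeasure lebesgue V = 0" using V by (simp add: emeasure_eq_measure2)
    then show ?thesis by simp
  next
    case False
    define \<mu> where "\<mu> = vol V"
    have \<mu>: "0 < \<mu>" using False by (simp add: \<mu>_def zero_less_measure_iff)
    obtain F where F: "finite F" "F \<subseteq> D" "\<mu> - \<mu> / 8 < (\<Sum>J\<in>F. (coef V J)\<^sup>2)"
      using bessel_approximation[OF basis L2_indicator[OF V], of "\<mu> / 8"] \<mu>
      by (auto simp: L2_inner_indicator V \<mu>_def coef_def)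
    define F1 where "F1 = F \<inter> sparse V \<epsilon>"
    define F2 where "F2 = {J \<in> F - sparse V \<epsilon>. local_density V J < \<delta>}"
    define F3 where "F3 = {J \<in> F. \<delta> \<le> local_density V J \<and> energy V J \<le> \<eta>}"
    define G where "G = {J \<in> F. \<eta> < energy V J}"
    have fin: "finite F1" "finite F2" "finite F3" "finite G" using F(1) by (simp_all add: F1_def F2_def F3_def G_def)
    have sub: "F1 \<subseteq> D" "F2 \<subseteq> D" "F3 \<subseteq> D" "G \<subseteq> D" using F(2) by (auto simp: F1_def F2_def F3_def G_def)
    let ?s = "\<lambda>X. \<Sum>J\<in>X. (coef V J)\<^sup>2"
    have Un: "?s (X \<union> Y) \<le> ?s X + ?s Y" if "finite X" "finite Y" for X Y
      using that by (simp add: sum_Un sum_nonneg)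
    have "?s F \<le> ?s (F1 \<union> (F2 \<union> (F3 \<union> G)))"
      using fin by (intro sum_mono2) (auto simp: F1_def F2_def F3_def G_def)
    also have "\<dots> \<le> ?s F1 + (?s F2 + (?s F3 + ?s G))"
      using Un[of F1 "F2 \<union> (F3 \<union> G)"] Un[of F2 "F3 \<union> G"] Un[of F3 G] fin by simp
    finally have total: "?s F \<le> ?s F1 + (?s F2 + (?s F3 + ?s G))" .
    have 1: "?s F1 \<le> \<mu> / 8"
    proof -
      have "?s F1 \<le> A * \<epsilon> * \<mu>"
        unfolding A_def \<mu>_def by (rule sparse_sum_le[OF V \<epsilon>(1) fin(1)]) (simp add: F1_def)
      then show ?thesis by (simp add: \<epsilon>(2))
    qed
    have 2: "?s F2 \<le> \<mu> / 8"
    proof -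
      have "?s F2 \<le> B * \<delta> * (160 / \<epsilon>) * \<mu>"
        unfolding B_def \<mu>_def by (rule low_density_sum_le[OF V \<epsilon>(1) \<delta>(1,2) fin(2) sub(2)]) (simp add: F2_def)
      also have "\<dots> \<le> 1 / 8 * \<mu>" using B\<delta> \<mu> by (intro mult_right_mono) auto
      finally show ?thesis by simp
    qed
    have 3: "?s F3 \<le> \<mu> / 8"
    proof -
      have "?s F3 \<le> (32 * \<tau>)\<^sup>2 * S * \<mu>"
        unfolding S_def \<mu>_def
        by (rule dense_low_energy_sum_le[OF V fin(3) sub(3) c ab R(3,4) \<delta>(1) R_def R(2) \<tau> \<eta>(2) \<eta>C])
          (auto simp: F3_def)
      also have "\<dots> \<le> 1 / 8 * \<mu>" using \<tau>S \<mu> by (intro mult_right_mono) auto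
      finally show ?thesis by simp
    qed
    have "\<mu> / 2 \<le> ?s G" using total 1 2 3 F(3) by linarith
    then have "\<eta> / 2 * \<mu> \<le> \<eta> * ?s G" using \<eta>(1) by simp
    also have "\<dots> \<le> (\<Sum>J\<in>G. (coef V J)\<^sup>2 * energy V J)"
      unfolding sum_distrib_left
    proof (rule sum_mono)
      fix J assume "J \<in> G"
      then have "\<eta> \<le> energy V J" by (simp add: G_def)
      then show "\<eta> * (coef V J)\<^sup>2 \<le> (coef V J)\<^sup>2 * energy V J"
        by (subst mult.commute) (intro mult_left_mono, auto)
    qed
    finally have "ennreal (\<eta> / 2 * \<mu>) \<le> ennreal (\<Sum>J\<in>G. (coef V J)\<^sup>2 * energy V J)" by (rule ennreal_leI)
    also have "\<dots> \<le> (\<integral>\<^sup>+x\<in>V. (wavelet_square_function D w (indicator V) x)\<^sup>2 \<partial>lebesgue)"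
      by (rule square_function_integral_ge[OF V fin(4) sub(4)])
    finally show ?thesis
      using ennreal_mult[of "\<eta> / 2" \<mu>] \<eta>(1) \<mu> emeasure_eq_measure2[OF V] by (simp only: \<mu>_def)
  qed
  show ?thesis using main \<eta>(1) by (intro exI[of _ "\<eta> / 2"]) auto
qed

end

theorem theorem3p1:
  fixes D :: "real set set" and w :: "real \<Rightarrow> real"
  assumes "dyadic_grid D"
    and "C2_function w"
    and "\<And>r::real. r > 1 \<Longrightarrow> \<exists>C. \<forall>x. \<bar>w x\<bar> \<le> C * (1 + \<bar>x\<bar>) powr (-r)"
    and "L2_orthonormal_basis D (wavelet w)"
  shows "\<exists>\<eta>::real. \<eta> > 0 \<and> (\<forall>V\<in>lmeasurable.
           (\<integral>\<^sup>+x\<in>V. (wavelet_square_function D w (indicator V) x)\<^sup>2 \<partial>lebesgue)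
             \<ge> ennreal \<eta> * emeasure lebesgue V)"
proof -
  obtain C where C: "\<And>x. \<bar>w x\<bar> \<le> C * (1 + \<bar>x\<bar>) powr (-8)" using assms(3)[of 8] by auto
  have "\<bar>w x\<bar> \<le> C / (1 + \<bar>x\<bar>) ^ 8" for x
  proof -
    have "(1 + \<bar>x\<bar>) powr (-8) = 1 / (1 + \<bar>x\<bar>) ^ 8"
      using powr_minus_divide[of "1 + \<bar>x\<bar>" 8] powr_numeral[of "1 + \<bar>x\<bar>" "num.Bit0 (num.Bit0 (num.Bit0 num.One))"] by simp
    then show ?thesis using C[of x] by simp
  qed
  then interpret wavelet_basis D w C using assms(1,4) by unfold_locales
  have cont: "isCont w x" for x
    using assms(2) unfolding C2_function_def by (meson DERIV_isCont)
  obtain x0 where x0: "w x0 \<noteq> 0"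
  proof (rule ccontr)
    assume "\<not> thesis"
    then have "w = (\<lambda>x. 0)" using that by blast
    moreover obtain J where "J \<in> D" using cell_exists by blast
    ultimately show False using basis_orthonormal[OF basis, of J J] by (simp add: wavelet_def[abs_def] L2_inner_def)
  qed
  then have "0 < (w x0)\<^sup>2 / 2" by simp
  moreover have "isCont (\<lambda>x. (w x)\<^sup>2) x0" using cont by (intro continuous_intros)
  ultimately obtain d where d: "0 < d" "\<And>x. \<bar>x - x0\<bar> < d \<Longrightarrow> \<bar>(w x)\<^sup>2 - (w x0)\<^sup>2\<bar> < (w x0)\<^sup>2 / 2"
    unfolding continuous_at_eps_delta dist_real_def by blast
  have "(w x0)\<^sup>2 / 2 \<le> (w x)\<^sup>2" if "x \<in> {x0..x0 + d / 2}" for x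
  proof -
    have "\<bar>x - x0\<bar> < d" using that d(1) by auto
    from d(2)[OF this] show ?thesis by linarith
  qed
  then show ?thesis
    using square_function_lower_bound[of "(w x0)\<^sup>2 / 2" x0 "x0 + d / 2"] \<open>0 < (w x0)\<^sup>2 / 2\<close> d(1) by auto
qed

end
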